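(* Let $k\{Y\}=k\{y_1,\ldots,y_l\}$ be a ring of differential polynomials over a differential field $k$ of characteristic zero, with a fixed ranking. Let $F\subset k\{Y\}$ be a finite set such that the radical differential ideal $\{F\}$ is characterizable. Let $\mathbb{C}_1,\ldots,\mathbb{C}_n$ be the output of the Rosenfeld–Gröbner algorithm applied to $F$, so that $$\{F\}=\bigcap_{i=1}^n[\mathbb{C}_i]:H_{\mathbb{C}_i}^\infty,$$ where each $[\mathbb{C}_i]:H_{\mathbb{C}_i}^\infty$ is a characterizable differential ideal with characteristic set $\mathbb{C}_i$. Let $\mathbb{C}_{i_1},\ldots,\mathbb{C}_{i_r}$ be those among the $\mathbb{C}_i$ whose sets of leaders have the highest possible rank, let $L$ be the set of leaders of $\mathbb{C}_{i_1}$, $N=\Theta Y\setminus\Theta L$, and $$I'=\bigcap_{j=1}^r(\mathbb{C}_{i_j}):H_{\mathbb{C}_{i_j}}^\infty .$$ Let $GB$ be the reduced Gröbner basis of $I'$ in $k(N)[L]$ with respect to $>_{\rm lex}$, and let $\mathbb{D}$ be obtained from $GB$ by clearing out denominators (multiplying each element by the least common multiple in $k[N]$ of the denominators of its coefficients) and dividing each resulting element by its leading coefficient from $k$ (so that its initial has leading coefficient $1$). Then $\mathbb{D}$ is the canonical characteristic set of the characterizable differential ideal $\{F\}$.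
   Context: $\Delta=\{\delta_1,\ldots,\delta_m\}$ is a finite set of commuting derivations, $\Theta$ the free commutative monoid of derivative operators they generate. $k\{Y\}$ is the polynomial ring over $k$ in the differential variables $\Theta Y=\{\theta y_j\}$. $(F)$, $[F]$, $\{F\}$ denote the ideal, differential ideal and radical differential ideal generated by $F$. A ranking is a total order on $\Theta Y$ such that $\theta u\geq u$ and ($u\geq v\Rightarrow\theta u\geq\theta v$). The leader $u_f$ of $f\notin k$ is the highest differential variable in $f$; if $d=\deg_{u_f}f$, the initial $I_f$ is the coefficient of $u_f^d$, the separant is $S_f=\partial f/\partial u_f$, and the rank is $u_f^d$. Ranks are compared by $u^{d}>v^{e}$ iff $u>v$, or $u=v$ and $d>e$. $f$ is reduced with respect to $g$ if no proper derivative of $u_g$ appears in $f$ and $\deg_{u_g}f<\deg_{u_g}g$. A set $\mathbb{A}\subset k\{Y\}\setminus k$ is autoreduced if each element is reduced with respect to all the others; such sets are finite and written in order of increasing rank. $\mathbb{A}=A_1,\ldots,A_r$ has lower rank than $\mathbb{B}=B_1,\ldots,B_s$ if there is $j\le r,s$ with $\operatorname{rank}A_i=\operatorname{rank}B_i$ for $i<j$ and $\operatorname{rank}A_j<\operatorname{rank}B_j$, or if $r>s$ and $\operatorname{rank}A_i=\operatorname{rank}B_i$ for $1\le i\le s$. Sets of leaders are ranked in the same way (listed increasingly, ignoring degrees: the set is treated as an autoreduced set). A characteristic set of an ideal is an autoreduced subset of it of lowest rank. $H_{\mathbb{A}}$ is the product of the initials and separants of the elements of $\mathbb{A}$, and $J:H_{\mathbb{A}}^\infty=\{a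 : H_{\mathbb{A}}^m a\in J\text{ for some }m\geq0\}$. A differential ideal $I$ is characterizable if $I=[\mathbb{A}]:H_{\mathbb{A}}^\infty$ for some characteristic set $\mathbb{A}$ of $I$. The algebraic ideals $(\mathbb{C}_{i_j}):H_{\mathbb{C}_{i_j}}^\infty$ are taken in $k[N][L]$, and $k(N)$ is the fraction field of $k[N]$; the Gröbner basis is that of the ideal generated by $I'$ in $k(N)[L]$. $>_{\rm lex}$ is the lexicographic order on power products of differential variables induced by the ranking. A characteristic set $\mathbb{C}=C_1,\ldots,C_p$ of a characterizable ideal $I$, with leaders $L$ and non-leaders $N=\Theta Y\setminus\Theta L$, is canonical if (1) $I_{C_i}\in k[N]$ for all $i$; (2) for each $i$, $C_i$ has no factors in $k[N]$ (other than constants of $k$), and the coefficient in $I_{C_i}$ of its leading monomial with respect to $>_{\rm lex}$ equals $1$. The canonical characteristic set exists and is unique. *)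

theory Defs
  imports
    "HOL.Hull"
    "HOL-Library.Poly_Mapping"
    "HOL-Library.Countable"
    "HOL-Computational_Algebra.Fraction_Field"
begin

section \<open>Differential variables and differential polynomials\<close>

text \<open>
  The derivations are indexed by a finite type \<open>'d\<close> and the differential indeterminates by a
  finite type \<open>'y\<close>. A derivative operator is an exponent vector \<open>\<theta> :: 'd \<Rightarrow> nat\<close>, and
  \<open>DVar \<theta> y\<close> is the differential variable \<open>\<theta> y\<close>.
\<close>

datatype ('d, 'y) dvar = DVar (dops: "'d \<Rightarrow> nat") (indet: 'y)

instance dvar :: (finite, finite) countable
proof
  have "inj (\<lambda>v :: ('a, 'b) dvar. to_nat (dops v, indet v))"
    by (rule injI) (auto intro: dvar.expand)
  then show "\<exists>to_nat :: ('a, 'b) dvar \<Rightarrow> nat. inj to_nat" by blast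
qed

text \<open>
  The order below is arbitrary and is unrelated to rankings. It is here only because the library
  instance \<open>poly_mapping :: idom\<close> asks for a linear order on the monomials.
\<close>

instantiation dvar :: (finite, finite) linorder
begin

definition less_eq_dvar :: "('a, 'b) dvar \<Rightarrow> ('a, 'b) dvar \<Rightarrow> bool"
  where "less_eq_dvar u v \<longleftrightarrow> to_nat u \<le> to_nat v"

definition less_dvar :: "('a, 'b) dvar \<Rightarrow> ('a, 'b) dvar \<Rightarrow> bool"
  where "less_dvar u v \<longleftrightarrow> to_nat u < to_nat v"

instance
  by standard (auto simp: less_eq_dvar_def less_dvar_def)

end

abbreviation "lookup \<equiv> Poly_Mapping.lookup"
abbreviation "keys \<equiv> Poly_Mapping.keys"
abbreviation "single \<equiv> Poly_Mapping.single"

type_synonym 'v mono = "'v \<Rightarrow>\<^sub>0 nat"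
type_synonym ('v, 'a) mpoly = "'v mono \<Rightarrow>\<^sub>0 'a"
type_synonym ('d, 'y, 'k) dpoly = "(('d, 'y) dvar, 'k) mpoly"

definition act :: "('d \<Rightarrow> nat) \<Rightarrow> ('d, 'y) dvar \<Rightarrow> ('d, 'y) dvar"
  where "act \<theta> v = DVar (\<lambda>d. \<theta> d + dops v d) (indet v)"

definition derivatives :: "('d, 'y) dvar set \<Rightarrow> ('d, 'y) dvar set"
  where "derivatives U = {act \<theta> u | \<theta> u. u \<in> U}"

definition vars :: "('v, 'a::zero) mpoly \<Rightarrow> 'v set"
  where "vars p = (\<Union>m\<in>keys p. keys m)"

text \<open>\<open>polys_in V\<close> is the subring \<open>k[V]\<close>; in particular \<open>polys_in {}\<close> is \<open>k\<close>.\<close>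

definition polys_in :: "'v set \<Rightarrow> ('v, 'a::zero) mpoly set"
  where "polys_in V = {p. vars p \<subseteq> V}"

definition Const :: "'a::zero \<Rightarrow> ('v, 'a) mpoly"
  where "Const c = single 0 c"

definition Var :: "'v \<Rightarrow> ('v, 'a::zero_neq_one) mpoly"
  where "Var v = single (single v 1) 1"

definition deg_in :: "'v \<Rightarrow> ('v, 'a::zero) mpoly \<Rightarrow> nat"
  where "deg_in v p = Max (insert 0 ((\<lambda>m. lookup m v) ` keys p))"

text \<open>The coefficient of \<open>v ^ e\<close> in \<open>p\<close>, viewed as a univariate polynomial in \<open>v\<close>.\<close>

definition coeff_in :: "'v \<Rightarrow> nat \<Rightarrow> ('v, 'a::comm_monoid_add) mpoly \<Rightarrow> ('v, 'a) mpoly"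
  where "coeff_in v e p =
    (\<Sum>m | m \<in> keys p \<and> lookup m v = e.
       single (m - single v e) (lookup p m))"

definition pdiff :: "'v \<Rightarrow> ('v, 'a::semiring_1) mpoly \<Rightarrow> ('v, 'a) mpoly"
  where "pdiff v p =
    (\<Sum>m\<in>keys p. single (m - single v 1)
                     (of_nat (lookup m v) * lookup p m))"

definition commuting_derivations :: "('d \<Rightarrow> 'k::field \<Rightarrow> 'k) \<Rightarrow> bool"
  where "commuting_derivations \<delta> \<longleftrightarrow>
    (\<forall>d a b. \<delta> d (a + b) = \<delta> d a + \<delta> d b) \<and>
    (\<forall>d a b. \<delta> d (a * b) = \<delta> d a * b + a * \<delta> d b) \<and>
    (\<forall>d e a. \<delta> d (\<delta> e a) = \<delta> e (\<delta> d a))"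

text \<open>
  The extension of the derivation \<open>\<delta> d\<close> to differential polynomials: apply \<open>\<delta> d\<close> to the
  coefficients, and add the chain rule terms coming from \<open>v \<mapsto> \<delta> d v\<close>.
\<close>

definition dderiv :: "('d \<Rightarrow> 'k::field \<Rightarrow> 'k) \<Rightarrow> 'd \<Rightarrow> ('d, 'y, 'k) dpoly \<Rightarrow> ('d, 'y, 'k) dpoly"
  where "dderiv \<delta> d p =
    (\<Sum>m\<in>keys p. single m (\<delta> d (lookup p m))) +
    (\<Sum>v\<in>vars p. pdiff v p * Var (act (\<lambda>e. if e = d then 1 else 0) v))"


section \<open>Ideals\<close>

definition ideal_in :: "'a::comm_ring_1 set \<Rightarrow> 'a set \<Rightarrow> bool"
  where "ideal_in R I \<longleftrightarrow> I \<subseteq> R \<and> 0 \<in> I \<and>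
    (\<forall>a\<in>I. \<forall>b\<in>I. a + b \<in> I) \<and> (\<forall>r\<in>R. \<forall>a\<in>I. r * a \<in> I)"

definition diff_ideal :: "('d \<Rightarrow> 'k::field \<Rightarrow> 'k) \<Rightarrow> ('d, 'y, 'k) dpoly set \<Rightarrow> bool"
  where "diff_ideal \<delta> I \<longleftrightarrow> ideal_in UNIV I \<and> (\<forall>d. \<forall>a\<in>I. dderiv \<delta> d a \<in> I)"

definition radical_diff_ideal :: "('d \<Rightarrow> 'k::field \<Rightarrow> 'k) \<Rightarrow> ('d, 'y, 'k) dpoly set \<Rightarrow> bool"
  where "radical_diff_ideal \<delta> I \<longleftrightarrow> diff_ideal \<delta> I \<and> (\<forall>a n. a ^ n \<in> I \<longrightarrow> a \<in> I)"

text \<open>The saturation \<open>J : h\<^sup>\<infinity>\<close> in the ring \<open>R\<close>.\<close>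

definition saturation :: "'a::comm_ring_1 set \<Rightarrow> 'a set \<Rightarrow> 'a \<Rightarrow> 'a set"
  where "saturation R J h = {a \<in> R. \<exists>m. h ^ m * a \<in> J}"


section \<open>Rankings and characteristic sets\<close>

text \<open>A ranking is given by its non-strict order \<open>le\<close>.\<close>

definition ranking :: "(('d, 'y) dvar \<Rightarrow> ('d, 'y) dvar \<Rightarrow> bool) \<Rightarrow> bool"
  where "ranking le \<longleftrightarrow> reflp le \<and> transp le \<and> antisymp le \<and> totalp le \<and>
    (\<forall>\<theta> u. le u (act \<theta> u)) \<and> (\<forall>\<theta> u v. le u v \<longrightarrow> le (act \<theta> u) (act \<theta> v))"

definition strict :: "('v \<Rightarrow> 'v \<Rightarrow> bool) \<Rightarrow> 'v \<Rightarrow> 'v \<Rightarrow> bool"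
  where "strict le u v \<longleftrightarrow> le u v \<and> u \<noteq> v"

definition leader :: "('v \<Rightarrow> 'v \<Rightarrow> bool) \<Rightarrow> ('v, 'a::zero) mpoly \<Rightarrow> 'v"
  where "leader le f = (THE u. u \<in> vars f \<and> (\<forall>v\<in>vars f. le v u))"

definition initial :: "('v \<Rightarrow> 'v \<Rightarrow> bool) \<Rightarrow> ('v, 'a::comm_monoid_add) mpoly \<Rightarrow> ('v, 'a) mpoly"
  where "initial le f = coeff_in (leader le f) (deg_in (leader le f) f) f"

definition separant :: "('v \<Rightarrow> 'v \<Rightarrow> bool) \<Rightarrow> ('v, 'a::semiring_1) mpoly \<Rightarrow> ('v, 'a) mpoly"
  where "separant le f = pdiff (leader le f) f"

definition rank :: "('v \<Rightarrow> 'v \<Rightarrow> bool) \<Rightarrow> ('v, 'a::zero) mpoly \<Rightarrow> 'v \<times> nat"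
  where "rank le f = (leader le f, deg_in (leader le f) f)"

definition rank_less :: "('v \<Rightarrow> 'v \<Rightarrow> bool) \<Rightarrow> 'v \<times> nat \<Rightarrow> 'v \<times> nat \<Rightarrow> bool"
  where "rank_less le r s \<longleftrightarrow>
    strict le (fst r) (fst s) \<or> (fst r = fst s \<and> snd r < snd s)"

definition reduced ::
    "(('d, 'y) dvar \<Rightarrow> ('d, 'y) dvar \<Rightarrow> bool) \<Rightarrow> ('d, 'y, 'k::zero) dpoly \<Rightarrow> ('d, 'y, 'k) dpoly \<Rightarrow> bool"
  where "reduced le f g \<longleftrightarrow>
    (\<forall>\<theta>. \<theta> \<noteq> (\<lambda>_. 0) \<longrightarrow> act \<theta> (leader le g) \<notin> vars f) \<and>
    deg_in (leader le g) f < deg_in (leader le g) g"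

text \<open>Finiteness is no restriction: by Dickson's lemma it follows from the other two conditions.\<close>

definition autoreduced ::
    "(('d, 'y) dvar \<Rightarrow> ('d, 'y) dvar \<Rightarrow> bool) \<Rightarrow> ('d, 'y, 'k::zero) dpoly set \<Rightarrow> bool"
  where "autoreduced le A \<longleftrightarrow> finite A \<and> A \<inter> polys_in {} = {} \<and>
    (\<forall>f\<in>A. \<forall>g\<in>A. f \<noteq> g \<longrightarrow> reduced le f g)"

definition increasing_list :: "('a \<Rightarrow> 'a \<Rightarrow> bool) \<Rightarrow> 'a set \<Rightarrow> 'a list"
  where "increasing_list lt X = (THE xs. sorted_wrt lt xs \<and> set xs = X)"

text \<open>The comparison of increasing sequences: a proper extension of a sequence is lower than it.\<close>

definition seq_lower :: "('a \<Rightarrow> 'a \<Rightarrow> bool) \<Rightarrow> 'a list \<Rightarrow> 'a list \<Rightarrow> bool"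
  where "seq_lower lt xs ys \<longleftrightarrow>
    (\<exists>j. j < length xs \<and> j < length ys \<and> (\<forall>i<j. xs ! i = ys ! i) \<and> lt (xs ! j) (ys ! j)) \<or>
    (length xs > length ys \<and> (\<forall>i<length ys. xs ! i = ys ! i))"

text \<open>Distinct elements of an autoreduced set have distinct leaders, so no rank is lost below.\<close>

definition lower_rank ::
    "('v \<Rightarrow> 'v \<Rightarrow> bool) \<Rightarrow> ('v, 'a::zero) mpoly set \<Rightarrow> ('v, 'a) mpoly set \<Rightarrow> bool"
  where "lower_rank le A B \<longleftrightarrow>
    seq_lower (rank_less le) (increasing_list (rank_less le) (rank le ` A))
                             (increasing_list (rank_less le) (rank le ` B))"

definition lower_leaders :: "('v \<Rightarrow> 'v \<Rightarrow> bool) \<Rightarrow> 'v set \<Rightarrow> 'v set \<Rightarrow> bool"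
  where "lower_leaders le U V \<longleftrightarrow>
    seq_lower (strict le) (increasing_list (strict le) U) (increasing_list (strict le) V)"

definition leaders :: "('v \<Rightarrow> 'v \<Rightarrow> bool) \<Rightarrow> ('v, 'a::zero) mpoly set \<Rightarrow> 'v set"
  where "leaders le A = leader le ` A"

definition char_set ::
    "(('d, 'y) dvar \<Rightarrow> ('d, 'y) dvar \<Rightarrow> bool) \<Rightarrow> ('d, 'y, 'k::zero) dpoly set \<Rightarrow>
      ('d, 'y, 'k) dpoly set \<Rightarrow> bool"
  where "char_set le A I \<longleftrightarrow> autoreduced le A \<and> A \<subseteq> I \<and>
    (\<forall>B. autoreduced le B \<and> B \<subseteq> I \<longrightarrow> \<not> lower_rank le B A)"

definition H_prod :: "('v \<Rightarrow> 'v \<Rightarrow> bool) \<Rightarrow> ('v, 'a::comm_semiring_1) mpoly set \<Rightarrow> ('v, 'a) mpoly"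
  where "H_prod le A = (\<Prod>f\<in>A. initial le f * separant le f)"

text \<open>\<open>diff_sat \<delta> le A\<close> is \<open>[A] : H\<^sub>A\<^sup>\<infinity>\<close>, and \<open>alg_sat R le A\<close> is \<open>(A) : H\<^sub>A\<^sup>\<infinity>\<close> in \<open>R\<close>.\<close>

definition diff_sat ::
    "('d \<Rightarrow> 'k::field \<Rightarrow> 'k) \<Rightarrow> (('d, 'y) dvar \<Rightarrow> ('d, 'y) dvar \<Rightarrow> bool) \<Rightarrow>
      ('d, 'y, 'k) dpoly set \<Rightarrow> ('d, 'y, 'k) dpoly set"
  where "diff_sat \<delta> le A = saturation UNIV (diff_ideal \<delta> hull A) (H_prod le A)"

definition alg_sat ::
    "('v, 'a) mpoly set \<Rightarrow> ('v \<Rightarrow> 'v \<Rightarrow> bool) \<Rightarrow> ('v, 'a::comm_ring_1) mpoly set \<Rightarrow> ('v, 'a) mpoly set"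
  where "alg_sat R le A = saturation R (ideal_in R hull A) (H_prod le A)"

definition characterizable ::
    "('d \<Rightarrow> 'k::field \<Rightarrow> 'k) \<Rightarrow> (('d, 'y) dvar \<Rightarrow> ('d, 'y) dvar \<Rightarrow> bool) \<Rightarrow>
      ('d, 'y, 'k) dpoly set \<Rightarrow> bool"
  where "characterizable \<delta> le I \<longleftrightarrow> diff_ideal \<delta> I \<and>
    (\<exists>A. char_set le A I \<and> I = diff_sat \<delta> le A)"

definition nonleaders :: "('d, 'y) dvar set \<Rightarrow> ('d, 'y) dvar set"
  where "nonleaders L = - derivatives L"


section \<open>The lexicographic order and canonical characteristic sets\<close>

definition lex_less :: "('v \<Rightarrow> 'v \<Rightarrow> bool) \<Rightarrow> 'v mono \<Rightarrow> 'v mono \<Rightarrow> bool"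
  where "lex_less le m m' \<longleftrightarrow>
    (\<exists>v. lookup m v < lookup m' v \<and> (\<forall>w. strict le v w \<longrightarrow> lookup m w = lookup m' w))"

definition lead_mono :: "('v \<Rightarrow> 'v \<Rightarrow> bool) \<Rightarrow> ('v, 'a::zero) mpoly \<Rightarrow> 'v mono"
  where "lead_mono le p = (THE m. m \<in> keys p \<and> (\<forall>m'\<in>keys p. m' \<noteq> m \<longrightarrow> lex_less le m' m))"

definition lex_coeff :: "('v \<Rightarrow> 'v \<Rightarrow> bool) \<Rightarrow> ('v, 'a::zero) mpoly \<Rightarrow> 'a"
  where "lex_coeff le p = lookup p (lead_mono le p)"

definition canonical_char_set ::
    "('d \<Rightarrow> 'k::field \<Rightarrow> 'k) \<Rightarrow> (('d, 'y) dvar \<Rightarrow> ('d, 'y) dvar \<Rightarrow> bool) \<Rightarrow>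
      ('d, 'y, 'k) dpoly set \<Rightarrow> ('d, 'y, 'k) dpoly set \<Rightarrow> bool"
  where "canonical_char_set \<delta> le C I \<longleftrightarrow> characterizable \<delta> le I \<and> char_set le C I \<and>
    (let N = nonleaders (leaders le C) in
      \<forall>f\<in>C. initial le f \<in> polys_in N \<and>
        (\<forall>p\<in>polys_in N. p dvd f \<longrightarrow> p \<in> polys_in {}) \<and>
        lex_coeff le (initial le f) = 1)"


section \<open>The ring \<open>k(N)[L]\<close>, Groebner bases and clearing denominators\<close>

text \<open>
  \<open>k(N)\<close> is realised inside the fraction field of \<open>k{Y}\<close>, and \<open>k(N)[L]\<close> inside the polynomial
  ring over that fraction field.
\<close>

definition frac_in ::
    "('d, 'y) dvar set \<Rightarrow> ('d::finite, 'y::finite, 'k::field) dpoly fract set"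
  where "frac_in N = {Fract a b | a b. a \<in> polys_in N \<and> b \<in> polys_in N \<and> b \<noteq> 0}"

definition frac_polys ::
    "('d, 'y) dvar set \<Rightarrow> ('d, 'y) dvar set \<Rightarrow>
      (('d, 'y) dvar, ('d::finite, 'y::finite, 'k::field) dpoly fract) mpoly set"
  where "frac_polys N L = {p \<in> polys_in L. \<forall>m. lookup p m \<in> frac_in N}"

definition restrict_mono :: "'v set \<Rightarrow> 'v mono \<Rightarrow> 'v mono"
  where "restrict_mono V m = (\<Sum>v\<in>keys m \<inter> V. single v (lookup m v))"

text \<open>
  The canonical map \<open>k[N][L] \<rightarrow> k(N)[L]\<close>, for disjoint \<open>N\<close> and \<open>L\<close>: each monomial is split into
  its part in \<open>L\<close>, which stays a monomial, and the remaining part, which goes into the coefficient.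
\<close>

definition to_frac_polys ::
    "('d, 'y) dvar set \<Rightarrow> ('d::finite, 'y::finite, 'k::field) dpoly \<Rightarrow>
      (('d, 'y) dvar, ('d, 'y, 'k) dpoly fract) mpoly"
  where "to_frac_polys L p =
    (\<Sum>m\<in>keys p. single (restrict_mono L m)
       (Fract (single (restrict_mono (- L) m) (lookup p m)) 1))"

definition mono_dvd :: "'v mono \<Rightarrow> 'v mono \<Rightarrow> bool"
  where "mono_dvd m m' \<longleftrightarrow> (\<forall>v. lookup m v \<le> lookup m' v)"

definition reduced_groebner_basis ::
    "('v \<Rightarrow> 'v \<Rightarrow> bool) \<Rightarrow> ('v, 'a::field) mpoly set \<Rightarrow> ('v, 'a) mpoly set \<Rightarrow> bool"
  where "reduced_groebner_basis le G J \<longleftrightarrow> finite G \<and> G \<subseteq> J \<and> 0 \<notin> G \<and>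
    (\<forall>f\<in>J. f \<noteq> 0 \<longrightarrow> (\<exists>g\<in>G. mono_dvd (lead_mono le g) (lead_mono le f))) \<and>
    (\<forall>g\<in>G. lex_coeff le g = 1) \<and>
    (\<forall>g\<in>G. \<forall>h\<in>G. h \<noteq> g \<longrightarrow> (\<forall>m\<in>keys g. \<not> mono_dvd (lead_mono le h) m))"

definition dvd_in :: "'a::times set \<Rightarrow> 'a \<Rightarrow> 'a \<Rightarrow> bool"
  where "dvd_in R a b \<longleftrightarrow> (\<exists>x\<in>R. b = a * x)"

text \<open>Denominators of fractions in lowest terms, hence unique up to units of \<open>k[N]\<close>.\<close>

definition denominator_in ::
    "('d, 'y) dvar set \<Rightarrow> ('d::finite, 'y::finite, 'k::field) dpoly fract \<Rightarrow>
      ('d, 'y, 'k) dpoly \<Rightarrow> bool"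
  where "denominator_in N q b \<longleftrightarrow> b \<in> polys_in N \<and> b \<noteq> 0 \<and>
    (\<exists>a\<in>polys_in N. q = Fract a b \<and>
      (\<forall>c\<in>polys_in N. dvd_in (polys_in N) c a \<and> dvd_in (polys_in N) c b \<longrightarrow>
         dvd_in (polys_in N) c 1))"

definition lcm_in :: "'a::times set \<Rightarrow> 'a set \<Rightarrow> 'a \<Rightarrow> bool"
  where "lcm_in R B c \<longleftrightarrow> c \<in> R \<and> (\<forall>b\<in>B. dvd_in R b c) \<and>
    (\<forall>c'\<in>R. (\<forall>b\<in>B. dvd_in R b c') \<longrightarrow> dvd_in R c c')"

text \<open>
  For \<open>g\<close> in \<open>k(N)[L]\<close>, multiply by the lcm \<open>c\<close> of the denominators of its coefficients, read the
  result as an element \<open>h\<close> of \<open>k[N][L]\<close>, and divide by the leading coefficient of \<open>h\<close> in \<open>k\<close>.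
  The lcm is determined up to a factor in \<open>k\<close>, which the last step removes.
\<close>

definition clear_denominators ::
    "(('d, 'y) dvar \<Rightarrow> ('d, 'y) dvar \<Rightarrow> bool) \<Rightarrow> ('d, 'y) dvar set \<Rightarrow> ('d, 'y) dvar set \<Rightarrow>
      (('d, 'y) dvar, ('d::finite, 'y::finite, 'k::field) dpoly fract) mpoly set \<Rightarrow>
      ('d, 'y, 'k) dpoly set"
  where "clear_denominators le N L G =
    {Const (inverse (lex_coeff le h)) * h | h. h \<in> polys_in (N \<union> L) \<and>
       (\<exists>g\<in>G. \<exists>c. lcm_in (polys_in N) {b. \<exists>m\<in>keys g. denominator_in N (lookup g m) b} c \<and>
          to_frac_polys L h = Const (Fract c 1) * g)}"

end

theory Submission
  imports Defs "HOL-Computational_Algebra.Polynomial" "HOL-Library.FuncSet"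
begin

text \<open>
  Write \<open>I = {F}\<close> with characteristic set \<open>A\<close>, and let \<open>I\<^sub>i = [C\<^sub>i] : H\<^sup>\<infinity>\<close>. Since \<open>I\<close> is saturated with respect
  to \<open>H\<^sub>A\<close>, the initials of \<open>A\<close> are nonzerodivisors modulo \<open>I\<close>. Hence, over \<open>k(N)\<close>, the quotient of
  \<open>k[N][L]\<close> is finite-dimensional and the initials are units, so that \<open>I\<close> contains, for each \<open>u \<in> L\<close>, some
  \<open>\<beta> u\<^sup>d + r\<close> with \<open>\<beta> \<in> k[N]\<close> and \<open>r\<close> reduced. No leader of \<open>A\<close> can be lost in a component
  \<open>I\<^sub>i\<close> before a new one appears, so the leaders of \<open>C\<^sub>i\<close> have rank at most that of \<open>L\<close>; and if they
  differ from \<open>L\<close>, a norm argument shows that \<open>I\<^sub>i\<close> meets \<open>k[N]\<close> nontrivially. As \<open>I\<close> does not, and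
  \<open>k[N]\<close> has no zero divisors modulo \<open>I\<close>, the components of highest rank are those with leaders \<open>L\<close>, and
  \<open>I' = I \<inter> k[N][L]\<close>. The reduced Groebner basis therefore consists of the \<open>u\<^sup>d + r / \<beta>\<close>, and unique
  factorization in \<open>k[N]\<close> makes the cleared polynomials free of factors in \<open>k[N]\<close>.
\<close>

section \<open>Polynomials in one of the variables\<close>

definition psum :: "('m \<Rightarrow> 'a::zero \<Rightarrow> 'b::comm_monoid_add) \<Rightarrow> ('m \<Rightarrow>\<^sub>0 'a) \<Rightarrow> 'b"
  where "psum F p = (\<Sum>m\<in>keys p. F m (lookup p m))"

lemma additive_zero:
  fixes f :: "'a::monoid_add \<Rightarrow> 'b::group_add"
  assumes "\<And>a b. f (a + b) = f a + f b"
  shows "f 0 = 0"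
  by (metis add_0 add_left_cancel assms add.right_neutral)

lemma additive_sum:
  fixes f :: "'a::comm_monoid_add \<Rightarrow> 'b::ab_group_add"
  assumes "\<And>a b. f (a + b) = f a + f b"
  shows "f (sum g X) = (\<Sum>x\<in>X. f (g x))"
  by (induct X rule: infinite_finite_induct) (auto simp: assms additive_zero[of f, OF assms])

lemma psum_superset:
  assumes "finite X" "keys p \<subseteq> X" "\<And>m. F m 0 = 0"
  shows "psum F p = (\<Sum>m\<in>X. F m (lookup p m))"
  unfolding psum_def using assms
  by (intro sum.mono_neutral_left) (auto simp: in_keys_iff)

lemma psum_add:
  fixes F :: "'m \<Rightarrow> 'a::comm_monoid_add \<Rightarrow> 'b::ab_group_add"
  assumes "\<And>m a b. F m (a + b) = F m a + F m b"
  shows "psum F (p + q) = psum F p + psum F q"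
proof -
  have z: "F m 0 = 0" for m
    using assms by (rule additive_zero)
  let ?X = "keys p \<union> keys q"
  have "psum F (p + q) = (\<Sum>m\<in>?X. F m (lookup (p + q) m))"
    using Poly_Mapping.keys_add[of p q] by (intro psum_superset z) auto
  also have "\<dots> = (\<Sum>m\<in>?X. F m (lookup p m)) + (\<Sum>m\<in>?X. F m (lookup q m))"
    by (simp add: lookup_add assms sum.distrib)
  also have "\<dots> = psum F p + psum F q"
    by (subst (1 2) psum_superset[of ?X]) (auto simp: z)
  finally show ?thesis .
qed

lemma psum_single [simp]: "F m 0 = 0 \<Longrightarrow> psum F (single m c) = F m c"
  by (cases "c = 0") (auto simp: psum_def)

lemma psum_zero [simp]: "psum F 0 = 0"
  by (simp add: psum_def)

lemma psum_monomials: "psum single p = p"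
proof (rule poly_mapping_eqI)
  fix m
  have "lookup (psum single p) m = (\<Sum>k\<in>keys p. if k = m then lookup p m else 0)"
    unfolding psum_def lookup_sum by (intro sum.cong) (auto simp: lookup_single when_def)
  then show "lookup (psum single p) m = lookup p m"
    by (auto simp: in_keys_iff)
qed

lemma poly_mapping_additive_eqI:
  fixes f g :: "('m \<Rightarrow>\<^sub>0 'a::comm_monoid_add) \<Rightarrow> 'b::ab_group_add"
  assumes "\<And>p q. f (p + q) = f p + f q" "\<And>p q. g (p + q) = g p + g q"
    and "\<And>m c. f (single m c) = g (single m c)"
  shows "f p = g p"
proof -
  have "f (psum single p) = g (psum single p)"
    unfolding psum_def by (simp add: additive_sum[of f] additive_sum[of g] assms)
  then show ?thesis by (simp add: psum_monomials)
qed

lemma psum_mult: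
  fixes F :: "'m::comm_monoid_add \<Rightarrow> 'a::comm_ring_1 \<Rightarrow> 'b::comm_ring_1"
  assumes add: "\<And>m a b. F m (a + b) = F m a + F m b"
    and mult: "\<And>m n a b. F (m + n) (a * b) = F m a * F n b"
  shows "psum F (p * q) = psum F p * psum F q"
proof -
  have z: "F m 0 = 0" for m
    using add by (rule additive_zero)
  have add': "psum F (p + q) = psum F p + psum F q" for p q
    using add by (rule psum_add)
  have 1: "psum F (single m c * q) = psum F (single m c) * psum F q" for m c q
    by (rule poly_mapping_additive_eqI[of "\<lambda>q. psum F (single m c * q)"
          "\<lambda>q. psum F (single m c) * psum F q"])
       (simp_all add: distrib_left add' mult_single z mult)
  show ?thesis
    by (rule poly_mapping_additive_eqI[of "\<lambda>p. psum F (p * q)" "\<lambda>p. psum F p * psum F q"])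
       (simp_all add: distrib_right add' 1)
qed

lemma additive_diff:
  fixes f :: "'a::ab_group_add \<Rightarrow> 'b::ab_group_add"
  assumes "\<And>a b. f (a + b) = f a + f b"
  shows "f (a - b) = f a - f b"
  using assms[of "a - b" b] by simp

definition upoly :: "'v \<Rightarrow> ('v, 'a::comm_ring_1) mpoly \<Rightarrow> ('v, 'a) mpoly poly"
  where "upoly x = psum (\<lambda>m c. monom (single (m - single x (lookup m x)) c) (lookup m x))"

lemma upoly_add: "upoly x (p + q) = upoly x p + upoly x q"
  unfolding upoly_def by (rule psum_add) (simp add: single_add add_monom)

lemma upoly_diff: "upoly x (p - q) = upoly x p - upoly x q"
  by (rule additive_diff) (rule upoly_add)

lemma upoly_zero [simp]: "upoly x 0 = 0"
  by (simp add: upoly_def)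

lemma upoly_mult: "upoly x (p * q) = upoly x p * upoly x q"
  unfolding upoly_def
proof (rule psum_mult, goal_cases)
  case (2 m n a b)
  have "m + n - single x (lookup (m + n) x) =
      (m - single x (lookup m x)) + (n - single x (lookup n x))"
    by (rule poly_mapping_eqI) (auto simp: lookup_add lookup_minus lookup_single when_def)
  then show ?case
    by (simp add: mult_monom mult_single lookup_add)
qed (simp add: single_add add_monom)

lemma lookup_coeff_in:
  fixes p :: "('v, 'a::comm_ring_1) mpoly"
  shows "lookup (coeff_in x e p) n = (if lookup n x = 0 then lookup p (n + single x e) else 0)"
proof -
  have inj: "m - single x e = n \<longleftrightarrow> lookup n x = 0 \<and> m = n + single x e" if "lookup m x = e" for m
  proof
    assume n: "m - single x e = n"
    have "m = n + single x e"
      unfolding n[symmetric] using that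
      by (intro poly_mapping_eqI) (auto simp: lookup_add lookup_minus lookup_single when_def)
    moreover have "lookup n x = 0"
      unfolding n[symmetric] using that by (simp add: lookup_minus)
    ultimately show "lookup n x = 0 \<and> m = n + single x e" by blast
  qed auto
  have "lookup (coeff_in x e p) n = (\<Sum>m | m \<in> keys p \<and> lookup m x = e.
      if lookup n x = 0 \<and> m = n + single x e then lookup p m else 0)"
    unfolding coeff_in_def lookup_sum
    by (intro sum.cong refl) (auto simp: lookup_single when_def inj)
  also have "\<dots> = (\<Sum>m\<in>(if lookup n x = 0 \<and> n + single x e \<in> keys p then {n + single x e} else {}).
      lookup p m)"
    by (intro sum.mono_neutral_cong_right) (auto simp: lookup_add split: if_splits)
  finally show ?thesis by (auto simp: in_keys_iff)
qed

lemma coeff_upoly: "coeff (upoly x p) e = coeff_in x e p"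
proof -
  have "coeff (upoly x p) e = (\<Sum>m\<in>keys p. if lookup m x = e then
      single (m - single x e) (lookup p m) else 0)"
    unfolding upoly_def psum_def coeff_sum by (intro sum.cong) auto
  also have "\<dots> = coeff_in x e p"
    unfolding coeff_in_def by (subst sum.inter_filter[symmetric]) auto
  finally show ?thesis .
qed

lemma deg_in_le_iff: "deg_in x p \<le> e \<longleftrightarrow> (\<forall>m\<in>keys p. lookup m x \<le> e)"
  unfolding deg_in_def by (subst Max_le_iff) auto

lemma lookup_le_deg_in: "m \<in> keys p \<Longrightarrow> lookup m x \<le> deg_in x p"
  using deg_in_le_iff[of x p "deg_in x p"] by simp

lemma degree_upoly: "degree (upoly x p) = deg_in x (p :: ('v, 'a::comm_ring_1) mpoly)"
proof (rule antisym)
  show "degree (upoly x p) \<le> deg_in x p"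
  proof (rule degree_le, intro allI impI)
    fix e assume e: "deg_in x p < e"
    show "coeff (upoly x p) e = 0"
      unfolding coeff_upoly
    proof (rule poly_mapping_eqI)
      fix n
      have "lookup p (n + single x e) = 0"
      proof (rule ccontr)
        assume "lookup p (n + single x e) \<noteq> 0"
        then have "n + single x e \<in> keys p" by (simp add: in_keys_iff)
        then have "lookup (n + single x e) x \<le> deg_in x p"
          by (rule lookup_le_deg_in)
        then show False using e by (simp add: lookup_add)
      qed
      then show "lookup (coeff_in x e p) n = lookup 0 n" by (simp add: lookup_coeff_in)
    qed
  qed
  show "deg_in x p \<le> degree (upoly x p)"
    unfolding deg_in_le_iff
  proof
    fix m assume m: "m \<in> keys p"
    let ?n = "m - single x (lookup m x)"
    have "?n + single x (lookup m x) = m"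
      by (rule poly_mapping_eqI) (auto simp: lookup_add lookup_minus lookup_single when_def)
    then have "lookup (coeff_in x (lookup m x) p) ?n = lookup p m"
      by (simp add: lookup_coeff_in lookup_minus)
    then have "coeff (upoly x p) (lookup m x) \<noteq> 0"
      using m unfolding coeff_upoly by (metis in_keys_iff lookup_zero)
    then show "lookup m x \<le> degree (upoly x p)" by (rule le_degree)
  qed
qed

lemma finite_vars [simp]: "finite (vars p)"
  by (simp add: vars_def)

lemma in_vars_iff: "v \<in> vars p \<longleftrightarrow> (\<exists>m\<in>keys p. lookup m v \<noteq> 0)"
  by (auto simp: vars_def in_keys_iff)

lemma in_vars_iff_deg: "v \<in> vars p \<longleftrightarrow> deg_in v p > 0"
proof -
  have "deg_in v p \<le> 0 \<longleftrightarrow> v \<notin> vars p"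
    unfolding deg_in_le_iff in_vars_iff by auto
  then show ?thesis by linarith
qed

lemma vars_zero [simp]: "vars 0 = {}" and vars_one [simp]: "vars (1 :: ('v, 'a::comm_semiring_1) mpoly) = {}"
  by (simp_all add: vars_def)

lemma vars_uminus [simp]: "vars (- p) = vars (p :: ('v, 'a::ab_group_add) mpoly)"
  by (simp add: vars_def in_keys_iff set_eq_iff)

lemma vars_add: "vars (p + q) \<subseteq> vars p \<union> vars q"
  unfolding vars_def using Poly_Mapping.keys_add[of p q] by blast

lemma vars_diff: "vars (p - q :: ('v, 'a::ab_group_add) mpoly) \<subseteq> vars p \<union> vars q"
  using vars_add[of p "- q"] by simp

lemma vars_mult_subset: "vars (p * q :: ('v, 'a::comm_semiring_1) mpoly) \<subseteq> vars p \<union> vars q"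
proof
  fix v assume "v \<in> vars (p * q)"
  then obtain m where m: "m \<in> keys (p * q)" "lookup m v \<noteq> 0"
    by (auto simp: in_vars_iff)
  then obtain a b where "a \<in> keys p" "b \<in> keys q" "m = a + b"
    using Poly_Mapping.keys_mult[of p q] by blast
  then show "v \<in> vars p \<union> vars q"
    using m(2) by (auto simp: in_vars_iff lookup_add)
qed

lemma vars_single: "vars (single m c) \<subseteq> keys m"
  by (auto simp: vars_def split: if_splits)

lemma vars_Var [simp]: "vars (Var v :: ('v, 'a::zero_neq_one) mpoly) = {v}"
  by (simp add: vars_def Var_def)

lemma polys_in_iff: "p \<in> polys_in V \<longleftrightarrow> vars p \<subseteq> V"
  by (simp add: polys_in_def)

lemma polys_in_mono: "U \<subseteq> V \<Longrightarrow> p \<in> polys_in U \<Longrightarrow> p \<in> polys_in V"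
  by (auto simp: polys_in_iff)

lemma polys_in_zero [simp]: "0 \<in> polys_in V"
  and polys_in_one [simp]: "(1 :: ('v, 'a::comm_semiring_1) mpoly) \<in> polys_in V"
  by (simp_all add: polys_in_iff)

lemma polys_in_add [intro]: "p \<in> polys_in V \<Longrightarrow> q \<in> polys_in V \<Longrightarrow> p + q \<in> polys_in V"
  using vars_add[of p q] by (auto simp: polys_in_iff)

lemma polys_in_uminus [intro]: "p \<in> polys_in V \<Longrightarrow> - p \<in> polys_in V"
  for p :: "('v, 'a::ab_group_add) mpoly"
  by (simp add: polys_in_iff)

lemma polys_in_diff [intro]: "p \<in> polys_in V \<Longrightarrow> q \<in> polys_in V \<Longrightarrow> p - q \<in> polys_in V"
  for p :: "('v, 'a::ab_group_add) mpoly"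
  using vars_diff[of p q] by (auto simp: polys_in_iff)

lemma polys_in_mult [intro]: "p \<in> polys_in V \<Longrightarrow> q \<in> polys_in V \<Longrightarrow> p * q \<in> polys_in V"
  for p :: "('v, 'a::comm_semiring_1) mpoly"
  using vars_mult_subset[of p q] by (auto simp: polys_in_iff)

lemma polys_in_power [intro]: "p \<in> polys_in V \<Longrightarrow> p ^ n \<in> polys_in V"
  for p :: "('v, 'a::comm_semiring_1) mpoly"
  by (induct n) auto

lemma polys_in_sum [intro]: "(\<And>x. x \<in> X \<Longrightarrow> f x \<in> polys_in V) \<Longrightarrow> sum f X \<in> polys_in V"
  by (induct X rule: infinite_finite_induct) auto

lemma polys_in_prod [intro]:
  fixes f :: "'b \<Rightarrow> ('v, 'a::comm_semiring_1) mpoly"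
  shows "(\<And>x. x \<in> X \<Longrightarrow> f x \<in> polys_in V) \<Longrightarrow> prod f X \<in> polys_in V"
  by (induct X rule: infinite_finite_induct) auto

lemma polys_in_Var [intro]: "v \<in> V \<Longrightarrow> (Var v :: ('v, 'a::zero_neq_one) mpoly) \<in> polys_in V"
  by (simp add: polys_in_iff)

lemma polys_in_single: "keys m \<subseteq> V \<Longrightarrow> single m c \<in> polys_in V"
  using vars_single[of m c] by (auto simp: polys_in_iff)

lemma Var_power: "(Var v :: ('v, 'a::comm_semiring_1) mpoly) ^ n = single (single v n) 1"
proof (induct n)
  case (Suc n)
  have "single v 1 + single v n = single v (Suc n)"
    by (simp flip: single_add)
  then show ?case by (simp add: Suc, simp add: Var_def mult_single)
qed simp

lemma mono_split:
  "m = (m - single x (lookup m x)) + single x (lookup m x)" for m :: "'v mono"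
  by (rule poly_mapping_eqI) (auto simp: lookup_add lookup_minus lookup_single when_def)

lemma poly_upoly: "poly (upoly x p) (Var x) = p"
proof -
  have "poly (upoly x p) (Var x) = id p"
  proof (rule poly_mapping_additive_eqI[of "\<lambda>p. poly (upoly x p) (Var x)" id])
    fix m :: "'a mono" and c :: 'b
    have "poly (upoly x (single m c)) (Var x) =
        single (m - single x (lookup m x)) c * single (single x (lookup m x)) 1"
      by (simp add: upoly_def poly_monom Var_power)
    also have "\<dots> = single m c"
      using mono_split[of m x] by (simp add: mult_single)
    finally show "poly (upoly x (single m c)) (Var x) = id (single m c)" by simp
  qed (simp_all add: upoly_add)
  then show ?thesis by simp
qed

lemma upoly_inject: "upoly x p = upoly x q \<longleftrightarrow> p = q"
  by (metis poly_upoly)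

lemma upoly_eq_0_iff [simp]: "upoly x p = 0 \<longleftrightarrow> p = 0"
  using upoly_inject[of x p 0] by simp

lemma vars_coeff_in:
  fixes p :: "('v, 'a::comm_ring_1) mpoly"
  shows "vars (coeff_in x e p) \<subseteq> vars p - {x}"
proof
  fix v assume "v \<in> vars (coeff_in x e p)"
  then obtain n where n: "lookup (coeff_in x e p) n \<noteq> 0" "lookup n v \<noteq> 0"
    by (auto simp: in_vars_iff in_keys_iff)
  then have "lookup n x = 0" "n + single x e \<in> keys p"
    by (auto simp: lookup_coeff_in in_keys_iff split: if_splits)
  then show "v \<in> vars p - {x}"
    using n(2) by (auto simp: in_vars_iff lookup_add intro!: bexI[of _ "n + single x e"])
qed

lemma polys_in_coeff_in:
  fixes p :: "('v, 'a::comm_ring_1) mpoly"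
  shows "p \<in> polys_in V \<Longrightarrow> coeff_in x e p \<in> polys_in (V - {x})"
  using vars_coeff_in[of x e p] by (auto simp: polys_in_iff)

lemma upoly_const: "upoly x p = [:p:]" if "x \<notin> vars p"
proof (rule poly_eqI)
  fix e
  have z: "lookup m x = 0" if "m \<in> keys p" for m
    using \<open>x \<notin> vars p\<close> that by (auto simp: in_vars_iff)
  show "coeff (upoly x p) e = coeff [:p:] e"
    unfolding coeff_upoly
  proof (rule poly_mapping_eqI)
    fix n
    show "lookup (coeff_in x e p) n = lookup (coeff [:p:] e) n"
    proof (cases e)
      case 0
      then show ?thesis using z[of n] by (cases "n \<in> keys p") (auto simp: lookup_coeff_in in_keys_iff)
    next
      case (Suc e')
      then show ?thesis
        using z[of "n + single x e"] by (auto simp: lookup_coeff_in in_keys_iff lookup_add)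
    qed
  qed
qed

lemma upoly_Var_power: "upoly x (Var x ^ n) = monom (1 :: ('v, 'a::comm_ring_1) mpoly) n"
  unfolding Var_power by (simp add: upoly_def)

lemma upoly_mult_Var_power:
  "x \<notin> vars p \<Longrightarrow> upoly x (p * Var x ^ n) = monom (p :: ('v, 'a::comm_ring_1) mpoly) n"
  by (simp add: upoly_mult upoly_const upoly_Var_power smult_monom)

lemma expand_coeff_in:
  fixes p :: "('v, 'a::comm_ring_1) mpoly"
  shows "p = (\<Sum>j\<le>deg_in x p. coeff_in x j p * Var x ^ j)"
  by (subst (1) poly_upoly[of x p, symmetric]) (simp add: poly_altdef degree_upoly coeff_upoly)

lemma coeff_in_add:
  fixes p :: "('v, 'a::comm_ring_1) mpoly"
  shows "coeff_in x e (p + q) = coeff_in x e p + coeff_in x e q"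
  by (simp flip: coeff_upoly add: upoly_add)

lemma coeff_in_diff:
  fixes p :: "('v, 'a::comm_ring_1) mpoly"
  shows "coeff_in x e (p - q) = coeff_in x e p - coeff_in x e q"
  by (simp flip: coeff_upoly add: upoly_diff)

lemma coeff_in_zero [simp]: "coeff_in x e (0 :: ('v, 'a::comm_ring_1) mpoly) = 0"
  by (simp add: coeff_in_def)

lemma coeff_in_mult_free:
  fixes p :: "('v, 'a::comm_ring_1) mpoly"
  shows "x \<notin> vars p \<Longrightarrow> coeff_in x e (p * q) = p * coeff_in x e q"
  by (simp flip: coeff_upoly add: upoly_mult upoly_const)

lemma coeff_in_free:
  fixes p :: "('v, 'a::comm_ring_1) mpoly"
  shows "x \<notin> vars p \<Longrightarrow> coeff_in x e p = (if e = 0 then p else 0)"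
  by (simp flip: coeff_upoly add: upoly_const coeff_pCons split: nat.splits)

lemma coeff_in_mult_Var_power:
  fixes p :: "('v, 'a::comm_ring_1) mpoly"
  shows "x \<notin> vars p \<Longrightarrow> coeff_in x e (p * Var x ^ n) = (if e = n then p else 0)"
  by (simp flip: coeff_upoly add: upoly_mult_Var_power)

lemma coeff_in_gt:
  fixes p :: "('v, 'a::comm_ring_1) mpoly"
  shows "deg_in x p < e \<Longrightarrow> coeff_in x e p = 0"
  by (simp flip: coeff_upoly degree_upoly add: coeff_eq_0)

lemma coeff_in_deg_in:
  fixes p :: "('v, 'a::comm_ring_1) mpoly"
  shows "p \<noteq> 0 \<Longrightarrow> coeff_in x (deg_in x p) p \<noteq> 0"
  by (simp flip: coeff_upoly degree_upoly)

lemma deg_in_zero [simp]: "deg_in x 0 = 0"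
  by (simp add: deg_in_def)

lemma deg_in_less_iff:
  fixes p :: "('v, 'a::comm_ring_1) mpoly"
  assumes "0 < d"
  shows "deg_in x p < d \<longleftrightarrow> (\<forall>e\<ge>d. coeff_in x e p = 0)"
proof
  assume "\<forall>e\<ge>d. coeff_in x e p = 0"
  then show "deg_in x p < d"
    using coeff_in_deg_in[of p x] assms by (cases "p = 0") (auto intro: leI dest: leI)
qed (auto simp: coeff_in_gt)

lemma deg_in_add_le:
  fixes p :: "('v, 'a::comm_ring_1) mpoly"
  shows "deg_in x (p + q) \<le> max (deg_in x p) (deg_in x q)"
  by (simp flip: degree_upoly add: upoly_add degree_add_le_max)

lemma deg_in_diff_le:
  fixes p :: "('v, 'a::comm_ring_1) mpoly"
  shows "deg_in x (p - q) \<le> max (deg_in x p) (deg_in x q)"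
  by (simp flip: degree_upoly add: upoly_diff degree_diff_le_max)

lemma deg_in_mult_le:
  fixes p :: "('v, 'a::comm_ring_1) mpoly"
  shows "deg_in x (p * q) \<le> deg_in x p + deg_in x q"
  by (simp flip: degree_upoly add: upoly_mult degree_mult_le)

lemma deg_in_free: "x \<notin> vars p \<Longrightarrow> deg_in x p = 0"
  by (simp add: in_vars_iff_deg)

lemma deg_in_mult:
  fixes p :: "('v::linorder, 'a::idom) mpoly"
  shows "p \<noteq> 0 \<Longrightarrow> q \<noteq> 0 \<Longrightarrow> deg_in x (p * q) = deg_in x p + deg_in x q"
  by (simp flip: degree_upoly add: upoly_mult degree_mult_eq)

lemma deg_in_coeff_in:
  fixes p :: "('v, 'a::comm_ring_1) mpoly"
  shows "deg_in y (coeff_in x e p) \<le> deg_in y p"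
  unfolding deg_in_le_iff
proof
  fix m assume "m \<in> keys (coeff_in x e p)"
  then have "m + single x e \<in> keys p"
    by (auto simp: in_keys_iff lookup_coeff_in split: if_splits)
  then show "lookup m y \<le> deg_in y p"
    using lookup_le_deg_in[of "m + single x e" p y] by (simp add: lookup_add)
qed

lemma vars_mult:
  fixes p :: "('v::linorder, 'a::idom) mpoly"
  shows "p \<noteq> 0 \<Longrightarrow> q \<noteq> 0 \<Longrightarrow> vars (p * q) = vars p \<union> vars q"
  by (auto simp: in_vars_iff_deg deg_in_mult)

lemma polys_in_factor:
  fixes p :: "('v::linorder, 'a::idom) mpoly"
  assumes "p * q \<in> polys_in V" "p * q \<noteq> 0"
  shows "p \<in> polys_in V" "q \<in> polys_in V"
  using assms vars_mult[of p q] by (auto simp: polys_in_iff)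

lemma polys_in_empty_iff:
  "p \<in> polys_in {} \<longleftrightarrow> (\<exists>c. p = Const c)"
proof
  assume p: "p \<in> polys_in {}"
  have "p = single 0 (lookup p 0)"
  proof (rule poly_mapping_eqI)
    fix m
    have "m = 0" if "m \<in> keys p"
      using p that by (intro poly_mapping_eqI) (auto simp: polys_in_iff in_vars_iff set_eq_iff)
    then show "lookup p m = lookup (single 0 (lookup p 0)) m"
      by (cases "m = 0") (auto simp: lookup_single in_keys_iff)
  qed
  then show "\<exists>c. p = Const c" unfolding Const_def ..
next
  assume "\<exists>c. p = Const c"
  then show "p \<in> polys_in {}" by (auto simp: Const_def polys_in_single)
qed

lemma Const_mult_inverse: "c \<noteq> 0 \<Longrightarrow> Const c * Const (inverse c) = (1 :: ('v, 'a::field) mpoly)"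
  by (simp add: Const_def mult_single)

lemma constant_dvd_one:
  fixes p :: "('v, 'a::field) mpoly"
  assumes "p \<in> polys_in {}" "p \<noteq> 0"
  shows "p dvd 1"
proof -
  obtain c where c: "p = Const c" using assms(1) polys_in_empty_iff by blast
  with assms(2) have "c \<noteq> 0" by (auto simp: Const_def)
  then show ?thesis unfolding c by (metis Const_mult_inverse dvdI)
qed

lemma dvd_one_iff:
  fixes p :: "('v::linorder, 'a::field) mpoly"
  shows "p dvd 1 \<longleftrightarrow> p \<in> polys_in {} \<and> p \<noteq> 0"
proof
  assume "p dvd 1"
  then obtain q where q: "p * q = 1" by (auto elim: dvdE)
  then have "p * q \<in> polys_in {}" by (simp add: polys_in_iff)
  then show "p \<in> polys_in {} \<and> p \<noteq> 0" using q polys_in_factor[of p q "{}"] by auto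
qed (auto simp: constant_dvd_one)

section \<open>Unique factorization\<close>

lemma vars_Var_power: "vars ((Var x :: ('v, 'a::comm_semiring_1) mpoly) ^ n) \<subseteq> {x}"
  using polys_in_power[OF polys_in_Var[of x "{x}"]] by (simp add: polys_in_iff)

lemma pseudo_division:
  fixes p a :: "('v, 'a::comm_ring_1) mpoly"
  assumes p: "p \<in> polys_in U" and a: "a \<in> polys_in U" and d: "d = deg_in x a" "0 < d"
    and c: "c = coeff_in x d a"
  shows "\<exists>k q s. q \<in> polys_in U \<and> s \<in> polys_in U \<and> c ^ k * p = q * a + s \<and> deg_in x s < d \<and>
    (\<forall>y. y \<notin> vars a \<longrightarrow> deg_in y s \<le> deg_in y p)"
  using p
proof (induct "deg_in x p" arbitrary: p rule: less_induct)
  case less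
  have x: "x \<in> vars a" using d by (simp add: in_vars_iff_deg)
  have xU: "x \<in> U" using x a by (auto simp: polys_in_iff)
  have cU: "c \<in> polys_in U"
    unfolding c by (rule polys_in_mono[OF _ polys_in_coeff_in[OF a]]) auto
  show ?case
  proof (cases "deg_in x p < d")
    case True
    then show ?thesis
      using less.prems by (intro exI[of _ 0] exI[of _ p]) auto
  next
    case False
    define e where "e = deg_in x p"
    define l where "l = coeff_in x e p"
    define p' where "p' = c * p - l * Var x ^ (e - d) * a"
    have de: "d \<le> e" using False by (simp add: e_def)
    have xc: "x \<notin> vars c" "x \<notin> vars l" using vars_coeff_in[of x] by (fastforce simp: c l_def)+
    have lU: "l \<in> polys_in U"
      unfolding l_def by (rule polys_in_mono[OF _ polys_in_coeff_in[OF less.prems]]) auto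
    have p'U: "p' \<in> polys_in U"
      unfolding p'_def using cU lU xU a less.prems by blast
    have "coeff_in x j p' = 0" if "e \<le> j" for j
    proof -
      have "upoly x p' = [:c:] * upoly x p - monom l (e - d) * upoly x a"
        unfolding p'_def upoly_diff upoly_mult[of x c] upoly_mult[of x _ a]
        by (simp only: upoly_mult_Var_power[OF xc(2)] upoly_const[OF xc(1)])
      then have "coeff_in x j p' = c * coeff_in x j p - l * coeff_in x (j - (e - d)) a"
        using that by (simp flip: coeff_upoly add: coeff_monom_mult)
      also have "\<dots> = 0"
      proof (cases "j = e")
        case True
        then show ?thesis using de by (simp add: c l_def)
      next
        case False
        then show ?thesis using that de d by (simp add: coeff_in_gt e_def)
      qed
      finally show ?thesis .
    qed
    then have "deg_in x p' < deg_in x p"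
      using de d by (subst deg_in_less_iff) (auto simp: e_def)
    from less.hyps[OF this p'U] obtain k q s where
      qs: "q \<in> polys_in U" "s \<in> polys_in U" "c ^ k * p' = q * a + s" "deg_in x s < d"
        "\<And>y. y \<notin> vars a \<Longrightarrow> deg_in y s \<le> deg_in y p'"
      by blast
    have "c ^ Suc k * p = (q + c ^ k * l * Var x ^ (e - d)) * a + s"
      using qs(3) by (simp add: p'_def algebra_simps)
    moreover have "q + c ^ k * l * Var x ^ (e - d) \<in> polys_in U"
      using qs(1) cU lU xU by blast
    moreover have "deg_in y s \<le> deg_in y p" if y: "y \<notin> vars a" for y
    proof -
      have yx: "y \<noteq> x" using x y by blast
      have "deg_in y c = 0" using vars_coeff_in[of x d a] y by (intro deg_in_free) (auto simp: c)
      then have 1: "deg_in y (c * p) \<le> deg_in y p"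
        using deg_in_mult_le[of y c p] by simp
      have "y \<notin> vars ((Var x :: ('v, 'a) mpoly) ^ (e - d))"
        using vars_Var_power[of x "e - d"] yx by auto
      then have "deg_in y (l * Var x ^ (e - d) * a) \<le> deg_in y l"
        using deg_in_mult_le[of y "l * Var x ^ (e - d)" a] deg_in_mult_le[of y l "Var x ^ (e - d)"] y
        by (simp add: deg_in_free)
      also have "\<dots> \<le> deg_in y p" unfolding l_def by (rule deg_in_coeff_in)
      finally have "deg_in y p' \<le> deg_in y p"
        using 1 deg_in_diff_le[of y "c * p" "l * Var x ^ (e - d) * a"] by (simp add: p'_def)
      with qs(5)[OF y] show ?thesis by simp
    qed
    ultimately show ?thesis using qs by blast
  qed
qed

lemma dvd_mult_unitD:
  fixes p :: "'a::comm_semiring_1"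
  assumes "u dvd 1" "p dvd u * h"
  shows "p dvd h"
proof -
  obtain e where "1 = u * e" using assms(1) by blast
  then have "h = e * (u * h)" by (metis mult.assoc mult.commute mult_1)
  then show ?thesis using assms(2) by (metis dvd_mult)
qed

lemma dvd_iff_coeff_in:
  fixes p :: "('v, 'a::comm_ring_1) mpoly"
  assumes "x \<notin> vars p"
  shows "p dvd f \<longleftrightarrow> (\<forall>j. p dvd coeff_in x j f)"
proof
  assume "p dvd f"
  then show "\<forall>j. p dvd coeff_in x j f" by (auto simp: coeff_in_mult_free assms elim!: dvdE)
next
  assume "\<forall>j. p dvd coeff_in x j f"
  then have "p dvd (\<Sum>j\<le>deg_in x f. coeff_in x j f * Var x ^ j)" by (intro dvd_sum dvd_mult2) auto
  then show "p dvd f" by (simp flip: expand_coeff_in)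
qed

lemma gauss_prime_lift:
  fixes p :: "('v, 'a::comm_ring_1) mpoly"
  assumes x: "x \<notin> V" and p: "p \<in> polys_in V"
    and prime: "\<And>f g. f \<in> polys_in V \<Longrightarrow> g \<in> polys_in V \<Longrightarrow> p dvd f * g \<Longrightarrow> p dvd f \<or> p dvd g"
    and fg: "f \<in> polys_in (insert x V)" "g \<in> polys_in (insert x V)" "p dvd f * g"
  shows "p dvd f \<or> p dvd g"
proof (rule ccontr)
  assume neg: "\<not> (p dvd f \<or> p dvd g)"
  have xp: "x \<notin> vars p" using x p by (auto simp: polys_in_iff)
  have coeffs: "coeff_in x j f \<in> polys_in V" "coeff_in x j g \<in> polys_in V" for j
    by (rule polys_in_mono[OF _ polys_in_coeff_in[OF fg(1)]], use x in auto)
       (rule polys_in_mono[OF _ polys_in_coeff_in[OF fg(2)]], use x in auto)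
  have ex: "\<exists>i. \<not> p dvd coeff_in x i f" "\<exists>j. \<not> p dvd coeff_in x j g"
    using neg dvd_iff_coeff_in[OF xp, of f] dvd_iff_coeff_in[OF xp, of g] by blast+
  define i where "i = (LEAST i. \<not> p dvd coeff_in x i f)"
  define j where "j = (LEAST j. \<not> p dvd coeff_in x j g)"
  have i: "\<not> p dvd coeff_in x i f" "\<And>k. k < i \<Longrightarrow> p dvd coeff_in x k f"
    unfolding i_def using LeastI_ex[OF ex(1)] not_less_Least by blast+
  have j: "\<not> p dvd coeff_in x j g" "\<And>k. k < j \<Longrightarrow> p dvd coeff_in x k g"
    unfolding j_def using LeastI_ex[OF ex(2)] not_less_Least by blast+
  let ?t = "\<lambda>k. coeff_in x k f * coeff_in x (i + j - k) g"
  have "coeff_in x (i + j) (f * g) = (\<Sum>k\<le>i + j. ?t k)"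
    by (simp flip: coeff_upoly add: upoly_mult coeff_mult)
  also have "\<dots> = ?t i + (\<Sum>k\<in>{..i + j} - {i}. ?t k)"
    by (subst sum.remove[of _ i]) auto
  finally have eq: "?t i = coeff_in x (i + j) (f * g) - (\<Sum>k\<in>{..i + j} - {i}. ?t k)"
    by simp
  have "p dvd (\<Sum>k\<in>{..i + j} - {i}. ?t k)"
  proof (rule dvd_sum)
    fix k assume "k \<in> {..i + j} - {i}"
    then consider "k < i" | "i + j - k < j" by force
    then show "p dvd ?t k" using i(2) j(2) by cases auto
  qed
  moreover have "p dvd coeff_in x (i + j) (f * g)"
    using fg(3) dvd_iff_coeff_in[OF xp, of "f * g"] by blast
  ultimately have "p dvd ?t i" unfolding eq by (rule dvd_diff[rotated])
  then show False using prime[OF coeffs(1)[of i] coeffs(2)[of j]] i(1) j(1) by simp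
qed

definition tdeg :: "('v, 'a::zero) mpoly \<Rightarrow> nat"
  where "tdeg p = (\<Sum>v\<in>vars p. deg_in v p)"

lemma tdeg_superset: "finite V \<Longrightarrow> vars p \<subseteq> V \<Longrightarrow> tdeg p = (\<Sum>v\<in>V. deg_in v p)"
  unfolding tdeg_def by (intro sum.mono_neutral_left) (auto simp: deg_in_free)

lemma tdeg_mult:
  fixes p :: "('v::linorder, 'a::idom) mpoly"
  assumes "p \<noteq> 0" "q \<noteq> 0"
  shows "tdeg (p * q) = tdeg p + tdeg q"
proof -
  have "tdeg (p * q) = (\<Sum>v\<in>vars p \<union> vars q. deg_in v p + deg_in v q)"
    unfolding tdeg_def using assms by (simp add: vars_mult deg_in_mult)
  also have "\<dots> = tdeg p + tdeg q"
    by (simp add: sum.distrib tdeg_superset[of "vars p \<union> vars q"])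
  finally show ?thesis .
qed

lemma tdeg_eq_0_iff: "tdeg p = 0 \<longleftrightarrow> p \<in> polys_in {}"
  by (auto simp: tdeg_def polys_in_iff in_vars_iff_deg)

lemma tdeg_pos_iff:
  fixes p :: "('v::linorder, 'a::field) mpoly"
  shows "p \<noteq> 0 \<Longrightarrow> 0 < tdeg p \<longleftrightarrow> \<not> p dvd 1"
  using tdeg_eq_0_iff[of p] by (auto simp: dvd_one_iff)

lemma irreducible_divisor_exists:
  fixes a :: "('v::linorder, 'a::field) mpoly"
  assumes "a \<noteq> 0" "\<not> a dvd 1"
  shows "\<exists>p. irreducible p \<and> p dvd a"
  using assms
proof (induct "tdeg a" arbitrary: a rule: less_induct)
  case less
  show ?case
  proof (cases "irreducible a")
    case False
    then obtain b c where bc: "a = b * c" "\<not> b dvd 1" "\<not> c dvd 1"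
      using less.prems by (auto simp: irreducible_def)
    then have "b \<noteq> 0" "c \<noteq> 0" using less.prems by auto
    then have "tdeg b < tdeg a" using bc by (simp add: tdeg_mult tdeg_pos_iff)
    from less.hyps[OF this \<open>b \<noteq> 0\<close> bc(2)] show ?thesis unfolding bc(1) by (blast intro: dvd_mult2)
  qed (auto intro: exI[of _ a])
qed

text \<open>Primes of \<open>k[V]\<close> stay prime in \<open>k[V, x]\<close>, so a factor \<open>c\<close> of \<open>b * d\<close> in \<open>k[V]\<close> can be
  distributed over \<open>b\<close> and \<open>d\<close>.\<close>

lemma distribute_factor:
  fixes b c d :: "('v::linorder, 'a::field) mpoly"
  assumes prime: "\<And>p f g :: ('v, 'a) mpoly. irreducible p \<Longrightarrow> p \<in> polys_in V \<Longrightarrow> f \<in> polys_in W \<Longrightarrow> g \<in> polys_in W \<Longrightarrow>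
      p dvd f * g \<Longrightarrow> p dvd f \<or> p dvd g"
    and "c \<in> polys_in V" "c \<noteq> 0" "b \<in> polys_in W" "d \<in> polys_in W" "c dvd b * d"
  shows "\<exists>c1 c2. c = c1 * c2 \<and> c1 dvd b \<and> c2 dvd d"
  using assms(2-)
proof (induct "tdeg c" arbitrary: b c d rule: less_induct)
  case less
  show ?case
  proof (cases "c dvd 1")
    case True
    then show ?thesis by (intro exI[of _ c] exI[of _ 1]) (auto intro: dvd_trans)
  next
    case False
    then obtain p c' where p: "irreducible p" "c = p * c'"
      using irreducible_divisor_exists less.prems(2) by (metis dvdE)
    have nz: "p \<noteq> 0" "c' \<noteq> 0" using p less.prems by auto
    have V: "p \<in> polys_in V" "c' \<in> polys_in V"
      using p(2) less.prems(1,2) polys_in_factor by metis+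
    have deg: "tdeg c' < tdeg c"
      using nz p irreducible_not_unit[OF p(1)] by (simp add: tdeg_mult tdeg_pos_iff)
    have "p dvd b * d" using less.prems(5) p(2) by (auto intro: dvd_mult_left)
    then consider "p dvd b" | "p dvd d" using prime p(1) V(1) less.prems by blast
    then show ?thesis
    proof cases
      case 1
      then obtain b' where b': "b = p * b'" by blast
      have "b' \<in> polys_in W"
        using less.prems(3) polys_in_factor(2)[of p b' W] by (cases "b' = 0") (auto simp: b' nz)
      moreover have "c' dvd b' * d" using less.prems(5) nz by (simp add: p(2) b' mult.assoc)
      ultimately obtain c1 c2 where "c' = c1 * c2" "c1 dvd b'" "c2 dvd d"
        using less.hyps[OF deg V(2) nz(2)] less.prems(4) by blast
      then show ?thesis unfolding p(2) b' by (intro exI[of _ "p * c1"] exI[of _ c2]) auto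
    next
      case 2
      then obtain d' where d': "d = p * d'" by blast
      have "d' \<in> polys_in W"
        using less.prems(4) polys_in_factor(2)[of p d' W] by (cases "d' = 0") (auto simp: d' nz)
      moreover have "c' dvd b * d'" using less.prems(5) nz by (simp add: p(2) d' mult.left_commute)
      ultimately obtain c1 c2 where "c' = c1 * c2" "c1 dvd b" "c2 dvd d'"
        using less.hyps[OF deg V(2) nz(2)] less.prems(3) by blast
      then show ?thesis unfolding p(2) d' by (intro exI[of _ "c1"] exI[of _ "p * c2"]) auto
    qed
  qed
qed

lemma irreducible_imp_prime_aux:
  fixes p :: "('v::linorder, 'a::field) mpoly"
  assumes "finite V"
  shows "irreducible p \<Longrightarrow> p \<in> polys_in V \<Longrightarrow> f \<in> polys_in V \<Longrightarrow> g \<in> polys_in V \<Longrightarrow>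
    p dvd f * g \<Longrightarrow> p dvd f \<or> p dvd g"
  using assms
proof (induct V arbitrary: p f g rule: finite_induct)
  case empty
  then have "p dvd 1" by (intro constant_dvd_one) auto
  then show ?case using empty irreducible_not_unit by blast
next
  case (insert x V)
  let ?W = "insert x V"
  have prime: "p dvd f \<or> p dvd g" if "irreducible p" "p \<in> polys_in V" "f \<in> polys_in ?W" "g \<in> polys_in ?W"
    "p dvd f * g" for p f g :: "('v, 'a) mpoly"
    by (rule gauss_prime_lift[OF insert.hyps(2) that(2) insert.hyps(3)[OF that(1,2)] that(3-5)])
  show ?case
  proof (cases "x \<in> vars p")
    case False
    then have "p \<in> polys_in V" using insert.prems(2) by (auto simp: polys_in_iff)
    then show ?thesis using prime insert.prems by blast
  next
    case True
    have p0: "p \<noteq> 0" using True by auto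
    have p1: "\<not> p dvd 1" using insert.prems(1) irreducible_not_unit by blast
    have xV: "x \<notin> vars c" if "c \<in> polys_in V" for c :: "('v, 'a) mpoly"
      using that insert.hyps(2) by (auto simp: polys_in_iff)
    have cancel: "p dvd h" if c: "c \<in> polys_in V" "c \<noteq> 0" and h: "h \<in> polys_in ?W" "p dvd c * h" for c h
    proof (cases "h = 0")
      case False
      obtain w where w: "c * h = p * w" using h(2) by blast
      have w0: "w \<noteq> 0" using w c(2) False by auto
      have "c * h \<in> polys_in ?W" using c(1) h(1) by (auto intro: polys_in_mono)
      then have wW: "w \<in> polys_in ?W" using polys_in_factor(2)[of p w] p0 w0 by (simp add: w)
      obtain c1 c2 where c12: "c = c1 * c2" "c1 dvd p" "c2 dvd w"
        using distribute_factor[OF prime c insert.prems(2) wW] dvd_triv_left[of c h] unfolding w by blast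
      have c12V: "c1 \<noteq> 0" "c2 \<noteq> 0" "c1 \<in> polys_in V" using c c12(1) polys_in_factor by auto
      obtain p1 w2 where pw: "p = c1 * p1" "w = c2 * w2" using c12 by blast
      have "\<not> p1 dvd 1"
      proof
        assume "p1 dvd 1"
        then have "vars p1 = {}" by (auto simp: dvd_one_iff polys_in_iff)
        then have "x \<notin> vars p"
          using xV[OF c12V(3)] vars_mult_subset[of c1 p1] by (auto simp: pw)
        then show False using True by blast
      qed
      then have "c1 dvd 1" using insert.prems(1) pw(1) by (auto simp: irreducible_def)
      have "c1 * h = p * w2" using w c12V by (simp add: c12(1) pw(2) algebra_simps)
      then have "p dvd c1 * h" by simp
      then show "p dvd h" using \<open>c1 dvd 1\<close> by (rule dvd_mult_unitD[rotated])
    qed auto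
    show ?thesis
    proof (rule ccontr)
      assume neg: "\<not> ?thesis"
      define I where "I = {u * p + v * f | u v. u \<in> polys_in ?W \<and> v \<in> polys_in ?W}"
      have IW: "I \<subseteq> polys_in ?W" unfolding I_def using insert.prems(2,3) by blast
      have pI: "p \<in> I" unfolding I_def by (rule CollectI, rule exI[of _ 1], rule exI[of _ 0], simp)
      have fI: "f \<in> I" unfolding I_def by (rule CollectI, rule exI[of _ 0], rule exI[of _ 1], simp)
      have Idiff: "a * h - q * r \<in> I" if hr: "h \<in> I" "r \<in> I" and aq: "a \<in> polys_in ?W" "q \<in> polys_in ?W"
        for a h q r
      proof -
        obtain u v u' v' where "h = u * p + v * f" "r = u' * p + v' * f"
          "u \<in> polys_in ?W" "v \<in> polys_in ?W" "u' \<in> polys_in ?W" "v' \<in> polys_in ?W"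
          using hr unfolding I_def by blast
        then show ?thesis unfolding I_def using aq
          by (intro CollectI exI[of _ "a * u - q * u'"] exI[of _ "a * v - q * v'"])
             (auto simp: algebra_simps)
      qed
      obtain r where r: "r \<in> I" "r \<noteq> 0" "\<And>s. s \<in> I \<Longrightarrow> s \<noteq> 0 \<Longrightarrow> deg_in x r \<le> deg_in x s"
        using ex_has_least_nat[of "\<lambda>r. r \<in> I \<and> r \<noteq> 0" p "deg_in x"] pI p0 by blast
      obtain u v where uv: "r = u * p + v * f" "u \<in> polys_in ?W" "v \<in> polys_in ?W"
        using r(1) unfolding I_def by blast
      show False
      proof (cases "deg_in x r = 0")
        case True
        then have "x \<notin> vars r" by (simp add: in_vars_iff_deg)
        moreover have "r \<in> polys_in ?W" using r(1) IW by blast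
        ultimately have rV: "r \<in> polys_in V" by (auto simp: polys_in_iff)
        have "r * g = p * (u * g) + v * (f * g)" by (simp add: uv(1) algebra_simps)
        then have "p dvd r * g" using insert.prems(5) by (simp only: dvd_add dvd_mult dvd_triv_left)
        then have "p dvd g" by (rule cancel[OF rV r(2) insert.prems(4)])
        then show False using neg by blast
      next
        case False
        define c where "c = coeff_in x (deg_in x r) r"
        have rW: "r \<in> polys_in ?W" using r(1) IW by blast
        have c: "c \<noteq> 0" "c \<in> polys_in V"
          unfolding c_def using r(2) coeff_in_deg_in[of r x]
            polys_in_mono[OF _ polys_in_coeff_in[OF rW, of x], of V] by auto
        have div: "\<exists>k q. q \<in> polys_in ?W \<and> c ^ k * h = q * r" if h: "h \<in> I" for h
        proof -
          have hW: "h \<in> polys_in ?W" using h IW by blast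
          obtain k q s where s: "q \<in> polys_in ?W" "c ^ k * h = q * r + s" "deg_in x s < deg_in x r"
            using pseudo_division[OF hW rW refl _ refl, of x] False unfolding c_def by blast
          have "c ^ k \<in> polys_in ?W" using c(2) by (auto intro: polys_in_mono)
          then have "s \<in> I" using Idiff[OF h r(1) _ s(1), of "c ^ k"] by (simp add: s(2))
          then have "s = 0" using r(3)[of s] s(3) by linarith
          then show ?thesis using s by auto
        qed
        obtain k q where q: "q \<in> polys_in ?W" "c ^ k * p = q * r" using div[OF pI] by blast
        obtain k' q' where q': "q' \<in> polys_in ?W" "c ^ k' * f = q' * r" using div[OF fI] by blast
        have ck: "c ^ k \<in> polys_in V" "c ^ k \<noteq> 0" "c ^ k' \<in> polys_in V" "c ^ k' \<noteq> 0" using c by auto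
        obtain c1 c2 where c12: "c ^ k = c1 * c2" "c1 dvd q" "c2 dvd r"
          using distribute_factor[OF prime ck(1,2) q(1) rW] dvd_triv_left[of "c ^ k" p]
          unfolding q(2) by blast
        obtain q1 r1 where qr: "q = c1 * q1" "r = c2 * r1" using c12 by blast
        have c12V: "c1 \<noteq> 0" "c2 \<noteq> 0" "c2 \<in> polys_in V"
          using ck(1,2) c12(1) polys_in_factor(2)[of c1 c2 V] by auto
        have p: "p = q1 * r1" using q(2) c12V by (simp add: c12(1) qr algebra_simps)
        have "\<not> r1 dvd 1"
        proof
          assume "r1 dvd 1"
          then have "vars r1 = {}" by (auto simp: dvd_one_iff polys_in_iff)
          then have "x \<notin> vars r" using xV[OF c12V(3)] vars_mult_subset[of c2 r1] by (auto simp: qr)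
          then show False using False by (simp add: in_vars_iff_deg)
        qed
        then have "q1 dvd 1" using insert.prems(1) p by (auto simp: irreducible_def)
        then have "p dvd r1" by (rule dvd_mult_unitD) (simp add: p)
        then have "p dvd c ^ k' * f" unfolding q'(2) qr by simp
        then have "p dvd f" by (rule cancel[OF ck(3,4) insert.prems(3)])
        then show False using neg by blast
      qed
    qed
  qed
qed

lemma irreducible_imp_prime:
  fixes p :: "('v::linorder, 'a::field) mpoly"
  assumes "irreducible p" "p dvd f * g"
  shows "p dvd f \<or> p dvd g"
proof -
  let ?V = "vars p \<union> vars f \<union> vars g"
  have "finite ?V" and V: "p \<in> polys_in ?V" "f \<in> polys_in ?V" "g \<in> polys_in ?V"
    by (auto simp: polys_in_iff)
  then show ?thesis by (rule irreducible_imp_prime_aux[OF _ assms(1) _ _ _ assms(2)])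
qed

lemma dvd_mult_coprime:
  fixes a b c :: "('v::linorder, 'a::field) mpoly"
  assumes "b dvd c * a" "b \<noteq> 0" "\<And>d. d dvd a \<Longrightarrow> d dvd b \<Longrightarrow> d dvd 1"
  shows "b dvd c"
proof -
  have "\<exists>b1 b2. b = b1 * b2 \<and> b1 dvd c \<and> b2 dvd a"
  proof (rule distribute_factor[of UNIV UNIV])
    fix p f g :: "('v, 'a) mpoly"
    assume "irreducible p" "p dvd f * g"
    then show "p dvd f \<or> p dvd g" by (rule irreducible_imp_prime)
  next
    show "b dvd c * a" "b \<noteq> 0" by (fact assms)+
  qed (simp_all add: polys_in_iff)
  then obtain b1 b2 where b: "b = b1 * b2" "b1 dvd c" "b2 dvd a" by blast
  have "b2 dvd 1" by (rule assms(3)) (simp_all add: b)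
  then have "b dvd b1" unfolding b(1) by (rule dvd_mult_unitD) (simp add: mult.commute)
  then show ?thesis using b(2) by (rule dvd_trans)
qed

section \<open>Orders, linear dependence and reduction\<close>

locale strict_total_order =
  fixes lt :: "'a \<Rightarrow> 'a \<Rightarrow> bool"
  assumes irrefl: "\<not> lt a a"
    and trans: "lt a b \<Longrightarrow> lt b c \<Longrightarrow> lt a c"
    and total: "a \<noteq> b \<Longrightarrow> lt a b \<or> lt b a"
begin

lemma finite_has_min: "finite X \<Longrightarrow> X \<noteq> {} \<Longrightarrow> \<exists>m\<in>X. \<forall>x\<in>X. x \<noteq> m \<longrightarrow> lt m x"
proof (induct X rule: finite_ne_induct)
  case (insert x X)
  then obtain m where "m \<in> X" "\<forall>x\<in>X. x \<noteq> m \<longrightarrow> lt m x" by blast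
  then show ?case using trans[of x m] total[of x m] by (cases "lt x m") auto
qed auto

lemma finite_has_max: "finite X \<Longrightarrow> X \<noteq> {} \<Longrightarrow> \<exists>m\<in>X. \<forall>x\<in>X. x \<noteq> m \<longrightarrow> lt x m"
proof -
  interpret conv: strict_total_order "\<lambda>a b. lt b a"
    by unfold_locales (auto simp: irrefl intro: trans dest: total)
  show "finite X \<Longrightarrow> X \<noteq> {} \<Longrightarrow> \<exists>m\<in>X. \<forall>x\<in>X. x \<noteq> m \<longrightarrow> lt x m"
    by (rule conv.finite_has_min)
qed

lemma sorted_wrt_unique:
  "sorted_wrt lt xs \<Longrightarrow> sorted_wrt lt ys \<Longrightarrow> set xs = set ys \<Longrightarrow> xs = ys"
proof (induct xs arbitrary: ys)
  case (Cons x xs)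
  then obtain y ys' where ys: "ys = y # ys'" by (cases ys) auto
  have "x = y"
  proof (rule ccontr)
    assume "x \<noteq> y"
    then have "x \<in> set ys'" "y \<in> set xs" using Cons.prems(3) by (auto simp: ys)
    then have "lt x y" "lt y x" using Cons.prems(1,2) by (auto simp: ys)
    then show False using trans irrefl by blast
  qed
  moreover have "x \<notin> set xs" "y \<notin> set ys'" using Cons.prems(1,2) irrefl by (auto simp: ys)
  ultimately have "set xs = set ys'" using Cons.prems(3) by (auto simp: ys)
  then show ?case using Cons \<open>x = y\<close> by (auto simp: ys)
qed simp

lemma sorted_wrt_exists: "finite X \<Longrightarrow> \<exists>xs. sorted_wrt lt xs \<and> set xs = X"
proof (induct X rule: finite_induct)
  case (insert x X)
  then obtain xs where xs: "sorted_wrt lt xs" "set xs = X" by blast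
  let ?ys = "filter (\<lambda>y. lt y x) xs @ x # filter (\<lambda>y. lt x y) xs"
  have "sorted_wrt lt ?ys" using xs(1) by (auto simp: sorted_wrt_append sorted_wrt_filter intro: trans)
  moreover have "set ?ys = insert x X"
    using xs(2) insert.hyps(2) total by fastforce
  ultimately show ?case by blast
qed simp

lemma increasing_list:
  assumes "finite X"
  shows "sorted_wrt lt (increasing_list lt X)" "set (increasing_list lt X) = X"
proof -
  have "\<exists>!xs. sorted_wrt lt xs \<and> set xs = X"
    using sorted_wrt_exists[OF assms] sorted_wrt_unique by blast
  from theI'[OF this] show "sorted_wrt lt (increasing_list lt X)" "set (increasing_list lt X) = X"
    unfolding increasing_list_def by auto
qed

lemma seq_lower_Nil [simp]: "\<not> seq_lower lt [] ys" "seq_lower lt (x # xs) []"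
  by (auto simp: seq_lower_def)

lemma seq_lower_Cons: "seq_lower lt (x # xs) (y # ys) \<longleftrightarrow> lt x y \<or> x = y \<and> seq_lower lt xs ys"
proof -
  have ex_split: "(\<exists>j. P j) \<longleftrightarrow> P 0 \<or> (\<exists>j. P (Suc j))" for P :: "nat \<Rightarrow> bool"
    by (metis not0_implies_Suc)
  have "(\<exists>j. j < length (x # xs) \<and> j < length (y # ys) \<and> (\<forall>i<j. (x # xs) ! i = (y # ys) ! i) \<and>
      lt ((x # xs) ! j) ((y # ys) ! j)) \<longleftrightarrow>
    lt x y \<or> x = y \<and> (\<exists>j. j < length xs \<and> j < length ys \<and> (\<forall>i<j. xs ! i = ys ! i) \<and> lt (xs ! j) (ys ! j))"
    by (subst ex_split) (simp add: All_less_Suc2, blast)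
  moreover have "length (y # ys) < length (x # xs) \<and> (\<forall>i<length (y # ys). (x # xs) ! i = (y # ys) ! i) \<longleftrightarrow>
    x = y \<and> length ys < length xs \<and> (\<forall>i<length ys. xs ! i = ys ! i)"
    by (simp add: All_less_Suc2) blast
  ultimately show ?thesis unfolding seq_lower_def by blast
qed

lemma seq_lower_iff:
  "sorted_wrt lt xs \<Longrightarrow> sorted_wrt lt ys \<Longrightarrow>
    seq_lower lt xs ys \<longleftrightarrow> (\<exists>v\<in>set xs - set ys. \<forall>w. lt w v \<longrightarrow> (w \<in> set xs \<longleftrightarrow> w \<in> set ys))"
proof (induct xs arbitrary: ys)
  case (Cons x xs)
  have x: "\<And>w. w \<in> set xs \<Longrightarrow> lt x w" using Cons.prems(1) by auto
  show ?case
  proof (cases ys)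
    case Nil
    have "\<forall>w. lt w x \<longrightarrow> w \<notin> set (x # xs)" using x trans irrefl by (metis set_ConsD)
    then show ?thesis by (auto simp: Nil)
  next
    case (Cons y ys')
    have y: "\<And>w. w \<in> set ys' \<Longrightarrow> lt y w" using Cons.prems(2) Cons by auto
    consider "lt x y" | "x = y" | "lt y x" using total by blast
    then show ?thesis
    proof cases
      case 1
      then have "x \<notin> set ys" "\<forall>w. lt w x \<longrightarrow> w \<notin> set (x # xs) \<and> w \<notin> set ys"
        using x y trans irrefl unfolding Cons by (metis set_ConsD)+
      then have "x \<in> set (x # xs) - set ys \<and> (\<forall>w. lt w x \<longrightarrow> (w \<in> set (x # xs) \<longleftrightarrow> w \<in> set ys))"
        by auto
      then show ?thesis using 1 unfolding Cons seq_lower_Cons by blast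
    next
      case 2
      have "x \<notin> set xs" "x \<notin> set ys'" using x y irrefl 2 by auto
      then have "(\<exists>v\<in>set (x # xs) - set ys. \<forall>w. lt w v \<longrightarrow> (w \<in> set (x # xs) \<longleftrightarrow> w \<in> set ys)) \<longleftrightarrow>
          (\<exists>v\<in>set xs - set ys'. \<forall>w. lt w v \<longrightarrow> (w \<in> set xs \<longleftrightarrow> w \<in> set ys'))"
        using 2 by (auto simp: Cons)
      moreover have "seq_lower lt xs ys' \<longleftrightarrow>
          (\<exists>v\<in>set xs - set ys'. \<forall>w. lt w v \<longrightarrow> (w \<in> set xs \<longleftrightarrow> w \<in> set ys'))"
        using Cons.prems Cons by (intro Cons.hyps) auto
      ultimately show ?thesis using 2 irrefl by (simp add: Cons seq_lower_Cons)
    next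
      case 3
      have "y \<notin> set (x # xs)" using 3 x trans irrefl by (metis set_ConsD)
      moreover have "lt y v" if "v \<in> set (x # xs)" for v using 3 x trans that by (metis set_ConsD)
      moreover have "y \<in> set ys" "\<not> lt x y" "x \<noteq> y" using 3 trans irrefl by (auto simp: Cons)
      ultimately show ?thesis unfolding Cons seq_lower_Cons by blast
    qed
  qed
qed simp

lemma seq_lower_increasing_list_iff:
  assumes "finite X" "finite Y"
  shows "seq_lower lt (increasing_list lt X) (increasing_list lt Y) \<longleftrightarrow>
    (\<exists>v\<in>X - Y. \<forall>w. lt w v \<longrightarrow> (w \<in> X \<longleftrightarrow> w \<in> Y))"
  using seq_lower_iff[OF increasing_list(1)[OF assms(1)] increasing_list(1)[OF assms(2)]]
  by (simp add: increasing_list(2) assms)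

lemma finite_sets_differ:
  assumes "finite X" "finite Y" "X \<noteq> Y"
  shows "(\<exists>v\<in>X - Y. \<forall>w. lt w v \<longrightarrow> (w \<in> X \<longleftrightarrow> w \<in> Y)) \<or> (\<exists>v\<in>Y - X. \<forall>w. lt w v \<longrightarrow> (w \<in> X \<longleftrightarrow> w \<in> Y))"
proof -
  let ?D = "(X - Y) \<union> (Y - X)"
  have "finite ?D" "?D \<noteq> {}" using assms by auto
  then obtain m where m: "m \<in> ?D" "\<forall>x\<in>?D. x \<noteq> m \<longrightarrow> lt m x" using finite_has_min by blast
  have "w \<notin> ?D" if "lt w m" for w
  proof
    assume "w \<in> ?D"
    moreover have "w \<noteq> m" using that irrefl by auto
    ultimately have "lt m w" using m(2) by auto
    then show False using that trans irrefl by blast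
  qed
  then show ?thesis using m(1) by blast
qed

end

lemma strict_total_order_ranking:
  assumes "ranking le"
  shows "strict_total_order (strict le)"
proof
  have le: "reflp le" "transp le" "antisymp le" "totalp le" using assms by (auto simp: ranking_def)
  show "strict le a c" if "strict le a b" "strict le b c" for a b c
    using that le(2,3) unfolding strict_def by (metis antisympD transpD)
  show "strict le a b \<or> strict le b a" if "a \<noteq> b" for a b
    using le(4) that by (auto simp: strict_def totalp_on_def)
qed (simp add: strict_def)

lemma strict_total_order_rank_less:
  assumes "strict_total_order (strict le)"
  shows "strict_total_order (rank_less le)"
proof -
  interpret strict_total_order "strict le" by (fact assms)
  show ?thesis
    by unfold_locales (auto simp: rank_less_def irrefl prod_eq_iff dest: total intro: trans)
qed

lemma domain_linear_dependence:
  fixes S :: "'a::idom set" and M :: "'i \<Rightarrow> 'b \<Rightarrow> 'a"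
  assumes S: "0 \<in> S" "1 \<in> S" "\<And>x y. x \<in> S \<Longrightarrow> y \<in> S \<Longrightarrow> x - y \<in> S" "\<And>x y. x \<in> S \<Longrightarrow> y \<in> S \<Longrightarrow> x * y \<in> S"
    and B: "finite B"
  shows "finite X \<Longrightarrow> card B < card X \<Longrightarrow> (\<And>i b. i \<in> X \<Longrightarrow> b \<in> B \<Longrightarrow> M i b \<in> S) \<Longrightarrow>
    \<exists>c. (\<forall>i. c i \<in> S) \<and> (\<exists>i\<in>X. c i \<noteq> 0) \<and> (\<forall>b\<in>B. (\<Sum>i\<in>X. c i * M i b) = 0)"
  using B
proof (induct B arbitrary: X M rule: finite_induct)
  case empty
  then have "X \<noteq> {}" by auto
  then show ?case using S by (intro exI[of _ "\<lambda>_. 1"]) auto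
next
  case (insert b B)
  have Ssum: "(\<Sum>i\<in>Y. f i) \<in> S" if "\<And>i. i \<in> Y \<Longrightarrow> f i \<in> S" for Y :: "'i set" and f
    using that
  proof (induct Y rule: infinite_finite_induct)
    case (insert y Y)
    then have "f y - (0 - sum f Y) \<in> S" by (intro S) auto
    then show ?case using insert by simp
  qed (auto simp: S)
  show ?case
  proof (cases "\<forall>i\<in>X. M i b = 0")
    case True
    have "\<exists>c. (\<forall>i. c i \<in> S) \<and> (\<exists>i\<in>X. c i \<noteq> 0) \<and> (\<forall>b\<in>B. (\<Sum>i\<in>X. c i * M i b) = 0)"
      using insert.prems insert.hyps by (intro insert.hyps(3)) auto
    then show ?thesis using True by auto
  next
    case False
    then obtain j where j: "j \<in> X" "M j b \<noteq> 0" by blast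
    let ?X = "X - {j}"
    let ?M = "\<lambda>i b'. M j b * M i b' - M i b * M j b'"
    have "\<exists>c. (\<forall>i. c i \<in> S) \<and> (\<exists>i\<in>?X. c i \<noteq> 0) \<and> (\<forall>b\<in>B. (\<Sum>i\<in>?X. c i * ?M i b) = 0)"
      using insert.prems insert.hyps j by (intro insert.hyps(3)) (auto intro!: S)
    then obtain c where c: "\<forall>i. c i \<in> S" "\<exists>i\<in>?X. c i \<noteq> 0" "\<forall>b\<in>B. (\<Sum>i\<in>?X. c i * ?M i b) = 0"
      by blast
    define e where "e i = (if i = j then 0 - (\<Sum>i\<in>?X. c i * M i b) else if i \<in> X then c i * M j b else 0)" for i
    have eS: "\<forall>i. e i \<in> S"
      unfolding e_def using c(1) insert.prems(3) j by (auto intro!: S Ssum simp del: diff_0)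
    have ej: "e j = - (\<Sum>i\<in>?X. c i * M i b)" by (simp add: e_def)
    have enz: "\<exists>i\<in>X. e i \<noteq> 0" using c(2) j by (auto simp: e_def)
    have "(\<Sum>i\<in>X. e i * M i b') = (\<Sum>i\<in>?X. c i * ?M i b')" for b'
    proof -
      have "(\<Sum>i\<in>X. e i * M i b') = e j * M j b' + (\<Sum>i\<in>?X. e i * M i b')"
        using insert.prems(1) j(1) by (rule sum.remove)
      also have "(\<Sum>i\<in>?X. e i * M i b') = (\<Sum>i\<in>?X. c i * M j b * M i b')"
        by (intro sum.cong) (auto simp: e_def)
      finally show ?thesis
        by (simp add: ej sum_distrib_left sum_distrib_right sum_subtractf algebra_simps)
    qed
    moreover have "(\<Sum>i\<in>?X. c i * ?M i b) = 0" by (simp add: mult.commute)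
    ultimately show ?thesis using eS enz c(3) by (intro exI[of _ e]) auto
  qed
qed

lemma ideal_inD:
  assumes "ideal_in R I"
  shows "0 \<in> I" "I \<subseteq> R" "a \<in> I \<Longrightarrow> b \<in> I \<Longrightarrow> a + b \<in> I" "r \<in> R \<Longrightarrow> a \<in> I \<Longrightarrow> r * a \<in> I"
  using assms by (auto simp: ideal_in_def)

text \<open>Ritt's reduction with respect to a triangular set. The ideal \<open>K\<close> and the multiplicative set
  \<open>S\<close> of admissible multipliers are left open: \<open>S\<close> will consist either of factors of
  \<open>H\<^sub>A\<^sup>m\<close> or of nonzero elements of \<open>k[N]\<close>.\<close>

lemma triangular_reduction:
  fixes a :: "'v \<Rightarrow> ('v, 'a::comm_ring_1) mpoly"
  assumes le: "strict_total_order (strict le)"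
    and K: "ideal_in (polys_in U) K"
    and S: "S \<subseteq> polys_in U" "1 \<in> S" "\<And>s t. s \<in> S \<Longrightarrow> t \<in> S \<Longrightarrow> s * t \<in> S"
    and p: "p \<in> polys_in U"
  shows "finite W \<Longrightarrow>
    (\<And>w. w \<in> W \<Longrightarrow> a w \<in> K \<and> vars (a w) \<subseteq> {v. v = w \<or> strict le v w} \<and> deg_in w (a w) = d w \<and> 0 < d w \<and>
      coeff_in w (d w) (a w) \<in> S) \<Longrightarrow>
    \<exists>s\<in>S. \<exists>r\<in>polys_in U. s * p - r \<in> K \<and> (\<forall>w\<in>W. deg_in w r < d w)"
proof (induct "card W" arbitrary: W)
  case 0
  then show ?case using S(2) p ideal_inD(1)[OF K] by (intro bexI[of _ 1] bexI[of _ p]) auto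
next
  case (Suc n)
  interpret strict_total_order "strict le" by (fact le)
  have "W \<noteq> {}" using Suc by auto
  then obtain m where m: "m \<in> W" "\<forall>x\<in>W. x \<noteq> m \<longrightarrow> strict le m x"
    using finite_has_min Suc.prems(1) by blast
  have "\<exists>s\<in>S. \<exists>r\<in>polys_in U. s * p - r \<in> K \<and> (\<forall>w\<in>W - {m}. deg_in w r < d w)"
    using Suc m by (intro Suc.hyps(1)) auto
  then obtain s r where sr: "s \<in> S" "r \<in> polys_in U" "s * p - r \<in> K" "\<forall>w\<in>W - {m}. deg_in w r < d w"
    by blast
  define c where "c = coeff_in m (d m) (a m)"
  have am: "a m \<in> K" "a m \<in> polys_in U" "d m = deg_in m (a m)" "0 < d m" "c \<in> S"
    and vars_am: "vars (a m) \<subseteq> {v. v = m \<or> strict le v m}"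
    using Suc.prems(2)[OF m(1)] ideal_inD(2)[OF K] by (auto simp: c_def)
  obtain k q r' where r': "q \<in> polys_in U" "r' \<in> polys_in U" "c ^ k * r = q * a m + r'" "deg_in m r' < d m"
    "\<And>y. y \<notin> vars (a m) \<Longrightarrow> deg_in y r' \<le> deg_in y r"
    using pseudo_division[OF sr(2) am(2-4) c_def] by blast
  have ck: "c ^ k \<in> S" by (induct k) (auto simp: S am)
  have "c ^ k * s * p - r' = c ^ k * (s * p - r) + q * a m"
    using r'(3) by (simp add: algebra_simps)
  also have "\<dots> \<in> K"
    using ideal_inD(3,4)[OF K] sr(3) am(1) r'(1) ck S(1) by blast
  finally have "c ^ k * s * p - r' \<in> K" .
  moreover have "deg_in w r' < d w" if "w \<in> W" for w
  proof (cases "w = m")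
    case False
    then have "w \<notin> vars (a m)" using vars_am m(2) that trans irrefl by blast
    then have "deg_in w r' \<le> deg_in w r" by (rule r'(5))
    also have "\<dots> < d w" using sr(4) that False by blast
    finally show ?thesis .
  qed (use r'(4) in simp)
  ultimately show ?case using S(3)[OF ck sr(1)] r'(2) by blast
qed

section \<open>Characteristic sets\<close>

lemma ideal_in_uminus: "ideal_in (polys_in U) K \<Longrightarrow> a \<in> K \<Longrightarrow> - a \<in> K"
  for a :: "('v, 'a::comm_ring_1) mpoly"
  using ideal_inD(4)[of "polys_in U" K "- 1" a] by (simp add: polys_in_uminus)

lemma polys_in_UNIV [simp]: "polys_in UNIV = UNIV"
  by (auto simp: polys_in_iff)

lemma ideal_in_diff: "ideal_in (polys_in U) K \<Longrightarrow> a \<in> K \<Longrightarrow> b \<in> K \<Longrightarrow> a - b \<in> K"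
  for a :: "('v, 'a::comm_ring_1) mpoly"
  using ideal_inD(3)[of "polys_in U" K a "- b"] ideal_in_uminus[of U K b] by simp

lemma ideal_in_sum: "ideal_in R K \<Longrightarrow> (\<And>x. x \<in> X \<Longrightarrow> f x \<in> K) \<Longrightarrow> sum f X \<in> K"
  by (induct X rule: infinite_finite_induct) (auto intro: ideal_inD)

lemma ideal_in_hull:
  assumes "ideal_in R J" "X \<subseteq> J"
  shows "ideal_in R (ideal_in R hull X)"
proof -
  have "ideal_in R hull X \<subseteq> J" using assms by (intro hull_minimal)
  then have "ideal_in R hull X \<subseteq> R" using ideal_inD(2)[OF assms(1)] by blast
  then show ?thesis unfolding ideal_in_def hull_def by simp
qed

lemma act_zero [simp]: "act (\<lambda>_. 0) v = v"
  by (simp add: act_def)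

lemma act_eq_self_iff: "act \<theta> v = v \<longleftrightarrow> \<theta> = (\<lambda>_. 0)"
  by (cases v) (auto simp: act_def fun_eq_iff)

lemma le_iff_strict: "ranking le \<Longrightarrow> le u v \<longleftrightarrow> u = v \<or> strict le u v"
  by (auto simp: ranking_def strict_def reflp_def)

lemma strict_act: "ranking le \<Longrightarrow> \<theta> \<noteq> (\<lambda>_. 0) \<Longrightarrow> strict le u (act \<theta> u)"
  using act_eq_self_iff[of \<theta> u] by (auto simp: ranking_def strict_def)

lemma leader:
  assumes "ranking le" "f \<notin> polys_in {}"
  shows "leader le f \<in> vars f" "v \<in> vars f \<Longrightarrow> v = leader le f \<or> strict le v (leader le f)"
proof -
  interpret strict_total_order "strict le" using assms(1) by (rule strict_total_order_ranking)
  have "finite (vars f)" "vars f \<noteq> {}" using assms(2) by (auto simp: polys_in_iff)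
  then obtain u where u: "u \<in> vars f" "\<forall>v\<in>vars f. v \<noteq> u \<longrightarrow> strict le v u"
    using finite_has_max by blast
  have "leader le f = u"
    unfolding leader_def
  proof (rule the_equality)
    show "u \<in> vars f \<and> (\<forall>v\<in>vars f. le v u)" using u le_iff_strict[OF assms(1)] by blast
    show "u' = u" if "u' \<in> vars f \<and> (\<forall>v\<in>vars f. le v u')" for u'
      using that u le_iff_strict[OF assms(1)] trans irrefl by metis
  qed
  then show "leader le f \<in> vars f" "v \<in> vars f \<Longrightarrow> v = leader le f \<or> strict le v (leader le f)"
    using u by auto
qed

lemma reduced_eq_leader_rank:
  "reduced le f g \<Longrightarrow> leader le f = leader le g \<Longrightarrow> rank_less le (rank le f) (rank le g)"
  by (simp add: reduced_def rank_less_def rank_def)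

lemma char_set_reduced_element:
  fixes f :: "('d, 'y, 'k::comm_ring_1) dpoly"
  assumes rk: "ranking le" and cs: "char_set le A I" and f: "f \<in> I" "f \<notin> polys_in {}"
  shows "\<exists>g\<in>A. \<not> reduced le f g"
proof (rule ccontr)
  assume "\<not> ?thesis"
  then have red: "\<And>g. g \<in> A \<Longrightarrow> reduced le f g" by blast
  interpret s: strict_total_order "strict le" using rk by (rule strict_total_order_ranking)
  interpret r: strict_total_order "rank_less le"
    by (rule strict_total_order_rank_less) (rule s.strict_total_order_axioms)
  have A: "autoreduced le A" "A \<subseteq> I" "\<And>B. autoreduced le B \<Longrightarrow> B \<subseteq> I \<Longrightarrow> \<not> lower_rank le B A"
    using cs by (auto simp: char_set_def)
  have fin: "finite A" using A(1) by (simp add: autoreduced_def)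
  define B where "B = insert f {g \<in> A. rank_less le (rank le g) (rank le f)}"
  have red': "reduced le g f" if g: "g \<in> A" "rank_less le (rank le g) (rank le f)" for g
  proof -
    have "leader le g \<noteq> leader le f"
      using reduced_eq_leader_rank[OF red[OF g(1)]] g(2) r.trans r.irrefl by metis
    then have lt: "strict le (leader le g) (leader le f)" using g(2) by (auto simp: rank_less_def rank_def)
    have gc: "g \<notin> polys_in {}" using g(1) A(1) by (auto simp: autoreduced_def)
    have nv: "v \<notin> vars g" if "v = leader le f \<or> strict le (leader le f) v" for v
      using leader(2)[OF rk gc, of v] lt that s.trans s.irrefl by metis
    have "deg_in (leader le f) g = 0" using nv by (simp add: deg_in_free)
    moreover have "0 < deg_in (leader le f) f"
      using leader(1)[OF rk f(2)] by (simp add: in_vars_iff_deg)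
    ultimately show ?thesis using nv strict_act[OF rk] by (auto simp: reduced_def)
  qed
  have "autoreduced le B"
    using A(1) f(2) red red' unfolding autoreduced_def B_def by auto
  moreover have "B \<subseteq> I" using A(2) f(1) by (auto simp: B_def)
  ultimately have "\<not> lower_rank le B A" by (rule A(3))
  moreover have "rank le f \<notin> rank le ` A"
  proof
    assume "rank le f \<in> rank le ` A"
    then obtain g where g: "g \<in> A" "rank le f = rank le g" by blast
    then have "leader le f = leader le g" by (simp add: rank_def)
    from reduced_eq_leader_rank[OF red[OF g(1)] this] show False using g(2) r.irrefl by simp
  qed
  moreover have "finite B" using fin by (simp add: B_def)
  ultimately have no: "\<not> (\<exists>v\<in>rank le ` B - rank le ` A.
      \<forall>w. rank_less le w v \<longrightarrow> (w \<in> rank le ` B \<longleftrightarrow> w \<in> rank le ` A))"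
    and f_new: "rank le f \<notin> rank le ` A"
    using fin unfolding lower_rank_def by (simp_all add: r.seq_lower_increasing_list_iff)
  have "w \<in> rank le ` B \<longleftrightarrow> w \<in> rank le ` A" if "rank_less le w (rank le f)" for w
    using that r.irrefl[of "rank le f"] by (auto simp: B_def)
  moreover have "rank le f \<in> rank le ` B" by (simp add: B_def)
  ultimately show False using no f_new by blast
qed

lemma nonleaders_disjoint: "nonleaders L \<inter> L = {}"
  by (auto simp: nonleaders_def derivatives_def) (metis act_zero)

lemma derivatives_iff:
  "v \<in> derivatives L \<longleftrightarrow> v \<in> L \<or> (\<exists>\<theta> u. u \<in> L \<and> \<theta> \<noteq> (\<lambda>_. 0) \<and> v = act \<theta> u)"
  unfolding derivatives_def by (auto, (metis act_zero)+)

lemma nonleaders_agree: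
  assumes "ranking le" "\<And>w. strict le w v \<Longrightarrow> w \<in> L \<longleftrightarrow> w \<in> L'" "strict le w v" "w \<in> nonleaders L"
  shows "w \<in> nonleaders L'"
proof -
  interpret strict_total_order "strict le" using assms(1) by (rule strict_total_order_ranking)
  have "w \<notin> derivatives L'"
  proof
    assume "w \<in> derivatives L'"
    then have "w \<in> derivatives L"
      unfolding derivatives_iff using assms(2,3) strict_act[OF assms(1)] trans by blast
    then show False using assms(4) by (simp add: nonleaders_def)
  qed
  then show ?thesis by (simp add: nonleaders_def)
qed

lemma deg_in_eqI:
  fixes p :: "('v, 'a::comm_ring_1) mpoly"
  assumes "coeff_in x e p \<noteq> 0" "\<And>j. e < j \<Longrightarrow> coeff_in x j p = 0"
  shows "deg_in x p = e"
proof (rule antisym)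
  show "deg_in x p \<le> e" using assms(2) coeff_in_deg_in[of p x] assms(1) by (metis coeff_in_zero leI)
  show "e \<le> deg_in x p" using assms(1) coeff_in_gt[of x p e] by (meson leI)
qed

lemma lookup_restrict_mono: "lookup (restrict_mono V m) v = (if v \<in> V then lookup m v else 0)"
proof -
  have "lookup (restrict_mono V m) v = (\<Sum>w\<in>keys m \<inter> V. if w = v then lookup m v else 0)"
    unfolding restrict_mono_def lookup_sum by (intro sum.cong) (auto simp: lookup_single when_def)
  then show ?thesis by (auto simp: in_keys_iff)
qed

lemma keys_restrict_mono: "keys (restrict_mono V m) = keys m \<inter> V"
  by (auto simp: in_keys_iff lookup_restrict_mono split: if_splits)

lemma restrict_mono_split: "restrict_mono (- V) m + restrict_mono V m = m"
  by (rule poly_mapping_eqI) (simp add: lookup_add lookup_restrict_mono)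

definition lcoeff :: "'v set \<Rightarrow> 'v mono \<Rightarrow> ('v, 'a::comm_ring_1) mpoly \<Rightarrow> ('v, 'a) mpoly"
  where "lcoeff L \<mu> = psum (\<lambda>m c. if restrict_mono L m = \<mu> then single (restrict_mono (- L) m) c else 0)"

lemma lcoeff_expand:
  assumes "finite X" "\<And>m. m \<in> keys p \<Longrightarrow> restrict_mono L m \<in> X"
  shows "p = (\<Sum>\<mu>\<in>X. lcoeff L \<mu> p * single \<mu> 1)"
proof -
  have "(\<Sum>\<mu>\<in>X. lcoeff L \<mu> p * single \<mu> 1) = (\<Sum>\<mu>\<in>X. \<Sum>m\<in>keys p.
      if restrict_mono L m = \<mu> then single (restrict_mono (- L) m + \<mu>) (lookup p m) else 0)"
    unfolding lcoeff_def psum_def sum_distrib_right by (intro sum.cong refl) (auto simp: mult_single)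
  also have "\<dots> = (\<Sum>m\<in>keys p. \<Sum>\<mu>\<in>X.
      if restrict_mono L m = \<mu> then single (restrict_mono (- L) m + \<mu>) (lookup p m) else 0)"
    by (rule sum.swap)
  also have "\<dots> = (\<Sum>m\<in>keys p. single m (lookup p m))"
    using assms by (intro sum.cong refl) (auto simp: restrict_mono_split)
  also have "\<dots> = p" using psum_monomials[of p] by (simp add: psum_def)
  finally show ?thesis by simp
qed

lemma vars_lcoeff: "vars (lcoeff L \<mu> p) \<subseteq> vars p - L"
proof -
  have "lcoeff L \<mu> p \<in> polys_in (vars p - L)"
    unfolding lcoeff_def psum_def
    by (intro polys_in_sum) (auto intro!: polys_in_single simp: keys_restrict_mono vars_def)
  then show ?thesis by (simp add: polys_in_iff)
qed

lemma finite_bounded_monos: "finite V \<Longrightarrow> finite {m :: 'v mono. keys m \<subseteq> V \<and> (\<forall>v\<in>V. lookup m v < D v)}"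
proof (rule finite_subset[OF _ finite_imageI])
  assume V: "finite V"
  show "finite (Pi\<^sub>E V (\<lambda>v. {..<D v}))" using V by (intro finite_PiE) auto
  show "{m :: 'v mono. keys m \<subseteq> V \<and> (\<forall>v\<in>V. lookup m v < D v)} \<subseteq>
      (\<lambda>f. \<Sum>v\<in>V. single v (f v)) ` Pi\<^sub>E V (\<lambda>v. {..<D v})"
  proof
    fix m :: "'v mono" assume m: "m \<in> {m. keys m \<subseteq> V \<and> (\<forall>v\<in>V. lookup m v < D v)}"
    have "m = (\<Sum>v\<in>V. single v (restrict (lookup m) V v))"
    proof (rule poly_mapping_eqI)
      fix v
      have "lookup (\<Sum>v\<in>V. single v (restrict (lookup m) V v)) v = (\<Sum>w\<in>V. if w = v then lookup m v else 0)"
        unfolding lookup_sum by (intro sum.cong) (auto simp: lookup_single when_def)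
      then show "lookup m v = lookup (\<Sum>v\<in>V. single v (restrict (lookup m) V v)) v"
        using m V by (auto simp: in_keys_iff)
    qed
    then show "m \<in> (\<lambda>f. \<Sum>v\<in>V. single v (f v)) ` Pi\<^sub>E V (\<lambda>v. {..<D v})"
      using m by (intro image_eqI[of _ _ "restrict (lookup m) V"]) auto
  qed
qed

locale charset =
  fixes le :: "('d::finite, 'y::finite) dvar \<Rightarrow> ('d, 'y) dvar \<Rightarrow> bool"
    and I A :: "('d, 'y, 'k::field) dpoly set"
  assumes ranking: "ranking le"
    and ideal: "ideal_in UNIV I"
    and proper: "1 \<notin> I"
    and char_set: "char_set le A I"
    and saturated: "\<And>w. H_prod le A * w \<in> I \<Longrightarrow> w \<in> I"
begin

sublocale ord: strict_total_order "strict le"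
  by (rule strict_total_order_ranking) (rule ranking)

abbreviation lt where "lt \<equiv> strict le"
abbreviation L where "L \<equiv> leaders le A"
abbreviation N where "N \<equiv> nonleaders (leaders le A)"

definition el :: "('d, 'y) dvar \<Rightarrow> ('d, 'y, 'k) dpoly"
  where "el u = (THE f. f \<in> A \<and> leader le f = u)"

definition d :: "('d, 'y) dvar \<Rightarrow> nat"
  where "d u = deg_in u (el u)"

lemma ideal_mult: "a \<in> I \<Longrightarrow> r * a \<in> I" and ideal_add: "a \<in> I \<Longrightarrow> b \<in> I \<Longrightarrow> a + b \<in> I"
  and ideal_zero: "0 \<in> I"
  using ideal_inD[OF ideal] by auto

lemma ideal_diff: "a \<in> I \<Longrightarrow> b \<in> I \<Longrightarrow> a - b \<in> I"
  using ideal_in_diff[of UNIV I a b] ideal by simp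

lemma ideal_sum: "(\<And>x. x \<in> X \<Longrightarrow> f x \<in> I) \<Longrightarrow> sum f X \<in> I"
  using ideal by (rule ideal_in_sum)

lemma ideal_restrict: "ideal_in (polys_in U) (I \<inter> polys_in U)"
  unfolding ideal_in_def using ideal_mult ideal_add ideal_zero by auto

lemma A_finite: "finite A" and A_nonconstant: "f \<in> A \<Longrightarrow> f \<notin> polys_in {}"
  and A_reduced: "f \<in> A \<Longrightarrow> g \<in> A \<Longrightarrow> f \<noteq> g \<Longrightarrow> reduced le f g"
  and A_subset: "f \<in> A \<Longrightarrow> f \<in> I"
  using char_set by (auto simp: char_set_def autoreduced_def)

lemma L_finite: "finite L"
  using A_finite by (simp add: leaders_def)

lemma leader_inj: "f \<in> A \<Longrightarrow> g \<in> A \<Longrightarrow> leader le f = leader le g \<Longrightarrow> f = g"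
  using A_reduced[of f g] A_reduced[of g f] unfolding reduced_def by (metis less_asym)

lemma el_leader: "f \<in> A \<Longrightarrow> el (leader le f) = f"
  unfolding el_def using leader_inj by (intro the_equality) auto

lemma el: "u \<in> L \<Longrightarrow> el u \<in> A" "u \<in> L \<Longrightarrow> leader le (el u) = u"
  using el_leader by (auto simp: leaders_def)

lemma el_vars: "u \<in> L \<Longrightarrow> u \<in> vars (el u)" "u \<in> L \<Longrightarrow> v \<in> vars (el u) \<Longrightarrow> v = u \<or> lt v u"
  using leader[OF ranking A_nonconstant[OF el(1)]] el(2) by metis+

lemma d_pos: "u \<in> L \<Longrightarrow> 0 < d u"
  using el_vars(1) by (simp add: d_def in_vars_iff_deg)

lemma proper_derivative: "u \<in> L \<Longrightarrow> \<theta> \<noteq> (\<lambda>_. 0) \<Longrightarrow> act \<theta> u \<notin> N \<union> L"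
proof
  assume u: "u \<in> L" "\<theta> \<noteq> (\<lambda>_. 0)" and "act \<theta> u \<in> N \<union> L"
  moreover have "act \<theta> u \<notin> N" using u by (auto simp: nonleaders_def derivatives_def)
  ultimately have w: "act \<theta> u \<in> L" by blast
  have "el (act \<theta> u) \<noteq> el u"
    using el(2)[OF w] el(2)[OF u(1)] act_eq_self_iff[of \<theta> u] u(2) by metis
  then have "reduced le (el (act \<theta> u)) (el u)" using A_reduced el(1) w u(1) by blast
  then have "act \<theta> u \<notin> vars (el (act \<theta> u))" using u el(2)[OF u(1)] by (auto simp: reduced_def)
  then show False using el_vars(1)[OF w] by blast
qed

lemma A_polys: "f \<in> A \<Longrightarrow> f \<in> polys_in (N \<union> L)"
  unfolding polys_in_iff
proof
  fix v assume f: "f \<in> A" "v \<in> vars f"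
  show "v \<in> N \<union> L"
  proof (rule ccontr)
    assume "v \<notin> N \<union> L"
    then obtain \<theta> u where u: "u \<in> L" "\<theta> \<noteq> (\<lambda>_. 0)" "v = act \<theta> u"
      by (auto simp: nonleaders_def derivatives_iff)
    show False
    proof (cases "f = el u")
      case True
      then have "act \<theta> u = u \<or> lt (act \<theta> u) u" using el_vars(2)[OF u(1)] f(2) u(3) by blast
      then show False using strict_act[OF ranking u(2), of u] ord.trans ord.irrefl by metis
    next
      case False
      then have "reduced le f (el u)" using A_reduced f(1) el(1) u(1) by blast
      then show False using u f(2) el(2) by (auto simp: reduced_def)
    qed
  qed
qed

lemma reduced_zero:
  assumes "p \<in> I" "p \<in> polys_in (N \<union> L)" "\<And>w. w \<in> L \<Longrightarrow> deg_in w p < d w"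
  shows "p = 0"
proof (rule ccontr)
  assume "p \<noteq> 0"
  have "p \<notin> polys_in {}"
  proof
    assume "p \<in> polys_in {}"
    then have "p dvd 1" using \<open>p \<noteq> 0\<close> by (rule constant_dvd_one)
    then obtain q where "1 = p * q" by blast
    then have "1 \<in> I" using ideal_mult[OF assms(1), of q] by (simp add: mult.commute)
    then show False using proper by blast
  qed
  then obtain g where g: "g \<in> A" "\<not> reduced le p g"
    using char_set_reduced_element[OF ranking char_set assms(1)] by blast
  have gl: "leader le g \<in> L" using g(1) by (auto simp: leaders_def)
  have "deg_in (leader le g) p < deg_in (leader le g) g"
    using assms(3)[OF gl] el_leader[OF g(1)] by (simp add: d_def)
  moreover have "act \<theta> (leader le g) \<notin> vars p" if "\<theta> \<noteq> (\<lambda>_. 0)" for \<theta>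
    using proper_derivative[OF gl that] assms(2) by (auto simp: polys_in_iff)
  ultimately show False using g(2) by (auto simp: reduced_def)
qed

lemma nonleaders_zero: "p \<in> I \<Longrightarrow> p \<in> polys_in N \<Longrightarrow> p = 0"
proof (rule reduced_zero)
  assume p: "p \<in> I" "p \<in> polys_in N"
  then show "p \<in> polys_in (N \<union> L)" by (auto simp: polys_in_iff)
  show "deg_in w p < d w" if "w \<in> L" for w
    using that p(2) nonleaders_disjoint[of L] d_pos[OF that]
    by (subst deg_in_free) (auto simp: polys_in_iff)
qed

lemma initial_el: "u \<in> L \<Longrightarrow> initial le (el u) = coeff_in u (d u) (el u)"
  by (simp add: initial_def el(2) d_def)

lemma initial_saturated: "u \<in> L \<Longrightarrow> coeff_in u (d u) (el u) * w \<in> I \<Longrightarrow> w \<in> I"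
proof (rule saturated)
  assume u: "u \<in> L" "coeff_in u (d u) (el u) * w \<in> I"
  have "initial le (el u) dvd H_prod le A"
    unfolding H_prod_def using A_finite el(1)[OF u(1)]
    by (metis (no_types, lifting) dvd_mult_left dvd_prodI)
  then obtain q where q: "H_prod le A = initial le (el u) * q" by blast
  have eq: "H_prod le A * w = q * (coeff_in u (d u) (el u) * w)"
    unfolding q initial_el[OF u(1)] by (simp add: ac_simps)
  show "H_prod le A * w \<in> I" unfolding eq by (rule ideal_mult[OF u(2)])
qed

lemma initial_polys: "f \<in> A \<Longrightarrow> initial le f \<in> polys_in (N \<union> L)"
  unfolding initial_def using polys_in_coeff_in[OF A_polys] by (rule polys_in_mono[rotated]) auto

lemma separant_polys: "f \<in> A \<Longrightarrow> separant le f \<in> polys_in (N \<union> L)"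
  unfolding separant_def pdiff_def
proof (intro polys_in_sum polys_in_single)
  fix m assume "f \<in> A" "m \<in> keys f"
  then have "keys m \<subseteq> N \<union> L" using A_polys by (auto simp: polys_in_iff vars_def)
  moreover have "keys (m - single (leader le f) 1) \<subseteq> keys m"
    by (auto simp: in_keys_iff lookup_minus)
  ultimately show "keys (m - single (leader le f) 1) \<subseteq> N \<union> L" by blast
qed

lemma power_saturated: "H_prod le A ^ m * w \<in> I \<Longrightarrow> w \<in> I"
  by (induct m) (auto simp: mult.assoc dest: saturated)

lemma ritt_reduction:
  assumes K: "ideal_in (polys_in (N \<union> L)) K" "A \<subseteq> K" and p: "p \<in> polys_in (N \<union> L)"
  shows "\<exists>s t m r. s \<in> polys_in (N \<union> L) \<and> t \<in> polys_in (N \<union> L) \<and> s * t = H_prod le A ^ m \<and>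
    r \<in> polys_in (N \<union> L) \<and> s * p - r \<in> K \<and> (\<forall>w\<in>L. deg_in w r < d w)"
proof -
  let ?P = "polys_in (N \<union> L)"
  define S where "S = {s \<in> ?P. \<exists>t\<in>?P. \<exists>m. s * t = H_prod le A ^ m}"
  have "\<exists>s\<in>S. \<exists>r\<in>?P. s * p - r \<in> K \<and> (\<forall>w\<in>L. deg_in w r < d w)"
  proof (rule triangular_reduction[OF ord.strict_total_order_axioms K(1) _ _ _ p L_finite])
    show "S \<subseteq> ?P" by (auto simp: S_def)
    show "1 \<in> S" by (auto simp: S_def intro: bexI[of _ 1] exI[of _ 0])
    show "s * s' \<in> S" if s: "s \<in> S" "s' \<in> S" for s s'
    proof -
      obtain t m t' m' where t: "t \<in> ?P" "s * t = H_prod le A ^ m" "t' \<in> ?P" "s' * t' = H_prod le A ^ m'"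
        using s unfolding S_def by blast
      have "s * s' * (t * t') = (s * t) * (s' * t')" by (simp add: ac_simps)
      also have "\<dots> = H_prod le A ^ (m + m')" by (simp add: t power_add)
      finally show ?thesis using s t(1,3) unfolding S_def by blast
    qed
    fix u assume u: "u \<in> L"
    let ?f = "el u"
    let ?t = "separant le ?f * (\<Prod>f\<in>A - {?f}. initial le f * separant le f)"
    have "initial le ?f * ?t = H_prod le A ^ 1"
      unfolding H_prod_def using prod.remove[OF A_finite el(1)[OF u], of "\<lambda>f. initial le f * separant le f"]
      by (simp add: ac_simps)
    moreover have "?t \<in> ?P"
      using initial_polys separant_polys el(1)[OF u] by (intro polys_in_mult polys_in_prod) auto
    ultimately have "initial le ?f \<in> S" using initial_polys el(1)[OF u] unfolding S_def by blast
    then show "el u \<in> K \<and> vars (el u) \<subseteq> {v. v = u \<or> lt v u} \<and> deg_in u (el u) = d u \<and> 0 < d u \<and>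
        coeff_in u (d u) (el u) \<in> S"
      using K(2) el(1)[OF u] el_vars(2)[OF u] d_pos[OF u] initial_el[OF u] by (auto simp: d_def)
  qed
  then show ?thesis unfolding S_def by blast
qed

lemma torsion_free:
  assumes g: "g \<in> polys_in N" "g \<noteq> 0" and p: "p \<in> polys_in (N \<union> L)" "g * p \<in> I"
  shows "p \<in> I"
proof -
  have "A \<subseteq> I \<inter> polys_in (N \<union> L)" using A_subset A_polys by blast
  from ritt_reduction[OF ideal_restrict this p(1)]
  obtain s t m r where r: "s * t = H_prod le A ^ m" "r \<in> polys_in (N \<union> L)" "s * p - r \<in> I"
    "\<forall>w\<in>L. deg_in w r < d w" by blast
  have "g * r = s * (g * p) - g * (s * p - r)" by (simp add: algebra_simps)
  then have "g * r \<in> I" using ideal_diff ideal_mult p(2) r(3) by metis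
  moreover have "g * r \<in> polys_in (N \<union> L)" using g(1) r(2) by (auto intro: polys_in_mono)
  moreover have "deg_in w (g * r) < d w" if w: "w \<in> L" for w
  proof -
    have "w \<notin> vars g" using g(1) w nonleaders_disjoint[of L] by (auto simp: polys_in_iff)
    then have "deg_in w (g * r) \<le> deg_in w r" using deg_in_mult_le[of w g r] by (simp add: deg_in_free)
    then show ?thesis using r(4) w by fastforce
  qed
  ultimately have "g * r = 0" by (rule reduced_zero)
  then have "r = 0" using g(2) by simp
  then have "t * (s * p) \<in> I" using r(3) ideal_mult by simp
  moreover have "H_prod le A ^ m * p = t * (s * p)" by (simp add: r(1)[symmetric] ac_simps)
  ultimately have "H_prod le A ^ m * p \<in> I" by (simp only:)
  then show ?thesis by (rule power_saturated)
qed

lemma alg_sat_eq: "alg_sat (polys_in (N \<union> L)) le A = I \<inter> polys_in (N \<union> L)"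
proof -
  let ?P = "polys_in (N \<union> L)"
  let ?K = "ideal_in ?P hull A"
  have AK: "A \<subseteq> ?K" by (rule hull_subset)
  have KI: "?K \<subseteq> I \<inter> ?P"
    using A_subset A_polys ideal_restrict by (intro hull_minimal) auto
  have K: "ideal_in ?P ?K"
    using ideal_in_hull[OF ideal_restrict[of "N \<union> L"]] A_subset A_polys by blast
  show ?thesis
  proof (intro equalityI subsetI)
    fix p assume "p \<in> alg_sat ?P le A"
    then show "p \<in> I \<inter> ?P"
      unfolding alg_sat_def saturation_def using KI power_saturated by blast
  next
    fix p assume p: "p \<in> I \<inter> ?P"
    obtain s t m r where r: "t \<in> ?P" "s * t = H_prod le A ^ m" "r \<in> ?P" "s * p - r \<in> ?K"
      "\<forall>w\<in>L. deg_in w r < d w" using ritt_reduction[OF K AK] p by blast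
    have "s * p - r \<in> I" "s * p \<in> I" using r(4) KI p ideal_mult by auto
    then have "s * p - (s * p - r) \<in> I" by (rule ideal_diff[rotated])
    then have "r = 0" using r(3,5) by (intro reduced_zero) auto
    then have "t * (s * p) \<in> ?K" using r(1,4) ideal_inD(4)[OF K] by simp
    moreover have "H_prod le A ^ m * p = t * (s * p)" by (simp add: r(2)[symmetric] ac_simps)
    ultimately have "H_prod le A ^ m * p \<in> ?K" by (simp only:)
    then show "p \<in> alg_sat ?P le A" using p unfolding alg_sat_def saturation_def by blast
  qed
qed

end

section \<open>Leading coefficients become invertible\<close>

context charset
begin

text \<open>Multiplication by a nonzerodivisor \<open>h\<close> modulo \<open>I\<close> is injective on a module of finite rank over
  \<open>k[U \<inter> N]\<close>, so \<open>h\<close> becomes invertible after localizing. The powers of \<open>h\<close> satisfy a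
  linear relation, from which powers of \<open>h\<close> are cancelled until its constant term is nonzero.\<close>

lemma nonzerodivisor_relation:
  assumes h: "h \<in> polys_in U" "\<And>w. w \<in> polys_in U \<Longrightarrow> h * w \<in> I \<Longrightarrow> w \<in> I"
    and V: "V \<subseteq> U"
  shows "(\<And>i. g i \<in> polys_in V) \<Longrightarrow> (\<Sum>i\<le>n. g i * h ^ i) \<in> I \<Longrightarrow> \<exists>i\<le>n. g i \<noteq> 0 \<Longrightarrow>
    \<exists>q\<in>polys_in U. \<exists>g\<in>polys_in V. g \<noteq> 0 \<and> q * h - g \<in> I"
proof (induct n arbitrary: g)
  case 0
  then show ?case
    using ideal_diff[OF ideal_zero, of "g 0"] by (intro bexI[of _ 0] bexI[of _ "g 0"]) auto
next
  case (Suc n)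
  let ?q = "\<Sum>i\<le>n. g (Suc i) * h ^ i"
  have gU: "g i \<in> polys_in U" for i using Suc.prems(1) V by (auto intro: polys_in_mono)
  have qU: "?q \<in> polys_in U" using gU h(1) by blast
  have sum: "(\<Sum>i\<le>Suc n. g i * h ^ i) = g 0 + h * ?q"
    by (subst sum.atMost_Suc_shift) (simp add: sum_distrib_left algebra_simps)
  show ?case
  proof (cases "g 0 = 0")
    case True
    then have "?q \<in> I" using Suc.prems(2) qU h(2) unfolding sum by simp
    moreover have "\<exists>i\<le>n. g (Suc i) \<noteq> 0"
      using Suc.prems(3) True by (metis Suc_le_mono not0_implies_Suc)
    ultimately show ?thesis using Suc.hyps[of "\<lambda>i. g (Suc i)"] Suc.prems(1) by blast
  next
    case False
    have "- ?q * h - g 0 = 0 - (\<Sum>i\<le>Suc n. g i * h ^ i)"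
      unfolding sum by (simp add: algebra_simps)
    then have "- ?q * h - g 0 \<in> I" using ideal_diff[OF ideal_zero Suc.prems(2)] by simp
    then show ?thesis using False Suc.prems(1) polys_in_uminus[OF qU] by blast
  qed
qed

lemma nonzerodivisor_invertible:
  assumes U: "U \<subseteq> N \<union> L"
    and red: "\<And>p. p \<in> polys_in U \<Longrightarrow> \<exists>s\<in>polys_in (U \<inter> N). s \<noteq> 0 \<and>
      (\<exists>r\<in>polys_in U. s * p - r \<in> I \<and> (\<forall>w\<in>U \<inter> L. deg_in w r < d w))"
    and h: "h \<in> polys_in U" "\<And>w. w \<in> polys_in U \<Longrightarrow> h * w \<in> I \<Longrightarrow> w \<in> I"
  shows "\<exists>q\<in>polys_in U. \<exists>g\<in>polys_in (U \<inter> N). g \<noteq> 0 \<and> q * h - g \<in> I"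
proof -
  have "\<forall>i. \<exists>s r. s \<in> polys_in (U \<inter> N) \<and> s \<noteq> 0 \<and> r \<in> polys_in U \<and> s * h ^ i - r \<in> I \<and>
      (\<forall>w\<in>U \<inter> L. deg_in w r < d w)"
    using red[OF polys_in_power[OF h(1)]] by blast
  then obtain s r where sr: "\<And>i. s i \<in> polys_in (U \<inter> N)" "\<And>i. s i \<noteq> 0" "\<And>i. r i \<in> polys_in U"
    "\<And>i. s i * h ^ i - r i \<in> I" "\<And>i w. w \<in> U \<inter> L \<Longrightarrow> deg_in w (r i) < d w"
    by metis
  define B where "B = {m :: ('d, 'y) dvar mono. keys m \<subseteq> U \<inter> L \<and> (\<forall>v\<in>U \<inter> L. lookup m v < d v)}"
  have B: "finite B" unfolding B_def by (rule finite_bounded_monos) (simp add: L_finite)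
  have exp: "r i = (\<Sum>\<mu>\<in>B. lcoeff L \<mu> (r i) * single \<mu> 1)" for i
  proof (rule lcoeff_expand[OF B])
    fix m assume m: "m \<in> keys (r i)"
    have "keys m \<subseteq> U" using m sr(3)[of i] by (auto simp: polys_in_iff vars_def)
    moreover have "lookup m v < d v" if "v \<in> U \<inter> L" for v
      using lookup_le_deg_in[OF m, of v] sr(5)[OF that, of i] by simp
    ultimately show "restrict_mono L m \<in> B"
      unfolding B_def by (auto simp: keys_restrict_mono lookup_restrict_mono)
  qed
  have co: "lcoeff L \<mu> (r i) \<in> polys_in (U \<inter> N)" for \<mu> i
    using vars_lcoeff[of L \<mu> "r i"] sr(3)[of i] U by (auto simp: polys_in_iff)
  have "\<exists>c. (\<forall>i. c i \<in> polys_in (U \<inter> N)) \<and> (\<exists>i\<in>{..card B}. c i \<noteq> 0) \<and>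
      (\<forall>\<mu>\<in>B. (\<Sum>i\<in>{..card B}. c i * lcoeff L \<mu> (r i)) = 0)"
    by (rule domain_linear_dependence) (auto simp: B co)
  then obtain c where c: "\<And>i. c i \<in> polys_in (U \<inter> N)" "\<exists>i\<le>card B. c i \<noteq> 0"
      "\<And>\<mu>. \<mu> \<in> B \<Longrightarrow> (\<Sum>i\<le>card B. c i * lcoeff L \<mu> (r i)) = 0"
    by (auto simp: Bex_def)
  have "(\<Sum>i\<le>card B. c i * r i) = (\<Sum>i\<le>card B. \<Sum>\<mu>\<in>B. c i * lcoeff L \<mu> (r i) * single \<mu> 1)"
    by (subst exp) (simp add: sum_distrib_left mult.assoc)
  also have "\<dots> = (\<Sum>\<mu>\<in>B. (\<Sum>i\<le>card B. c i * lcoeff L \<mu> (r i)) * single \<mu> 1)"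
    by (subst sum.swap) (simp add: sum_distrib_right)
  also have "\<dots> = 0" using c(3) by simp
  finally have zero: "(\<Sum>i\<le>card B. c i * r i) = 0" .
  have "(\<Sum>i\<le>card B. c i * s i * h ^ i) = (\<Sum>i\<le>card B. c i * (s i * h ^ i - r i))"
    using zero by (simp add: right_diff_distrib sum_subtractf mult.assoc)
  also have "\<dots> \<in> I" by (intro ideal_sum ideal_mult sr(4))
  finally show ?thesis
    by (intro nonzerodivisor_relation[OF h, of "U \<inter> N" "\<lambda>i. c i * s i" "card B"])
       (use c sr in auto)
qed

definition monic_at :: "('d, 'y) dvar \<Rightarrow> ('d, 'y, 'k) dpoly \<Rightarrow> bool"
  where "monic_at w a \<longleftrightarrow> a \<in> I \<and> a \<in> polys_in {v \<in> N \<union> L. v = w \<or> lt v w} \<and> deg_in w a = d w \<and>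
    coeff_in w (d w) a \<in> polys_in {v \<in> N. lt v w} \<and> coeff_in w (d w) a \<noteq> 0"

lemma monic_reduction:
  assumes K: "ideal_in (polys_in U) K" and p: "p \<in> polys_in U"
    and W: "W \<subseteq> U \<inter> L" "\<And>w v. w \<in> W \<Longrightarrow> v \<in> N \<union> L \<Longrightarrow> lt v w \<Longrightarrow> v \<in> U"
    and a: "\<And>w. w \<in> W \<Longrightarrow> monic_at w (a w) \<and> a w \<in> K"
  shows "\<exists>s\<in>polys_in {v \<in> N. \<exists>w\<in>W. lt v w}. s \<noteq> 0 \<and>
    (\<exists>r\<in>polys_in U. s * p - r \<in> K \<and> (\<forall>w\<in>W. deg_in w r < d w))"
proof -
  define S where "S = polys_in {v \<in> N. \<exists>w\<in>W. lt v w} - {0 :: ('d, 'y, 'k) dpoly}"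
  have "\<exists>s\<in>S. \<exists>r\<in>polys_in U. s * p - r \<in> K \<and> (\<forall>w\<in>W. deg_in w r < d w)"
  proof (rule triangular_reduction[OF ord.strict_total_order_axioms K _ _ _ p])
    have "{v \<in> N. \<exists>w\<in>W. lt v w} \<subseteq> U" using W(2) by blast
    then show "S \<subseteq> polys_in U" unfolding S_def using polys_in_mono by blast
    show "finite W" using W(1) L_finite by (meson finite_subset inf.boundedE)
    show "a w \<in> K \<and> vars (a w) \<subseteq> {v. v = w \<or> lt v w} \<and> deg_in w (a w) = d w \<and> 0 < d w \<and>
        coeff_in w (d w) (a w) \<in> S" if w: "w \<in> W" for w
      using a[OF w] d_pos[of w] W(1) w unfolding monic_at_def S_def Diff_iff polys_in_iff by blast
  qed (auto simp: S_def)
  then show ?thesis unfolding S_def by blast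
qed

lemma monic_reduction_ideal:
  assumes "U \<subseteq> N \<union> L" "p \<in> polys_in U"
    and "\<And>w v. w \<in> U \<inter> L \<Longrightarrow> v \<in> N \<union> L \<Longrightarrow> lt v w \<Longrightarrow> v \<in> U"
    and "\<And>w. w \<in> U \<inter> L \<Longrightarrow> \<exists>a. monic_at w a"
  shows "\<exists>s\<in>polys_in {v \<in> N. \<exists>w\<in>U \<inter> L. lt v w}. s \<noteq> 0 \<and>
    (\<exists>r\<in>polys_in U. s * p - r \<in> I \<and> (\<forall>w\<in>U \<inter> L. deg_in w r < d w))"
proof -
  obtain a where a: "\<And>w. w \<in> U \<inter> L \<Longrightarrow> monic_at w (a w)" using assms(4) by metis
  have "a w \<in> I \<inter> polys_in U" if w: "w \<in> U \<inter> L" for w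
  proof -
    have "{v \<in> N \<union> L. v = w \<or> lt v w} \<subseteq> U" using assms(3)[OF w] w by blast
    then show ?thesis using a[OF w] by (auto simp: monic_at_def intro: polys_in_mono)
  qed
  then show ?thesis
    using monic_reduction[OF ideal_restrict assms(2), of "U \<inter> L" a] a assms(3) by blast
qed

lemma monic_exists: "u \<in> L \<Longrightarrow> \<exists>a. monic_at u a"
proof (induct "card {w \<in> L. lt w u}" arbitrary: u rule: less_induct)
  case less
  have IH: "\<exists>a. monic_at w a" if w: "w \<in> L" "lt w u" for w
  proof (rule less.hyps[OF _ w(1)])
    have "{x \<in> L. lt x w} \<subset> {x \<in> L. lt x u}" using w ord.trans ord.irrefl by blast
    then show "card {x \<in> L. lt x w} < card {x \<in> L. lt x u}"
      using L_finite by (intro psubset_card_mono) auto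
  qed
  define U where "U = {v \<in> N \<union> L. lt v u}"
  define h where "h = coeff_in u (d u) (el u)"
  note u = less.prems
  have hU: "h \<in> polys_in U"
    using vars_coeff_in[of u "d u" "el u"] el_vars(2)[OF u] A_polys[OF el(1)[OF u]]
    unfolding h_def U_def polys_in_iff by blast
  have "\<exists>q\<in>polys_in U. \<exists>g\<in>polys_in (U \<inter> N). g \<noteq> 0 \<and> q * h - g \<in> I"
  proof (rule nonzerodivisor_invertible[OF _ _ hU])
    show "U \<subseteq> N \<union> L" by (auto simp: U_def)
    show "w \<in> I" if "h * w \<in> I" for w using initial_saturated[OF u] that by (simp add: h_def)
    fix p :: "('d, 'y, 'k) dpoly" assume p: "p \<in> polys_in U"
    have "\<exists>s\<in>polys_in {v \<in> N. \<exists>w\<in>U \<inter> L. lt v w}. s \<noteq> 0 \<and>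
        (\<exists>r\<in>polys_in U. s * p - r \<in> I \<and> (\<forall>w\<in>U \<inter> L. deg_in w r < d w))"
      by (rule monic_reduction_ideal[OF _ p]) (auto simp: U_def intro: ord.trans IH)
    moreover have "{v \<in> N. \<exists>w\<in>U \<inter> L. lt v w} \<subseteq> U \<inter> N" by (auto simp: U_def intro: ord.trans)
    ultimately show "\<exists>s\<in>polys_in (U \<inter> N). s \<noteq> 0 \<and>
        (\<exists>r\<in>polys_in U. s * p - r \<in> I \<and> (\<forall>w\<in>U \<inter> L. deg_in w r < d w))"
      using polys_in_mono by blast
  qed
  then obtain q g where q: "q \<in> polys_in U" and g: "g \<in> polys_in (U \<inter> N)" "g \<noteq> 0" and qg: "q * h - g \<in> I"
    by blast
  define a where "a = q * el u - (q * h - g) * Var u ^ d u"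
  have uU: "u \<notin> U" using ord.irrefl by (simp add: U_def)
  have "g \<in> polys_in U" using g(1) by (rule polys_in_mono[rotated]) auto
  then have qhU: "q * h - g \<in> polys_in U" using q hU by blast
  have free: "u \<notin> vars q" "u \<notin> vars (q * h - g)"
    using q qhU uU by (auto simp: polys_in_iff)
  have coeff: "coeff_in u j a = q * coeff_in u j (el u) - (if j = d u then q * h - g else 0)" for j
    unfolding a_def coeff_in_diff coeff_in_mult_free[OF free(1)] coeff_in_mult_Var_power[OF free(2)] ..
  have "coeff_in u (d u) a = g" by (simp add: coeff flip: h_def)
  moreover have "deg_in u a = d u"
  proof (rule deg_in_eqI)
    show "coeff_in u (d u) a \<noteq> 0" using calculation g(2) by simp
    show "coeff_in u j a = 0" if "d u < j" for j
      using that coeff_in_gt[of u "el u" j] by (simp add: coeff d_def)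
  qed
  moreover have "a \<in> I"
    unfolding a_def mult.commute[of "q * h - g"]
    by (intro ideal_diff ideal_mult A_subset el(1) u qg)
  moreover have "a \<in> polys_in {v \<in> N \<union> L. v = u \<or> lt v u}"
  proof -
    let ?W = "{v \<in> N \<union> L. v = u \<or> lt v u}"
    have "U \<subseteq> ?W" by (auto simp: U_def)
    then have "q \<in> polys_in ?W" "h \<in> polys_in ?W" "g \<in> polys_in ?W"
      using q hU g(1) by (auto intro: polys_in_mono)
    moreover have "el u \<in> polys_in ?W"
      using el_vars(2)[OF u] A_polys[OF el(1)[OF u]] unfolding polys_in_iff by blast
    moreover have "u \<in> ?W" using u by blast
    ultimately show ?thesis unfolding a_def by blast
  qed
  moreover have "g \<in> polys_in {v \<in> N. lt v u}" using g(1) by (auto simp: U_def polys_in_iff)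
  ultimately have "monic_at u a" using g(2) unfolding monic_at_def by simp
  then show ?case by blast
qed

lemma coeff_in_ideal:
  assumes f: "f \<in> I" "f \<in> polys_in (N \<union> {w \<in> L. w = v \<or> lt w v})"
    and v: "v \<in> N \<union> L" "v \<in> L \<Longrightarrow> deg_in v f < d v"
  shows "coeff_in v j f \<in> I"
proof -
  define U where "U = N \<union> {w \<in> L. w = v \<or> lt w v}"
  define W where "W = {w \<in> L. lt w v}"
  define K where "K = {p \<in> polys_in U. \<forall>j. coeff_in v j p \<in> I}"
  have K: "ideal_in (polys_in U) K"
    unfolding ideal_in_def
  proof (intro conjI ballI)
    fix p q :: "('d, 'y, 'k) dpoly" assume "p \<in> polys_in U" "q \<in> K"
    then show "p * q \<in> K"
      unfolding K_def by (auto simp flip: coeff_upoly simp: upoly_mult coeff_mult intro!: ideal_sum ideal_mult)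
  qed (auto simp: K_def coeff_in_add ideal_zero ideal_add)
  have KI: "p \<in> I" if "p \<in> K" for p
  proof -
    have "(\<Sum>j\<le>deg_in v p. Var v ^ j * coeff_in v j p) \<in> I"
      using that by (intro ideal_sum ideal_mult) (auto simp: K_def)
    then show ?thesis using expand_coeff_in[of p v] by (simp add: mult.commute)
  qed
  have sub: "{x \<in> N \<union> L. x = w \<or> lt x w} \<subseteq> U" "v \<notin> {x \<in> N \<union> L. x = w \<or> lt x w}" if "w \<in> W" for w
    using that ord.trans ord.irrefl by (auto simp: U_def W_def)
  obtain a where a: "\<And>w. w \<in> W \<Longrightarrow> monic_at w (a w)"
    using monic_exists unfolding W_def by (metis (no_types, lifting) mem_Collect_eq)
  have "monic_at w (a w) \<and> a w \<in> K" if w: "w \<in> W" for w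
  proof -
    have "a w \<in> polys_in U" "v \<notin> vars (a w)" "a w \<in> I"
      using a[OF w] sub[OF w] unfolding monic_at_def by (auto simp: polys_in_iff)
    then show ?thesis using a[OF w] ideal_zero by (auto simp: K_def coeff_in_free)
  qed
  moreover have "W \<subseteq> U \<inter> L" "\<And>w x. w \<in> W \<Longrightarrow> x \<in> N \<union> L \<Longrightarrow> lt x w \<Longrightarrow> x \<in> U"
    using sub(1) by (auto simp: W_def U_def intro: ord.trans)
  ultimately obtain s r where s: "s \<in> polys_in {x \<in> N. \<exists>w\<in>W. lt x w}" "s \<noteq> 0"
    and r: "r \<in> polys_in U" "s * f - r \<in> K" "\<And>w. w \<in> W \<Longrightarrow> deg_in w r < d w"
    using monic_reduction[OF K f(2)[folded U_def], of W a] by blast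
  have vs: "v \<notin> vars s" using s(1) ord.trans ord.irrefl unfolding polys_in_iff W_def by blast
  have UNL: "U \<subseteq> N \<union> L" by (auto simp: U_def)
  have "s * f - (s * f - r) \<in> I" using KI[OF r(2)] ideal_mult[OF f(1)] by (rule ideal_diff[rotated])
  then have rI: "r \<in> I" by simp
  have other: "w \<notin> U" if "w \<in> L" "w \<notin> W" "w \<noteq> v" for w
    using that nonleaders_disjoint[of L] by (auto simp: U_def W_def)
  have "coeff_in v j r = 0" if j: "v \<in> L" "d v \<le> j" for j
  proof (rule reduced_zero)
    have "s * coeff_in v j f - coeff_in v j r \<in> I"
      using r(2) by (auto simp: K_def coeff_in_diff coeff_in_mult_free[OF vs])
    moreover have "coeff_in v j f = 0" using v(2)[OF j(1)] j(2) by (intro coeff_in_gt) simp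
    ultimately have "- coeff_in v j r \<in> I" by simp
    from ideal_diff[OF ideal_zero this] show "coeff_in v j r \<in> I" by simp
    have cU: "coeff_in v j r \<in> polys_in (U - {v})" by (rule polys_in_coeff_in[OF r(1)])
    then show "coeff_in v j r \<in> polys_in (N \<union> L)" using UNL by (auto simp: polys_in_iff)
    show "deg_in w (coeff_in v j r) < d w" if w: "w \<in> L" for w
    proof (cases "w \<in> W")
      case True
      then show ?thesis using r(3)[OF True] deg_in_coeff_in[of w v j r] by simp
    next
      case False
      then have "w \<notin> U - {v}" using other[OF w False] by blast
      then have "w \<notin> vars (coeff_in v j r)" using cU by (auto simp: polys_in_iff)
      then show ?thesis using d_pos[OF w] by (simp add: deg_in_free)
    qed
  qed
  then have deg_v: "deg_in v r < d v" if "v \<in> L"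
    using that d_pos[OF that] by (simp add: deg_in_less_iff)
  have "r = 0"
  proof (rule reduced_zero[OF rI])
    show "r \<in> polys_in (N \<union> L)" using r(1) UNL by (rule polys_in_mono[rotated])
    show "deg_in w r < d w" if w: "w \<in> L" for w
    proof (cases "w \<in> W \<or> w = v")
      case True
      then show ?thesis using r(3) deg_v w by blast
    next
      case False
      then have "w \<notin> vars r" using other[OF w] r(1) by (auto simp: polys_in_iff)
      then show ?thesis using d_pos[OF w] by (simp add: deg_in_free)
    qed
  qed
  then have "s * coeff_in v j f \<in> I" using r(2) by (simp add: K_def coeff_in_mult_free[OF vs])
  moreover have "s \<in> polys_in N" using s(1) by (rule polys_in_mono[rotated]) auto
  moreover have "coeff_in v j f \<in> polys_in (N \<union> L)"
    by (rule polys_in_mono[OF _ polys_in_coeff_in[OF f(2)]]) auto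
  ultimately show ?thesis using torsion_free s(2) by blast
qed

lemma reduced_monic_exists:
  assumes u: "u \<in> L"
  shows "\<exists>\<beta> r. \<beta> \<in> polys_in {v \<in> N. lt v u} \<and> \<beta> \<noteq> 0 \<and> r \<in> polys_in {v \<in> N \<union> L. v = u \<or> lt v u} \<and>
    (\<forall>w\<in>L. deg_in w r < d w) \<and> \<beta> * Var u ^ d u + r \<in> I"
proof -
  let ?U = "{v \<in> N \<union> L. v = u \<or> lt v u}"
  obtain a where a: "monic_at u a" using monic_exists[OF u] by blast
  define g where "g = coeff_in u (d u) a"
  define b where "b = a - g * Var u ^ d u"
  have g: "g \<in> polys_in {v \<in> N. lt v u}" "g \<noteq> 0" using a by (auto simp: monic_at_def g_def)
  have "g \<in> polys_in ?U" using g(1) by (rule polys_in_mono[rotated]) auto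
  then have b: "b \<in> polys_in ?U" unfolding b_def using a u by (auto simp: monic_at_def)
  have "\<exists>s\<in>polys_in {v \<in> N. \<exists>w\<in>?U \<inter> L. lt v w}. s \<noteq> 0 \<and>
      (\<exists>r\<in>polys_in ?U. s * b - r \<in> I \<and> (\<forall>w\<in>?U \<inter> L. deg_in w r < d w))"
    by (rule monic_reduction_ideal[OF _ b]) (auto intro: ord.trans monic_exists)
  then obtain s r where s: "s \<in> polys_in {v \<in> N. \<exists>w\<in>?U \<inter> L. lt v w}" "s \<noteq> 0"
    and r: "r \<in> polys_in ?U" "s * b - r \<in> I" "\<forall>w\<in>?U \<inter> L. deg_in w r < d w" by blast
  have "{v \<in> N. \<exists>w\<in>?U \<inter> L. lt v w} \<subseteq> {v \<in> N. lt v u}" by (auto intro: ord.trans)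
  then have "s \<in> polys_in {v \<in> N. lt v u}" using s(1) by (rule polys_in_mono)
  then have "s * g \<in> polys_in {v \<in> N. lt v u}" "s * g \<noteq> 0" using g s(2) by auto
  moreover have "deg_in w r < d w" if w: "w \<in> L" for w
  proof (cases "w \<in> ?U")
    case False
    then have "w \<notin> vars r" using r(1) by (auto simp: polys_in_iff)
    then show ?thesis using d_pos[OF w] by (simp add: deg_in_free)
  qed (use r(3) w in blast)
  moreover have "s * g * Var u ^ d u + r \<in> I"
  proof -
    have eq: "s * g * Var u ^ d u + r = s * a - (s * b - r)"
      by (simp add: b_def algebra_simps)
    have "a \<in> I" using a by (simp add: monic_at_def)
    then show ?thesis unfolding eq by (intro ideal_diff[OF _ r(2)] ideal_mult)
  qed
  ultimately show ?thesis using r(1) by blast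
qed

end

lemma charset_leader_not_lost:
  fixes I A I' A' :: "('d::finite, 'y::finite, 'k::field) dpoly set"
  assumes "charset le I A" "charset le I' A'" "I \<subseteq> I'"
    and v: "v \<in> leaders le A" "v \<notin> leaders le A'"
    and agree: "\<And>w. strict le w v \<Longrightarrow> w \<in> leaders le A \<longleftrightarrow> w \<in> leaders le A'"
  shows False
proof -
  interpret X: charset le I A by fact
  interpret Y: charset le I' A' by fact
  have N: "w \<in> X.N \<Longrightarrow> w \<in> Y.N" if "strict le w v" for w
    using nonleaders_agree[OF X.ranking agree that] by blast
  have vN: "v \<in> Y.N"
  proof (rule ccontr)
    assume "v \<notin> Y.N"
    then obtain \<theta> u where u: "u \<in> Y.L" "\<theta> \<noteq> (\<lambda>_. 0)" "v = act \<theta> u"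
      using v(2) by (auto simp: nonleaders_def derivatives_iff)
    then have "u \<in> X.L" using agree strict_act[OF X.ranking u(2)] by blast
    then show False using X.proper_derivative u v(1) by blast
  qed
  obtain a where a: "X.monic_at v a" using X.monic_exists[OF v(1)] by blast
  have "a \<in> polys_in (Y.N \<union> {w \<in> Y.L. w = v \<or> strict le w v})"
  proof -
    have "{w \<in> X.N \<union> X.L. w = v \<or> strict le w v} \<subseteq> Y.N \<union> {w \<in> Y.L. w = v \<or> strict le w v}"
      using N agree vN by blast
    then show ?thesis using a unfolding X.monic_at_def by (blast intro: polys_in_mono)
  qed
  moreover have "a \<in> I'" using a assms(3) by (auto simp: X.monic_at_def)
  ultimately have "coeff_in v (X.d v) a \<in> I'"
    using Y.coeff_in_ideal[of a v] vN v(2) by blast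
  moreover have "coeff_in v (X.d v) a \<in> polys_in Y.N"
    using a N unfolding X.monic_at_def polys_in_iff by blast
  ultimately have "coeff_in v (X.d v) a = 0" by (rule Y.nonleaders_zero)
  then show False using a by (simp add: X.monic_at_def)
qed

lemma charset_new_leader_relation:
  fixes I A I' A' :: "('d::finite, 'y::finite, 'k::field) dpoly set"
  assumes "charset le I A" "charset le I' A'" "I \<subseteq> I'"
    and v: "v \<in> leaders le A'" "v \<notin> leaders le A"
    and agree: "\<And>w. strict le w v \<Longrightarrow> w \<in> leaders le A \<longleftrightarrow> w \<in> leaders le A'"
  shows "\<exists>g\<in>I' \<inter> polys_in (nonleaders (leaders le A)). g \<noteq> 0"
proof -
  interpret X: charset le I A by fact
  interpret Y: charset le I' A' by fact
  have N: "w \<in> Y.N \<Longrightarrow> w \<in> X.N" if "strict le w v" for w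
    using nonleaders_agree[OF X.ranking _ that, of Y.L X.L] agree by blast
  have vN: "v \<in> X.N"
  proof (rule ccontr)
    assume "v \<notin> X.N"
    then obtain \<theta> u where u: "u \<in> X.L" "\<theta> \<noteq> (\<lambda>_. 0)" "v = act \<theta> u"
      using v(2) by (auto simp: nonleaders_def derivatives_iff)
    then have "u \<in> Y.L" using agree strict_act[OF X.ranking u(2)] by blast
    then show False using Y.proper_derivative u v(1) by blast
  qed
  obtain a where a: "Y.monic_at v a" using Y.monic_exists[OF v(1)] by blast
  let ?U = "{w \<in> X.N \<union> X.L. w = v \<or> strict le w v}"
  have aU: "a \<in> polys_in ?U"
  proof -
    have "{w \<in> Y.N \<union> Y.L. w = v \<or> strict le w v} \<subseteq> ?U" using N agree vN by blast
    then show ?thesis using a unfolding Y.monic_at_def by (blast intro: polys_in_mono)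
  qed
  define D where "D = Y.d v"
  define g where "g = coeff_in v D a"
  have g: "g \<in> polys_in X.N" "g \<noteq> 0"
    using a N unfolding Y.monic_at_def polys_in_iff g_def D_def by blast+
  have degD: "deg_in v a = D" using a by (simp add: Y.monic_at_def D_def)
  have nzd: "w \<in> I" if w: "w \<in> polys_in ?U" "a * w \<in> I" for w
  proof (rule ccontr)
    assume "w \<notin> I"
    let ?P = "\<lambda>j. coeff_in v j w \<notin> I"
    have ex: "\<exists>j. ?P j"
    proof (rule ccontr)
      assume "\<nexists>j. ?P j"
      then have "(\<Sum>j\<le>deg_in v w. Var v ^ j * coeff_in v j w) \<in> I"
        by (intro X.ideal_sum X.ideal_mult) auto
      then show False using \<open>w \<notin> I\<close> expand_coeff_in[of w v] by (simp add: mult.commute)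
    qed
    have bound: "j \<le> deg_in v w" if "?P j" for j
      using that X.ideal_zero coeff_in_gt[of v w j] by (metis leI)
    have j: "?P (Greatest ?P)" by (rule GreatestI_ex_nat[OF ex bound])
    have greater: "i \<le> Greatest ?P" if "?P i" for i by (rule Greatest_le_nat[of ?P, OF that bound])
    define j where "j = Greatest ?P"
    let ?t = "\<lambda>i. coeff_in v i a * coeff_in v (D + j - i) w"
    have "a * w \<in> polys_in (X.N \<union> {w \<in> X.L. w = v \<or> strict le w v})"
      using polys_in_mult[OF aU w(1)] by (rule polys_in_mono[rotated]) auto
    then have c1: "coeff_in v (D + j) (a * w) \<in> I"
      using X.coeff_in_ideal[OF w(2)] vN v(2) by blast
    have c2: "coeff_in v (D + j) (a * w) = ?t D + (\<Sum>i\<in>{..D + j} - {D}. ?t i)"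
      by (simp flip: coeff_upoly add: upoly_mult coeff_mult) (subst sum.remove[of _ D], auto)
    have c3: "(\<Sum>i\<in>{..D + j} - {D}. ?t i) \<in> I"
    proof (rule X.ideal_sum)
      fix i assume "i \<in> {..D + j} - {D}"
      then consider "j < D + j - i" | "D < i" by force
      then show "?t i \<in> I"
      proof cases
        case 1
        then have "coeff_in v (D + j - i) w \<in> I" using greater[of "D + j - i"] by (auto simp: j_def)
        then show ?thesis by (rule X.ideal_mult)
      next
        case 2
        then show ?thesis using coeff_in_gt[of v a i] degD X.ideal_zero by simp
      qed
    qed
    have "g * coeff_in v j w \<in> I"
      using X.ideal_diff[OF c1 c3] by (simp add: c2 g_def)
    moreover have "coeff_in v j w \<in> polys_in (X.N \<union> X.L)"
      by (rule polys_in_mono[OF _ polys_in_coeff_in[OF w(1)]]) auto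
    ultimately have "coeff_in v j w \<in> I" using X.torsion_free g by blast
    then show False using j by (simp add: j_def)
  qed
  have "\<exists>q\<in>polys_in ?U. \<exists>g\<in>polys_in (?U \<inter> X.N). g \<noteq> 0 \<and> q * a - g \<in> I"
  proof (rule X.nonzerodivisor_invertible[OF _ _ aU nzd])
    fix p :: "('d, 'y, 'k) dpoly" assume p: "p \<in> polys_in ?U"
    have "\<exists>s\<in>polys_in {x \<in> X.N. \<exists>w\<in>?U \<inter> X.L. strict le x w}. s \<noteq> 0 \<and>
        (\<exists>r\<in>polys_in ?U. s * p - r \<in> I \<and> (\<forall>w\<in>?U \<inter> X.L. deg_in w r < X.d w))"
      by (rule X.monic_reduction_ideal[OF _ p]) (auto intro: X.ord.trans X.monic_exists)
    moreover have "{x \<in> X.N. \<exists>w\<in>?U \<inter> X.L. strict le x w} \<subseteq> ?U \<inter> X.N"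
      by (auto intro: X.ord.trans)
    ultimately show "\<exists>s\<in>polys_in (?U \<inter> X.N). s \<noteq> 0 \<and>
        (\<exists>r\<in>polys_in ?U. s * p - r \<in> I \<and> (\<forall>w\<in>?U \<inter> X.L. deg_in w r < X.d w))"
      using polys_in_mono by blast
  qed auto
  then obtain q G where q: "G \<in> polys_in (?U \<inter> X.N)" "G \<noteq> 0" "q * a - G \<in> I" by blast
  have "a \<in> I'" "q * a - G \<in> I'" using a q(3) assms(3) by (auto simp: Y.monic_at_def)
  from Y.ideal_diff[OF Y.ideal_mult[OF this(1)] this(2), of q] have "q * a - (q * a - G) \<in> I'" .
  then have "G \<in> I'" by simp
  moreover have "G \<in> polys_in X.N" using q(1) by (rule polys_in_mono[rotated]) auto
  ultimately show ?thesis using q(2) by blast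
qed

section \<open>Saturated ideals of characteristic sets are proper\<close>

definition eval_mono :: "('v \<Rightarrow> 'a::comm_ring_1) \<Rightarrow> 'v mono \<Rightarrow> 'a"
  where "eval_mono x m = (\<Prod>v\<in>keys m. x v ^ lookup m v)"

definition eval_at :: "('v \<Rightarrow> 'a::comm_ring_1) \<Rightarrow> ('v, 'a) mpoly \<Rightarrow> 'a"
  where "eval_at x = psum (\<lambda>m c. c * eval_mono x m)"

lemma eval_mono_superset:
  assumes "finite X" "keys m \<subseteq> X"
  shows "eval_mono x m = (\<Prod>v\<in>X. x v ^ lookup m v)"
  unfolding eval_mono_def using assms
  by (intro prod.mono_neutral_left) (auto simp: in_keys_iff)

lemma eval_mono_add: "eval_mono x (m + n) = eval_mono x m * eval_mono x n"
proof -
  let ?X = "keys m \<union> keys n"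
  have "eval_mono x (m + n) = (\<Prod>v\<in>?X. x v ^ lookup (m + n) v)"
    using Poly_Mapping.keys_add[of m n] by (intro eval_mono_superset) auto
  also have "\<dots> = (\<Prod>v\<in>?X. x v ^ lookup m v) * (\<Prod>v\<in>?X. x v ^ lookup n v)"
    by (simp add: lookup_add power_add prod.distrib)
  also have "\<dots> = eval_mono x m * eval_mono x n"
    by (simp add: eval_mono_superset[of ?X])
  finally show ?thesis .
qed

lemma eval_add: "eval_at x (p + q) = eval_at x p + eval_at x q"
  unfolding eval_at_def by (rule psum_add) (simp add: distrib_right)

lemma eval_mult: "eval_at x (p * q) = eval_at x p * eval_at x q"
  unfolding eval_at_def by (rule psum_mult) (simp_all add: eval_mono_add algebra_simps)

lemma eval_zero [simp]: "eval_at x 0 = 0"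
  by (simp add: eval_at_def)

lemma eval_Const [simp]: "eval_at x (Const c) = c"
  by (simp add: eval_at_def Const_def eval_mono_def)

lemma eval_one [simp]: "eval_at x 1 = 1"
  using eval_Const[of x 1] by (simp add: Const_def)

lemma eval_Var [simp]: "eval_at x (Var v) = x v"
  by (simp add: eval_at_def Var_def eval_mono_def)

lemma eval_power: "eval_at x (p ^ n) = eval_at x p ^ n"
  by (induct n) (simp_all add: eval_mult)

lemma eval_prod: "eval_at x (prod f X) = (\<Prod>i\<in>X. eval_at x (f i))"
  by (induct X rule: infinite_finite_induct) (simp_all add: eval_mult)

lemma eval_sum: "eval_at x (sum f X) = (\<Sum>i\<in>X. eval_at x (f i))"
  by (rule additive_sum) (rule eval_add)

lemma eval_single: "eval_at x (single m c) = c * eval_mono x m"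
  by (simp add: eval_at_def)

locale derivation =
  fixes \<delta> :: "'a::comm_ring_1 \<Rightarrow> 'a"
  assumes add: "\<delta> (a + b) = \<delta> a + \<delta> b" and mult: "\<delta> (a * b) = \<delta> a * b + a * \<delta> b"
begin

lemma zero: "\<delta> 0 = 0"
  by (rule additive_zero) (rule add)

lemma one: "\<delta> 1 = 0"
  using mult[of 1 1] by simp

lemma sum: "\<delta> (\<Sum>i\<in>X. f i) = (\<Sum>i\<in>X. \<delta> (f i))"
  by (rule additive_sum) (rule add)

lemma power: "\<delta> (a ^ n) = of_nat n * a ^ (n - 1) * \<delta> a"
proof (induct n)
  case (Suc n)
  then show ?case by (cases n) (simp_all add: mult one algebra_simps)
qed (simp add: one)

lemma prod: "finite X \<Longrightarrow> \<delta> (\<Prod>i\<in>X. f i) = (\<Sum>i\<in>X. \<delta> (f i) * (\<Prod>j\<in>X - {i}. f j))"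
proof (induct X rule: finite_induct)
  case (insert x X)
  have "(\<Sum>i\<in>X. \<delta> (f i) * (\<Prod>j\<in>insert x X - {i}. f j)) = (\<Sum>i\<in>X. f x * (\<delta> (f i) * (\<Prod>j\<in>X - {i}. f j)))"
  proof (rule sum.cong[OF refl])
    fix i assume i: "i \<in> X"
    then have "insert x X - {i} = insert x (X - {i})" using insert.hyps by auto
    then show "\<delta> (f i) * (\<Prod>j\<in>insert x X - {i}. f j) = f x * (\<delta> (f i) * (\<Prod>j\<in>X - {i}. f j))"
      using insert.hyps by (simp add: ac_simps)
  qed
  moreover have "insert x X - {x} = X" using insert.hyps by auto
  ultimately show ?case
    using insert.hyps by (simp add: mult insert sum_distrib_left)
qed (simp add: one)

lemma eval_mono:
  assumes "finite X" "keys m \<subseteq> X"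
  shows "\<delta> (eval_mono x m) =
    (\<Sum>v\<in>X. of_nat (lookup m v) * eval_mono x (m - single v 1) * \<delta> (x v))"
proof -
  have "\<delta> (x v ^ lookup m v) * (\<Prod>w\<in>X - {v}. x w ^ lookup m w) =
      of_nat (lookup m v) * eval_mono x (m - single v 1) * \<delta> (x v)" if v: "v \<in> X" for v
  proof -
    have "keys (m - single v 1) \<subseteq> X" using assms(2) by (auto simp: in_keys_iff lookup_minus)
    then have "eval_mono x (m - single v 1) = (\<Prod>w\<in>X. x w ^ lookup (m - single v 1) w)"
      by (rule eval_mono_superset[OF assms(1)])
    also have "\<dots> = x v ^ (lookup m v - 1) * (\<Prod>w\<in>X - {v}. x w ^ lookup m w)"
      using v assms(1) by (simp add: prod.remove[of X v] lookup_minus)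
        (auto simp: lookup_single when_def intro!: arg_cong2[of _ _ _ _ "(*)"] prod.cong split: if_splits)
    finally show ?thesis by (simp add: power ac_simps)
  qed
  then show ?thesis
    unfolding eval_mono_superset[OF assms] by (simp add: prod assms(1))
qed

end

definition iterate_derivations :: "('d::finite \<Rightarrow> 'a \<Rightarrow> 'a) \<Rightarrow> ('d \<Rightarrow> nat) \<Rightarrow> 'a \<Rightarrow> 'a"
  where "iterate_derivations \<delta> \<theta> = foldr (\<lambda>d. \<delta> d ^^ \<theta> d) (SOME ds. set ds = UNIV \<and> distinct ds)"

lemma funpow_swap: "(\<And>x. f (g x) = g (f x)) \<Longrightarrow> f ((g ^^ n) x) = (g ^^ n) (f x)"
  by (induct n) auto

lemma iterate_derivations_step:
  fixes \<delta> :: "'d::finite \<Rightarrow> 'a \<Rightarrow> 'a"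
  assumes comm: "\<And>d e a. \<delta> d (\<delta> e a) = \<delta> e (\<delta> d a)"
  shows "\<delta> d (iterate_derivations \<delta> \<theta> a) = iterate_derivations \<delta> (\<lambda>e. (if e = d then 1 else 0) + \<theta> e) a"
proof -
  let ?\<theta> = "\<lambda>e. (if e = d then 1 else 0) + \<theta> e"
  have notin: "foldr (\<lambda>e. \<delta> e ^^ ?\<theta> e) ds a = foldr (\<lambda>e. \<delta> e ^^ \<theta> e) ds a" if "d \<notin> set ds" for ds
    using that by (induct ds) auto
  have step: "\<delta> d (foldr (\<lambda>e. \<delta> e ^^ \<theta> e) ds a) = foldr (\<lambda>e. \<delta> e ^^ ?\<theta> e) ds a"
    if "d \<in> set ds" "distinct ds" for ds
    using that
  proof (induct ds)
    case (Cons e ds)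
    show ?case
    proof (cases "e = d")
      case True
      then show ?thesis using Cons.prems notin[of ds] by simp
    next
      case False
      then show ?thesis using Cons funpow_swap[of "\<delta> d" "\<delta> e", OF comm] by simp
    qed
  qed simp
  have "\<exists>ds. set ds = (UNIV :: 'd set) \<and> distinct ds" by (rule finite_distinct_list) simp
  from someI_ex[OF this] show ?thesis unfolding iterate_derivations_def by (intro step) auto
qed

lemma iterate_derivations_zero: "iterate_derivations \<delta> (\<lambda>_. 0) a = a"
proof -
  have "foldr (\<lambda>d. \<delta> d ^^ 0) ds a = a" for ds by (induct ds) auto
  then show ?thesis by (simp add: iterate_derivations_def)
qed

lemma eval_dderiv:
  fixes \<delta> :: "'d \<Rightarrow> 'k::field \<Rightarrow> 'k"
  assumes \<delta>: "commuting_derivations \<delta>"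
    and x: "\<And>v. \<delta> d (x v) = x (act (\<lambda>e. if e = d then 1 else 0) v)"
  shows "eval_at x (dderiv \<delta> d p) = \<delta> d (eval_at x p)"
proof -
  interpret derivation "\<delta> d"
    using \<delta> by unfold_locales (auto simp: commuting_derivations_def)
  let ?x' = "\<lambda>v. x (act (\<lambda>e. if e = d then 1 else 0) v)"
  let ?t = "\<lambda>m v. of_nat (lookup m v) * lookup p m * eval_mono x (m - single v 1) * ?x' v"
  have "eval_at x (dderiv \<delta> d p) = (\<Sum>m\<in>keys p. \<delta> d (lookup p m) * eval_mono x m) +
      (\<Sum>v\<in>vars p. \<Sum>m\<in>keys p. ?t m v)"
    unfolding dderiv_def pdiff_def
    by (simp add: eval_add eval_sum eval_mult eval_single sum_distrib_right)
  also have "(\<Sum>v\<in>vars p. \<Sum>m\<in>keys p. ?t m v) = (\<Sum>m\<in>keys p. \<Sum>v\<in>vars p. ?t m v)"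
    by (rule sum.swap)
  also have "\<dots> = (\<Sum>m\<in>keys p. lookup p m * \<delta> d (eval_mono x m))"
  proof (rule sum.cong[OF refl])
    fix m assume "m \<in> keys p"
    then have "keys m \<subseteq> vars p" by (auto simp: vars_def)
    then show "(\<Sum>v\<in>vars p. ?t m v) = lookup p m * \<delta> d (eval_mono x m)"
      by (simp add: eval_mono[of "vars p"] x sum_distrib_left ac_simps)
  qed
  finally show ?thesis
    by (simp add: eval_at_def psum_def sum mult sum.distrib)
qed

lemma diff_ideal_kernel:
  fixes \<delta> :: "'d::finite \<Rightarrow> 'k::field \<Rightarrow> 'k"
  assumes "commuting_derivations \<delta>"
  shows "diff_ideal \<delta> {p. eval_at (\<lambda>v. iterate_derivations \<delta> (dops v) (c (indet v))) p = 0}"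
proof -
  let ?x = "\<lambda>v. iterate_derivations \<delta> (dops v) (c (indet v))"
  have comm: "\<And>d e a. \<delta> d (\<delta> e a) = \<delta> e (\<delta> d a)" and zero: "\<And>d. \<delta> d 0 = 0"
    using assms additive_zero[of "\<delta> d" for d] unfolding commuting_derivations_def by blast+
  have "eval_at ?x (dderiv \<delta> d p) = \<delta> d (eval_at ?x p)" for d p
    by (rule eval_dderiv[OF assms]) (simp add: iterate_derivations_step[of \<delta>, OF comm] act_def)
  then show ?thesis
    by (simp add: diff_ideal_def ideal_in_def eval_add eval_mult zero)
qed

lemma pdiff_linear:
  fixes f :: "('v, 'a::comm_ring_1) mpoly"
  assumes "deg_in v f = 1"
  shows "pdiff v f = coeff_in v 1 f"
  unfolding pdiff_def coeff_in_def
proof (rule sum.mono_neutral_cong_right)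
  have le1: "lookup m v \<le> 1" if "m \<in> keys f" for m using lookup_le_deg_in[OF that, of v] assms by simp
  show "\<forall>m\<in>keys f - {m \<in> keys f. lookup m v = 1}.
      single (m - single v 1) (of_nat (lookup m v) * lookup f m) = 0"
  proof
    fix m assume "m \<in> keys f - {m \<in> keys f. lookup m v = 1}"
    then have "lookup m v = 0" using le1[of m] by (auto simp: le_Suc_eq)
    then show "single (m - single v 1) (of_nat (lookup m v) * lookup f m) = 0" by simp
  qed
qed auto

lemma deg_in_Var: "deg_in v (Var v :: ('v, 'a::comm_ring_1) mpoly) = 1"
  using upoly_Var_power[of v 1, where 'a = 'a] by (simp flip: degree_upoly add: degree_monom_eq)

text \<open>If \<open>1\<close> lay in \<open>[A] : H\<^sub>A\<^sup>\<infinity>\<close>, the lowest rank would force \<open>A\<close> to consist of polynomials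
  \<open>\<alpha>\<^sub>y y + \<beta>\<^sub>y\<close>, one for each indeterminate, with \<open>\<alpha>\<^sub>y \<noteq> 0\<close> and \<open>\<beta>\<^sub>y\<close> in \<open>k\<close>.
  Evaluating at \<open>y = - \<beta>\<^sub>y / \<alpha>\<^sub>y\<close> kills \<open>[A]\<close> but not \<open>H\<^sub>A\<close>.\<close>

lemma diff_sat_proper:
  fixes \<delta> :: "'d::finite \<Rightarrow> 'k::field \<Rightarrow> 'k" and A :: "('d, 'y::finite, 'k) dpoly set"
  assumes \<delta>: "commuting_derivations \<delta>" and rk: "ranking le"
    and cs: "char_set le A (diff_sat \<delta> le A)" and ideal: "ideal_in UNIV (diff_sat \<delta> le A)"
  shows "1 \<notin> diff_sat \<delta> le A"
proof
  assume one: "1 \<in> diff_sat \<delta> le A"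
  interpret strict_total_order "strict le" using rk by (rule strict_total_order_ranking)
  have all: "p \<in> diff_sat \<delta> le A" for p
    using ideal_inD(4)[OF ideal _ one, of p] by simp
  have A: "\<And>f. f \<in> A \<Longrightarrow> f \<notin> polys_in {}" "\<And>f g. f \<in> A \<Longrightarrow> g \<in> A \<Longrightarrow> f \<noteq> g \<Longrightarrow> reduced le f g"
    "finite A"
    using cs by (auto simp: char_set_def autoreduced_def)
  let ?v = "\<lambda>y :: 'y. DVar (\<lambda>_. 0) y :: ('d, 'y) dvar"
  have "\<exists>g\<in>A. leader le g = ?v y \<and> deg_in (?v y) g = 1" for y
  proof -
    let ?V = "Var (?v y) :: ('d, 'y, 'k) dpoly"
    have "?V \<notin> polys_in {}" by (simp add: polys_in_iff)
    then obtain g where g: "g \<in> A" "\<not> reduced le ?V g"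
      using char_set_reduced_element[OF rk cs all] by blast
    have "act \<theta> (leader le g) \<notin> vars ?V" if "\<theta> \<noteq> (\<lambda>_. 0)" for \<theta>
      using that by (auto simp: act_def fun_eq_iff)
    then have le: "deg_in (leader le g) g \<le> deg_in (leader le g) ?V"
      using g(2) by (auto simp: reduced_def)
    have pos: "0 < deg_in (leader le g) g"
      using leader(1)[OF rk A(1)[OF g(1)]] by (simp add: in_vars_iff_deg)
    then have "leader le g \<in> vars ?V" using le unfolding in_vars_iff_deg by simp
    then have "leader le g = ?v y" by simp
    then show ?thesis using g(1) le pos deg_in_Var[of "?v y", where 'a = 'k] by auto
  qed
  then obtain g where g: "\<And>y. g y \<in> A" "\<And>y. leader le (g y) = ?v y" "\<And>y. deg_in (?v y) (g y) = 1"
    by metis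
  have eq_g: "f = g (indet w) \<and> w = ?v (indet w)" if f: "f \<in> A" "w \<in> vars f" for f w
  proof -
    let ?u = "?v (indet w)"
    have w: "w = act (dops w) ?u" by (cases w) (simp add: act_def)
    have "f = g (indet w)"
    proof (rule ccontr)
      assume "f \<noteq> g (indet w)"
      then have red: "reduced le f (g (indet w))" using A(2) f(1) g(1) by blast
      have "dops w = (\<lambda>_. 0)" using red f(2) w g(2) unfolding reduced_def by metis
      then have "?u \<in> vars f" using f(2) w by simp
      moreover have "deg_in ?u f < 1" using red by (simp add: reduced_def g)
      ultimately show False by (simp add: in_vars_iff_deg)
    qed
    moreover from this have "w = ?u \<or> strict le w ?u"
      using leader(2)[OF rk A(1)[OF f(1)] f(2)] g(2) by simp
    then have "dops w = (\<lambda>_. 0)" using strict_act[OF rk, of "dops w" ?u] w trans irrefl by (metis act_eq_self_iff)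
    ultimately show ?thesis using w by simp
  qed
  have vars_g: "vars (g y) = {?v y}" for y
  proof -
    have "w = ?v y" if w: "w \<in> vars (g y)" for w
    proof -
      have "?v (indet w) = leader le (g (indet w))" by (simp only: g(2))
      also have "g (indet w) = g y" using eq_g[OF g(1) w] by (rule conjunct1[THEN sym])
      also have "leader le (g y) = ?v y" by (rule g(2))
      finally have "?v (indet w) = ?v y" .
      with eq_g[OF g(1) w, THEN conjunct2] show ?thesis by (rule HOL.trans)
    qed
    moreover have "?v y \<in> vars (g y)" using leader(1)[OF rk A(1)[OF g(1)], of y] g(2) by simp
    ultimately show ?thesis by blast
  qed
  have lin: "\<exists>\<alpha> \<beta>. \<alpha> \<noteq> 0 \<and> g y = Const \<beta> + Const \<alpha> * Var (?v y) \<and> coeff_in (?v y) 1 (g y) = Const \<alpha>" for y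
  proof -
    have "coeff_in (?v y) j (g y) \<in> polys_in {}" for j
      using vars_coeff_in[of "?v y" j "g y"] by (auto simp: polys_in_iff vars_g)
    then obtain \<beta> \<alpha> where ab: "coeff_in (?v y) 0 (g y) = Const \<beta>" "coeff_in (?v y) 1 (g y) = Const \<alpha>"
      unfolding polys_in_empty_iff by metis
    have "g y = Const \<beta> + Const \<alpha> * Var (?v y)"
      by (subst expand_coeff_in[of _ "?v y"]) (use ab in \<open>simp add: g(3)\<close>)
    moreover have "g y \<noteq> 0" using vars_g[of y] by auto
    then have "Const \<alpha> \<noteq> (0 :: ('d, 'y, 'k) dpoly)"
      using coeff_in_deg_in[of "g y" "?v y"] ab(2) by (simp add: g(3))
    then have "\<alpha> \<noteq> 0" by (auto simp: Const_def)
    ultimately show ?thesis using ab(2) by blast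
  qed
  then obtain \<alpha> \<beta> where ab: "\<And>y. \<alpha> y \<noteq> 0" "\<And>y. g y = Const (\<beta> y) + Const (\<alpha> y) * Var (?v y)"
    "\<And>y. coeff_in (?v y) 1 (g y) = Const (\<alpha> y)"
    by metis
  let ?x = "\<lambda>v. iterate_derivations \<delta> (dops v) (- \<beta> (indet v) / \<alpha> (indet v))"
  have A_g: "\<exists>y. f = g y" if "f \<in> A" for f
    using eq_g[OF that leader(1)[OF rk A(1)[OF that]]] by blast
  have "eval_at ?x (g y) = 0" for y
    by (simp add: ab(2) eval_add eval_mult iterate_derivations_zero ab(1))
  then have "A \<subseteq> {p. eval_at ?x p = 0}" using A_g by blast
  then have hull: "diff_ideal \<delta> hull A \<subseteq> {p. eval_at ?x p = 0}"
    by (rule hull_minimal) (rule diff_ideal_kernel[OF \<delta>, of "\<lambda>y. - \<beta> y / \<alpha> y"])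
  obtain m where "H_prod le A ^ m \<in> diff_ideal \<delta> hull A"
    using one by (auto simp: diff_sat_def saturation_def)
  then have "eval_at ?x (H_prod le A) = 0" using hull by (auto simp: eval_power)
  moreover have "eval_at ?x (initial le f * separant le f) \<noteq> 0" if f: "f \<in> A" for f
  proof -
    obtain y where "f = g y" using A_g[OF f] by blast
    then have "initial le f = Const (\<alpha> y)" "separant le f = Const (\<alpha> y)"
      using ab(3)[of y] by (simp_all add: initial_def separant_def g pdiff_linear)
    then show ?thesis using ab(1) by (simp add: eval_mult)
  qed
  then have "eval_at ?x (H_prod le A) \<noteq> 0" unfolding H_prod_def eval_prod using A(3) by simp
  ultimately show False by blast
qed

lemma charset_of_diff_sat:
  fixes \<delta> :: "'d::finite \<Rightarrow> 'k::field \<Rightarrow> 'k" and A :: "('d, 'y::finite, 'k) dpoly set"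
  assumes "commuting_derivations \<delta>" "ranking le" "diff_ideal \<delta> I" "char_set le A I" "I = diff_sat \<delta> le A"
  shows "charset le I A"
proof
  show ideal: "ideal_in UNIV I" using assms(3) by (simp add: diff_ideal_def)
  show "1 \<notin> I" using diff_sat_proper[OF assms(1,2)] assms(4) ideal unfolding assms(5) by blast
  show "w \<in> I" if w: "H_prod le A * w \<in> I" for w
  proof -
    obtain m where "H_prod le A ^ m * (H_prod le A * w) \<in> diff_ideal \<delta> hull A"
      using w unfolding assms(5) diff_sat_def saturation_def by blast
    then have "H_prod le A ^ Suc m * w \<in> diff_ideal \<delta> hull A" by (simp add: ac_simps)
    then show ?thesis unfolding assms(5) diff_sat_def saturation_def by blast
  qed
qed (fact assms)+

section \<open>Denominators and the ring \<open>k(N)[L]\<close>\<close>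

lemma dvd_in_polys_in_iff:
  fixes a b :: "('v::linorder, 'a::idom) mpoly"
  assumes "b \<in> polys_in V"
  shows "dvd_in (polys_in V) a b \<longleftrightarrow> a dvd b"
proof
  assume "a dvd b"
  then obtain x where x: "b = a * x" by blast
  show "dvd_in (polys_in V) a b"
  proof (cases "b = 0")
    case True
    then show ?thesis unfolding dvd_in_def by (intro bexI[of _ 0]) auto
  next
    case False
    then have "x \<in> polys_in V" using assms polys_in_factor(2)[of a x V] by (simp add: x)
    then show ?thesis using x unfolding dvd_in_def by blast
  qed
qed (auto simp: dvd_in_def)

lemma denominator_dvd:
  fixes a b c \<beta> :: "('d::finite, 'y::finite, 'k::field) dpoly"
  assumes \<beta>: "\<beta> \<noteq> 0" and b: "denominator_in N (Fract a \<beta>) b" and c: "\<beta> dvd c * a"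
  shows "b dvd c"
proof -
  obtain a' where a': "a' \<in> polys_in N" "Fract a \<beta> = Fract a' b"
    "\<And>c. c \<in> polys_in N \<Longrightarrow> dvd_in (polys_in N) c a' \<Longrightarrow> dvd_in (polys_in N) c b \<Longrightarrow> dvd_in (polys_in N) c 1"
    and bN: "b \<in> polys_in N" "b \<noteq> 0"
    using b unfolding denominator_in_def by blast
  have eq: "a * b = a' * \<beta>" using a'(2) \<beta> bN(2) by (simp add: eq_fract)
  obtain k where k: "c * a = \<beta> * k" using c by blast
  have "\<beta> * (c * a') = c * (a' * \<beta>)" by (simp only: ac_simps)
  also have "\<dots> = (c * a) * b" unfolding eq[symmetric] by (simp only: ac_simps)
  also have "\<dots> = \<beta> * (k * b)" unfolding k by (simp only: ac_simps)
  finally have "b dvd c * a'" using \<beta> by simp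
  moreover have "x dvd 1" if x: "x dvd a'" "x dvd b" for x
  proof -
    obtain y where "b = x * y" using x(2) by blast
    then have "x \<in> polys_in N" using bN polys_in_factor(1)[of x y N] by simp
    then show ?thesis using a'(3)[of x] x a'(1) bN(1) by (simp add: dvd_in_polys_in_iff)
  qed
  ultimately show ?thesis using bN(2) dvd_mult_coprime by blast
qed

lemma dvd_of_denominator_dvd:
  fixes a b c \<beta> :: "('d::finite, 'y::finite, 'k::field) dpoly"
  assumes \<beta>: "\<beta> \<noteq> 0" and b: "denominator_in N (Fract a \<beta>) b" and c: "b dvd c"
  shows "\<beta> dvd c * a"
proof -
  obtain a' where "Fract a \<beta> = Fract a' b" "b \<noteq> 0" using b unfolding denominator_in_def by blast
  then have eq: "a * b = a' * \<beta>" using \<beta> by (simp add: eq_fract)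
  obtain k where k: "c = b * k" using c by blast
  have "c * a = k * (a * b)" unfolding k by (simp only: ac_simps)
  also have "\<dots> = \<beta> * (k * a')" unfolding eq by (simp only: ac_simps)
  finally show ?thesis by simp
qed

lemma denominator_exists:
  fixes a \<beta> :: "('d::finite, 'y::finite, 'k::field) dpoly"
  assumes "a \<in> polys_in N" "\<beta> \<in> polys_in N" "\<beta> \<noteq> 0"
  shows "\<exists>b. denominator_in N (Fract a \<beta>) b"
proof -
  let ?P = "\<lambda>b. b \<in> polys_in N \<and> b \<noteq> 0 \<and> (\<exists>a'\<in>polys_in N. Fract a \<beta> = Fract a' b)"
  have "?P \<beta>" using assms by blast
  then obtain b where b: "?P b" "\<And>b'. ?P b' \<Longrightarrow> tdeg b \<le> tdeg b'"
    using ex_has_least_nat[of ?P \<beta> tdeg] by blast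
  then obtain a' where a': "a' \<in> polys_in N" "Fract a \<beta> = Fract a' b" by blast
  have "dvd_in (polys_in N) c 1"
    if c: "c \<in> polys_in N" "dvd_in (polys_in N) c a'" "dvd_in (polys_in N) c b" for c
  proof -
    obtain x y where xy: "x \<in> polys_in N" "a' = c * x" "y \<in> polys_in N" "b = c * y"
      using c(2,3) unfolding dvd_in_def by blast
    then have nz: "c \<noteq> 0" "y \<noteq> 0" using b(1) by auto
    have "Fract a \<beta> = Fract x y" unfolding a'(2) xy using nz by (simp add: eq_fract)
    then have "tdeg b \<le> tdeg y" using xy nz by (intro b(2)) blast
    then have "tdeg c = 0" using nz by (simp add: xy tdeg_mult)
    then have "c dvd 1" using nz tdeg_pos_iff[of c] by simp
    then show ?thesis by (simp add: dvd_in_polys_in_iff)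
  qed
  then show ?thesis using b(1) a' unfolding denominator_in_def by blast
qed

lemma denominators_dvd_iff:
  fixes e :: "'m \<Rightarrow> ('d::finite, 'y::finite, 'k::field) dpoly"
  assumes "\<And>\<mu>. \<mu> \<in> X \<Longrightarrow> e \<mu> \<in> polys_in N" "\<beta> \<in> polys_in N" "\<beta> \<noteq> 0"
  shows "(\<forall>b\<in>{b. \<exists>\<mu>\<in>X. denominator_in N (Fract (e \<mu>) \<beta>) b}. b dvd c) \<longleftrightarrow> (\<forall>\<mu>\<in>X. \<beta> dvd c * e \<mu>)"
proof (intro iffI ballI)
  fix \<mu> assume all: "\<forall>b\<in>{b. \<exists>\<mu>\<in>X. denominator_in N (Fract (e \<mu>) \<beta>) b}. b dvd c" and \<mu>: "\<mu> \<in> X"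
  obtain b where b: "denominator_in N (Fract (e \<mu>) \<beta>) b"
    using denominator_exists[OF assms(1)[OF \<mu>] assms(2,3)] by blast
  moreover have "b dvd c" using all b \<mu> by blast
  ultimately show "\<beta> dvd c * e \<mu>" by (rule dvd_of_denominator_dvd[OF assms(3)])
next
  fix b assume all: "\<forall>\<mu>\<in>X. \<beta> dvd c * e \<mu>" and "b \<in> {b. \<exists>\<mu>\<in>X. denominator_in N (Fract (e \<mu>) \<beta>) b}"
  then obtain \<mu> where "\<mu> \<in> X" "denominator_in N (Fract (e \<mu>) \<beta>) b" by blast
  then show "b dvd c" using denominator_dvd[OF assms(3)] all by blast
qed

lemma lcm_in_denominators_iff:
  fixes e :: "'m \<Rightarrow> ('d::finite, 'y::finite, 'k::field) dpoly"
  assumes "\<And>\<mu>. \<mu> \<in> X \<Longrightarrow> e \<mu> \<in> polys_in N" "\<beta> \<in> polys_in N" "\<beta> \<noteq> 0"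
  shows "lcm_in (polys_in N) {b. \<exists>\<mu>\<in>X. denominator_in N (Fract (e \<mu>) \<beta>) b} c \<longleftrightarrow>
    c \<in> polys_in N \<and> (\<forall>\<mu>\<in>X. \<beta> dvd c * e \<mu>) \<and> (\<forall>c'\<in>polys_in N. (\<forall>\<mu>\<in>X. \<beta> dvd c' * e \<mu>) \<longrightarrow> c dvd c')"
proof -
  let ?B = "{b. \<exists>\<mu>\<in>X. denominator_in N (Fract (e \<mu>) \<beta>) b}"
  have "lcm_in (polys_in N) ?B c \<longleftrightarrow>
      c \<in> polys_in N \<and> (\<forall>b\<in>?B. b dvd c) \<and> (\<forall>c'\<in>polys_in N. (\<forall>b\<in>?B. b dvd c') \<longrightarrow> c dvd c')"
    unfolding lcm_in_def by (simp add: dvd_in_polys_in_iff cong: conj_cong ball_cong del: mem_Collect_eq)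
  then show ?thesis by (simp only: denominators_dvd_iff[OF assms])
qed

text \<open>Among the \<open>c\<close> with \<open>\<beta> | c e\<^sub>\<mu>\<close> for all \<open>\<mu>\<close>, one of least degree is the lcm of the
  denominators: the greatest common divisor with any other such element has the same property.\<close>

lemma lcm_in_denominators_exists:
  fixes e :: "'m \<Rightarrow> ('d::finite, 'y::finite, 'k::field) dpoly"
  assumes e: "\<And>\<mu>. \<mu> \<in> X \<Longrightarrow> e \<mu> \<in> polys_in N" and \<beta>: "\<beta> \<in> polys_in N" "\<beta> \<noteq> 0"
  shows "\<exists>c. lcm_in (polys_in N) {b. \<exists>\<mu>\<in>X. denominator_in N (Fract (e \<mu>) \<beta>) b} c"
proof -
  let ?P = "\<lambda>c. c \<in> polys_in N \<and> c \<noteq> 0 \<and> (\<forall>\<mu>\<in>X. \<beta> dvd c * e \<mu>)"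
  have "?P \<beta>" using \<beta> by simp
  then obtain c where c: "?P c" "\<And>c'. ?P c' \<Longrightarrow> tdeg c \<le> tdeg c'"
    using ex_has_least_nat[of ?P \<beta> tdeg] by blast
  have "c dvd c'" if c': "c' \<in> polys_in N" "\<forall>\<mu>\<in>X. \<beta> dvd c' * e \<mu>" for c'
  proof (cases "c' = 0")
    case False
    let ?Q = "\<lambda>x. x dvd c \<and> x dvd c'"
    have bound: "tdeg x \<le> tdeg c" if "x dvd c" for x
      using that c(1) by (auto elim!: dvdE simp: tdeg_mult)
    have "?Q 1" "\<forall>x. ?Q x \<longrightarrow> tdeg x < Suc (tdeg c)" using bound by (auto simp: less_Suc_eq_le)
    then obtain g where g: "?Q g" "\<And>x. ?Q x \<Longrightarrow> tdeg x \<le> tdeg g"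
      using ex_has_greatest_nat[of ?Q 1 tdeg "Suc (tdeg c)"] by blast
    then obtain c1 c1' where c1: "c = g * c1" "c' = g * c1'" by blast
    have nz: "g \<noteq> 0" "c1 \<noteq> 0" "c1' \<noteq> 0" using c(1) False c1 by auto
    have coprime: "x dvd 1" if x: "x dvd c1'" "x dvd c1" for x
    proof -
      have "x \<noteq> 0" using x nz by auto
      have "tdeg (g * x) \<le> tdeg g" using x by (intro g(2)) (auto simp: c1)
      then show "x dvd 1" using nz \<open>x \<noteq> 0\<close> tdeg_pos_iff[of x] by (simp add: tdeg_mult)
    qed
    have "\<beta> dvd g * e \<mu>" if \<mu>: "\<mu> \<in> X" for \<mu>
    proof -
      obtain h where h: "c * e \<mu> = \<beta> * h" using c(1) \<mu> by blast
      obtain h' where h': "c' * e \<mu> = \<beta> * h'" using c'(2) \<mu> by blast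
      have "(g * \<beta>) * (c1' * h) = c' * (\<beta> * h)" by (simp add: c1 ac_simps)
      also have "\<dots> = c * (c' * e \<mu>)" unfolding h[symmetric] by (simp add: ac_simps)
      also have "\<dots> = (g * \<beta>) * (c1 * h')" unfolding h' by (simp add: c1 ac_simps)
      finally have "c1' * h = c1 * h'" using nz \<beta> by simp
      then have "c1 dvd h * c1'" by (simp add: mult.commute)
      then have "c1 dvd h" using nz(2) coprime by (rule dvd_mult_coprime)
      then obtain k where "h = c1 * k" by blast
      then have "c1 * (g * e \<mu>) = c1 * (\<beta> * k)" using h by (simp add: c1 ac_simps)
      then show ?thesis using nz by simp
    qed
    moreover have "g \<in> polys_in N" using c(1) polys_in_factor(1)[of g c1 N] by (simp add: c1)
    ultimately have "tdeg c \<le> tdeg g" using nz by (intro c(2)) blast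
    then have "c1 dvd 1" using nz tdeg_pos_iff[of c1] by (simp add: c1 tdeg_mult)
    then have "c dvd g" unfolding c1 by (rule dvd_mult_unitD) (simp add: mult.commute)
    then show ?thesis using g(1) by (blast intro: dvd_trans)
  qed simp
  then have "lcm_in (polys_in N) {b. \<exists>\<mu>\<in>X. denominator_in N (Fract (e \<mu>) \<beta>) b} c"
    using c(1) by (subst lcm_in_denominators_iff[OF assms]) blast+
  then show ?thesis ..
qed

lemma lcoeff_add: "lcoeff L \<mu> (p + q) = lcoeff L \<mu> p + lcoeff L \<mu> q"
  unfolding lcoeff_def by (rule psum_add) (simp add: single_add)

lemma lookup_lcoeff:
  fixes p :: "('v, 'a::comm_ring_1) mpoly"
  shows "lookup (lcoeff L \<mu> p) \<nu> = (if keys \<mu> \<subseteq> L \<and> keys \<nu> \<inter> L = {} then lookup p (\<mu> + \<nu>) else 0)"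
proof (rule poly_mapping_additive_eqI[of "\<lambda>p. lookup (lcoeff L \<mu> p) \<nu>"
      "\<lambda>p. if keys \<mu> \<subseteq> L \<and> keys \<nu> \<inter> L = {} then lookup p (\<mu> + \<nu>) else 0"])
  fix m :: "'v mono" and c :: 'a
  have "restrict_mono L m = \<mu> \<and> restrict_mono (- L) m = \<nu> \<longleftrightarrow>
      keys \<mu> \<subseteq> L \<and> keys \<nu> \<inter> L = {} \<and> m = \<mu> + \<nu>"
  proof
    assume "restrict_mono L m = \<mu> \<and> restrict_mono (- L) m = \<nu>"
    then show "keys \<mu> \<subseteq> L \<and> keys \<nu> \<inter> L = {} \<and> m = \<mu> + \<nu>"
      using restrict_mono_split[of L m] keys_restrict_mono[of L m] keys_restrict_mono[of "- L" m]
      by (auto simp: add.commute)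
  next
    assume "keys \<mu> \<subseteq> L \<and> keys \<nu> \<inter> L = {} \<and> m = \<mu> + \<nu>"
    then show "restrict_mono L m = \<mu> \<and> restrict_mono (- L) m = \<nu>"
      by (auto intro!: poly_mapping_eqI simp: lookup_restrict_mono lookup_add disjoint_iff
          subset_iff in_keys_iff)
  qed
  then show "lookup (lcoeff L \<mu> (single m c)) \<nu> =
      (if keys \<mu> \<subseteq> L \<and> keys \<nu> \<inter> L = {} then lookup (single m c) (\<mu> + \<nu>) else 0)"
    by (auto simp: lcoeff_def lookup_single when_def)
qed (simp_all add: lcoeff_add lookup_add)

lemma lookup_via_lcoeff: "lookup p m = lookup (lcoeff L (restrict_mono L m) p) (restrict_mono (- L) m)"
  using restrict_mono_split[of L m]
  by (auto simp: lookup_lcoeff keys_restrict_mono add.commute)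

lemma lookup_Const_mult:
  fixes p :: "('v, 'a::comm_ring_1) mpoly"
  shows "lookup (Const c * p) m = c * lookup p m"
  by (rule poly_mapping_additive_eqI[of "\<lambda>p. lookup (Const c * p) m" "\<lambda>p. c * lookup p m"])
     (auto simp: Const_def mult_single lookup_single when_def distrib_left lookup_add)

lemma restrict_mono_add: "restrict_mono V (m + n) = restrict_mono V m + restrict_mono V n"
  by (rule poly_mapping_eqI) (simp add: lookup_restrict_mono lookup_add)

lemma Fract_one_add: "Fract (a + b) 1 = Fract a 1 + Fract b 1"
  and Fract_one_mult: "Fract (a * b) 1 = Fract a 1 * Fract b 1"
  by simp_all

lemma Fract_one_inject: "Fract a 1 = Fract b 1 \<longleftrightarrow> a = b"
  by (simp add: eq_fract)

lemma Fract_one_eq_0_iff: "Fract a 1 = 0 \<longleftrightarrow> a = 0"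
  by (simp add: Zero_fract_def eq_fract)

lemma to_frac_polys_psum:
  "to_frac_polys L = psum (\<lambda>m c. single (restrict_mono L m) (Fract (single (restrict_mono (- L) m) c) 1))"
  by (simp add: fun_eq_iff to_frac_polys_def psum_def)

lemma to_frac_polys_add: "to_frac_polys L (p + q) = to_frac_polys L p + to_frac_polys L q"
  unfolding to_frac_polys_psum by (rule psum_add) (simp only: single_add Fract_one_add)

lemma to_frac_polys_mult: "to_frac_polys L (p * q) = to_frac_polys L p * to_frac_polys L q"
  unfolding to_frac_polys_psum
  by (rule psum_mult)
     (simp_all only: single_add Fract_one_add restrict_mono_add mult_single Fract_one_mult[symmetric])

lemma to_frac_polys_zero [simp]: "to_frac_polys L 0 = 0"
  by (simp add: to_frac_polys_psum)

lemma lookup_to_frac_polys: "lookup (to_frac_polys L p) \<mu> = Fract (lcoeff L \<mu> p) 1"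
proof (rule poly_mapping_additive_eqI[of "\<lambda>p. lookup (to_frac_polys L p) \<mu>" "\<lambda>p. Fract (lcoeff L \<mu> p) 1"])
  fix m c
  show "lookup (to_frac_polys L (single m c)) \<mu> = Fract (lcoeff L \<mu> (single m c)) 1"
    by (simp add: to_frac_polys_psum lcoeff_def lookup_single when_def flip: Zero_fract_def)
qed (simp_all only: to_frac_polys_add lookup_add lcoeff_add Fract_one_add)

lemma to_frac_polys_inject: "to_frac_polys L p = to_frac_polys L q \<longleftrightarrow> p = q"
proof
  assume "to_frac_polys L p = to_frac_polys L q"
  then have "lcoeff L \<mu> p = lcoeff L \<mu> q" for \<mu>
    by (metis lookup_to_frac_polys Fract_one_inject)
  then show "p = q" by (intro poly_mapping_eqI) (metis lookup_via_lcoeff)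
qed simp

lemma to_frac_polys_free:
  assumes "p \<in> polys_in V" "V \<inter> L = {}"
  shows "to_frac_polys L p = Const (Fract p 1)"
proof (rule poly_mapping_eqI)
  fix \<mu>
  have m: "restrict_mono L m = 0" "restrict_mono (- L) m = m" if "m \<in> keys p" for m
  proof -
    have "keys m \<subseteq> V" using assms(1) that by (auto simp: polys_in_iff vars_def)
    then have "lookup m v = 0" if "v \<in> L" for v
      using assms(2) that by (auto simp: in_keys_iff)
    then show "restrict_mono L m = 0" "restrict_mono (- L) m = m"
      by (auto intro!: poly_mapping_eqI simp: lookup_restrict_mono)
  qed
  have "lcoeff L \<mu> p = (\<Sum>m\<in>keys p. if \<mu> = 0 then single m (lookup p m) else 0)"
    unfolding lcoeff_def psum_def by (intro sum.cong refl) (auto simp: m)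
  also have "\<dots> = (if \<mu> = 0 then p else 0)"
    using psum_monomials[of p] by (simp add: psum_def)
  finally show "lookup (to_frac_polys L p) \<mu> = lookup (Const (Fract p 1)) \<mu>"
    by (auto simp: lookup_to_frac_polys Const_def lookup_single when_def simp flip: Zero_fract_def)
qed

lemma to_frac_polys_monomial: "keys \<mu> \<subseteq> L \<Longrightarrow> to_frac_polys L (single \<mu> 1) = single \<mu> 1"
proof -
  assume "keys \<mu> \<subseteq> L"
  then have "restrict_mono L \<mu> = \<mu>" "restrict_mono (- L) \<mu> = 0"
    by (auto intro!: poly_mapping_eqI simp: lookup_restrict_mono in_keys_iff subset_iff)
  then show ?thesis by (simp add: to_frac_polys_psum flip: One_fract_def Zero_fract_def)
qed

lemma lcoeff_nonzero_key:
  assumes "lcoeff L \<mu> p \<noteq> 0"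
  shows "\<exists>m\<in>keys p. \<mu> = restrict_mono L m"
proof (rule ccontr)
  assume "\<not> ?thesis"
  then have "lcoeff L \<mu> p = 0"
    unfolding lcoeff_def psum_def by (intro sum.neutral) auto
  then show False using assms by blast
qed

lemma keys_to_frac_polys: "keys (to_frac_polys L p) = restrict_mono L ` keys p"
proof (intro equalityI subsetI)
  fix \<mu> assume "\<mu> \<in> keys (to_frac_polys L p)"
  then have "lcoeff L \<mu> p \<noteq> 0" by (simp add: in_keys_iff lookup_to_frac_polys Fract_one_eq_0_iff)
  then show "\<mu> \<in> restrict_mono L ` keys p" using lcoeff_nonzero_key by blast
next
  fix \<mu> assume "\<mu> \<in> restrict_mono L ` keys p"
  then obtain m where m: "m \<in> keys p" "\<mu> = restrict_mono L m" by blast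
  then have "lcoeff L \<mu> p \<noteq> 0" using lookup_via_lcoeff[of p m L] by (auto simp: in_keys_iff)
  then show "\<mu> \<in> keys (to_frac_polys L p)"
    by (simp add: in_keys_iff lookup_to_frac_polys Fract_one_eq_0_iff)
qed

lemma lcoeff_polys_in: "p \<in> polys_in (N \<union> L) \<Longrightarrow> lcoeff L \<mu> p \<in> polys_in N"
  using vars_lcoeff[of L \<mu> p] by (auto simp: polys_in_iff)

lemma lcoeff_mult_free:
  fixes p q :: "('d::finite, 'y::finite, 'k::field) dpoly"
  assumes "p \<in> polys_in V" "V \<inter> L = {}"
  shows "lcoeff L \<mu> (p * q) = p * lcoeff L \<mu> q"
proof -
  have "Fract (lcoeff L \<mu> (p * q)) 1 = Fract (p * lcoeff L \<mu> q) 1"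
    by (simp only: lookup_to_frac_polys[symmetric] to_frac_polys_mult to_frac_polys_free[OF assms]
        lookup_Const_mult Fract_one_mult)
  then show ?thesis by (simp only: Fract_one_inject)
qed

lemma keys_Const_mult:
  fixes p :: "('v, 'a::idom) mpoly"
  shows "c \<noteq> 0 \<Longrightarrow> keys (Const c * p) = keys p"
  by (auto simp: in_keys_iff lookup_Const_mult)

lemma frac_polys_assemble:
  fixes x :: "(('d, 'y) dvar, ('d::finite, 'y::finite, 'k::field) dpoly fract) mpoly"
  assumes disj: "N \<inter> L = {}" and x: "x \<in> polys_in L"
    and c: "\<And>\<mu>. \<mu> \<in> keys x \<Longrightarrow> \<exists>a\<in>polys_in N. c * lookup x \<mu> = Fract a 1"
  shows "\<exists>h\<in>polys_in (N \<union> L). to_frac_polys L h = Const c * x"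
proof -
  obtain a where a: "\<And>\<mu>. \<mu> \<in> keys x \<Longrightarrow> a \<mu> \<in> polys_in N" "\<And>\<mu>. \<mu> \<in> keys x \<Longrightarrow> c * lookup x \<mu> = Fract (a \<mu>) 1"
    using c by metis
  have sub: "keys \<mu> \<subseteq> L" if "\<mu> \<in> keys x" for \<mu> using x that by (auto simp: polys_in_iff vars_def)
  let ?h = "\<Sum>\<mu>\<in>keys x. a \<mu> * single \<mu> 1"
  have "to_frac_polys L ?h = (\<Sum>\<mu>\<in>keys x. to_frac_polys L (a \<mu> * single \<mu> 1))"
    by (rule additive_sum) (rule to_frac_polys_add)
  also have "\<dots> = (\<Sum>\<mu>\<in>keys x. Const c * single \<mu> (lookup x \<mu>))"
  proof (rule sum.cong[OF refl])
    fix \<mu> assume \<mu>: "\<mu> \<in> keys x"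
    have "to_frac_polys L (a \<mu> * single \<mu> 1) = Const (Fract (a \<mu>) 1) * single \<mu> 1"
      by (simp add: to_frac_polys_mult to_frac_polys_free[OF a(1)[OF \<mu>] disj] to_frac_polys_monomial[OF sub[OF \<mu>]])
    also have "\<dots> = Const c * single \<mu> (lookup x \<mu>)"
      by (simp add: Const_def mult_single a(2)[OF \<mu>])
    finally show "to_frac_polys L (a \<mu> * single \<mu> 1) = Const c * single \<mu> (lookup x \<mu>)" .
  qed
  also have "\<dots> = Const c * x"
    using psum_monomials[of x] by (simp add: psum_def flip: sum_distrib_left)
  finally have "to_frac_polys L ?h = Const c * x" .
  moreover have "?h \<in> polys_in (N \<union> L)"
  proof (intro polys_in_sum polys_in_mult)
    fix \<mu> assume \<mu>: "\<mu> \<in> keys x"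
    show "a \<mu> \<in> polys_in (N \<union> L)" using a(1)[OF \<mu>] by (rule polys_in_mono[rotated]) auto
    show "single \<mu> 1 \<in> polys_in (N \<union> L)" using sub[OF \<mu>] by (intro polys_in_single) auto
  qed
  ultimately show ?thesis by blast
qed

lemma frac_polys_iff:
  fixes x :: "(('d, 'y) dvar, ('d::finite, 'y::finite, 'k::field) dpoly fract) mpoly"
  assumes disj: "N \<inter> L = {}"
  shows "x \<in> frac_polys N L \<longleftrightarrow> (\<exists>b\<in>polys_in N. b \<noteq> 0 \<and> (\<exists>h\<in>polys_in (N \<union> L).
    Const (Fract b 1) * x = to_frac_polys L h))"
proof
  assume x: "x \<in> frac_polys N L"
  have "\<exists>b\<in>polys_in N. b \<noteq> 0 \<and> (\<forall>\<mu>\<in>X. \<exists>a\<in>polys_in N. Fract b 1 * lookup x \<mu> = Fract a 1)" if "finite X" for X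
    using that
  proof induct
    case empty
    then show ?case by (intro bexI[of _ 1]) auto
  next
    case (insert \<mu> X)
    obtain b where b: "b \<in> polys_in N" "b \<noteq> 0" "\<forall>\<mu>\<in>X. \<exists>a\<in>polys_in N. Fract b 1 * lookup x \<mu> = Fract a 1"
      using insert by blast
    have "lookup x \<mu> \<in> frac_in N" using x by (simp add: frac_polys_def)
    then obtain p q where pq: "p \<in> polys_in N" "q \<in> polys_in N" "q \<noteq> 0" "lookup x \<mu> = Fract p q"
      unfolding frac_in_def by blast
    have "\<exists>a\<in>polys_in N. Fract (b * q) 1 * lookup x \<nu> = Fract a 1" if \<nu>: "\<nu> \<in> insert \<mu> X" for \<nu>
    proof (cases "\<nu> = \<mu>")
      case True
      then show ?thesis using pq b by (intro bexI[of _ "b * p"]) (auto simp: eq_fract)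
    next
      case False
      then have "\<nu> \<in> X" using \<nu> by blast
      then obtain a where a: "a \<in> polys_in N" "Fract b 1 * lookup x \<nu> = Fract a 1" using b(3) by blast
      have "Fract (b * q) 1 * lookup x \<nu> = Fract q 1 * (Fract b 1 * lookup x \<nu>)"
        by (simp only: Fract_one_mult ac_simps)
      also have "\<dots> = Fract (q * a) 1" unfolding a(2) by (simp only: Fract_one_mult)
      finally show ?thesis using a(1) pq by blast
    qed
    then show ?case using b pq by (intro bexI[of _ "b * q"]) auto
  qed
  from this[of "keys x"] obtain b where b: "b \<in> polys_in N" "b \<noteq> 0"
    "\<And>\<mu>. \<mu> \<in> keys x \<Longrightarrow> \<exists>a\<in>polys_in N. Fract b 1 * lookup x \<mu> = Fract a 1" by auto
  have "x \<in> polys_in L" using x by (simp add: frac_polys_def)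
  from frac_polys_assemble[OF disj this b(3)] b(1,2)
  show "\<exists>b\<in>polys_in N. b \<noteq> 0 \<and> (\<exists>h\<in>polys_in (N \<union> L). Const (Fract b 1) * x = to_frac_polys L h)"
    by metis
next
  assume "\<exists>b\<in>polys_in N. b \<noteq> 0 \<and> (\<exists>h\<in>polys_in (N \<union> L). Const (Fract b 1) * x = to_frac_polys L h)"
  then obtain b h where b: "b \<in> polys_in N" "b \<noteq> 0" "h \<in> polys_in (N \<union> L)"
    "Const (Fract b 1) * x = to_frac_polys L h" by blast
  have "keys x = keys (to_frac_polys L h)"
    using b(2) by (simp add: Fract_one_eq_0_iff keys_Const_mult flip: b(4))
  then have "x \<in> polys_in L"
    by (auto simp: keys_to_frac_polys polys_in_iff vars_def keys_restrict_mono)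
  moreover have "lookup x \<mu> \<in> frac_in N" for \<mu>
  proof -
    have "Fract b 1 * lookup x \<mu> = Fract (lcoeff L \<mu> h) 1"
      using b(4) by (metis lookup_Const_mult lookup_to_frac_polys)
    moreover have one: "Fract 1 b * Fract b 1 = 1" using b(2) by (simp add: One_fract_def eq_fract)
    ultimately have "Fract 1 b * (Fract b 1 * lookup x \<mu>) = Fract 1 b * Fract (lcoeff L \<mu> h) 1" by simp
    then have "lookup x \<mu> = Fract 1 b * Fract (lcoeff L \<mu> h) 1"
      unfolding mult.assoc[symmetric] one by simp
    then have "lookup x \<mu> = Fract (lcoeff L \<mu> h) b" by simp
    then show ?thesis
      using b lcoeff_polys_in[OF b(3)] unfolding frac_in_def by blast
  qed
  ultimately show "x \<in> frac_polys N L" by (simp add: frac_polys_def)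
qed

section \<open>The reduced Groebner basis\<close>

lemma strict_total_order_lex_less:
  assumes "strict_total_order (strict le)"
  shows "strict_total_order (lex_less le)"
proof -
  interpret strict_total_order "strict le" by (fact assms)
  show ?thesis
  proof
    show "\<not> lex_less le m m" for m by (simp add: lex_less_def)
    fix a b c :: "'a mono"
    assume "lex_less le a b" "lex_less le b c"
    then obtain v w where v: "lookup a v < lookup b v" "\<And>x. strict le v x \<Longrightarrow> lookup a x = lookup b x"
      and w: "lookup b w < lookup c w" "\<And>x. strict le w x \<Longrightarrow> lookup b x = lookup c x"
      unfolding lex_less_def by blast
    consider "v = w" | "strict le v w" | "strict le w v" using total by blast
    then show "lex_less le a c"
    proof cases
      case 1
      then show ?thesis using v w unfolding lex_less_def by (intro exI[of _ v]) auto
    next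
      case 2
      have "lookup a x = lookup c x" if "strict le w x" for x
        using v(2)[of x] w(2)[of x] trans[OF 2 that] that by simp
      then show ?thesis using v(2)[OF 2] w(1) unfolding lex_less_def by (intro exI[of _ w]) auto
    next
      case 3
      have "lookup a x = lookup c x" if "strict le v x" for x
        using v(2)[of x] w(2)[of x] trans[OF 3 that] that by simp
      then show ?thesis using w(2)[OF 3] v(1) unfolding lex_less_def by (intro exI[of _ v]) auto
    qed
  next
    fix a b :: "'a mono"
    assume "a \<noteq> b"
    let ?D = "{v. lookup a v \<noteq> lookup b v}"
    have "?D \<subseteq> keys a \<union> keys b" by (auto simp: in_keys_iff)
    then have "finite ?D" by (rule finite_subset) auto
    moreover have "?D \<noteq> {}" using \<open>a \<noteq> b\<close> by (auto simp: poly_mapping_eq_iff fun_eq_iff)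
    ultimately obtain v where v: "v \<in> ?D" "\<forall>x\<in>?D. x \<noteq> v \<longrightarrow> strict le x v" using finite_has_max by blast
    have above: "lookup a x = lookup b x" if x: "strict le v x" for x
    proof (rule ccontr)
      assume "lookup a x \<noteq> lookup b x"
      moreover have "x \<noteq> v" using x irrefl by auto
      ultimately have "strict le x v" using v(2) by simp
      then show False using x trans irrefl by blast
    qed
    have "lookup a v < lookup b v \<or> lookup b v < lookup a v" using v(1) by auto
    then show "lex_less le a b \<or> lex_less le b a" using above unfolding lex_less_def by metis
  qed
qed

lemma lead_mono_eqI:
  assumes "strict_total_order (strict le)" "m \<in> keys p" "\<And>m'. m' \<in> keys p \<Longrightarrow> m' \<noteq> m \<Longrightarrow> lex_less le m' m"
  shows "lead_mono le p = m"
proof -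
  interpret strict_total_order "lex_less le" using assms(1) by (rule strict_total_order_lex_less)
  show ?thesis unfolding lead_mono_def
  proof (rule the_equality)
    show "m \<in> keys p \<and> (\<forall>m'\<in>keys p. m' \<noteq> m \<longrightarrow> lex_less le m' m)" using assms(2,3) by simp
    fix n assume n: "n \<in> keys p \<and> (\<forall>m'\<in>keys p. m' \<noteq> n \<longrightarrow> lex_less le m' n)"
    show "n = m"
    proof (rule ccontr)
      assume "n \<noteq> m"
      then have "lex_less le n m" "lex_less le m n" using n assms(2,3) by auto
      then show False using trans irrefl by blast
    qed
  qed
qed

lemma lead_mono:
  assumes "strict_total_order (strict le)" "p \<noteq> 0"
  shows "lead_mono le p \<in> keys p" "m \<in> keys p \<Longrightarrow> m \<noteq> lead_mono le p \<Longrightarrow> lex_less le m (lead_mono le p)"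
proof -
  interpret strict_total_order "lex_less le" using assms(1) by (rule strict_total_order_lex_less)
  obtain l where l: "l \<in> keys p" "\<forall>m\<in>keys p. m \<noteq> l \<longrightarrow> lex_less le m l"
    using finite_has_max[of "keys p"] assms(2) by auto
  then have "lead_mono le p = l" by (intro lead_mono_eqI[OF assms(1)]) auto
  then show "lead_mono le p \<in> keys p" "m \<in> keys p \<Longrightarrow> m \<noteq> lead_mono le p \<Longrightarrow> lex_less le m (lead_mono le p)"
    using l by auto
qed

lemma lex_coeff_nonzero: "strict_total_order (strict le) \<Longrightarrow> p \<noteq> 0 \<Longrightarrow> lex_coeff le p \<noteq> 0"
  using lead_mono(1) by (auto simp: lex_coeff_def in_keys_iff)

lemma lex_coeff_Const_mult:
  fixes p :: "('v, 'a::idom) mpoly"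
  shows "c \<noteq> 0 \<Longrightarrow> lex_coeff le (Const c * p) = c * lex_coeff le p"
  by (simp add: lex_coeff_def lead_mono_def keys_Const_mult lookup_Const_mult)

lemma lex_less_single_iff:
  assumes "strict_total_order (strict le)"
  shows "lex_less le m (single u k) \<longleftrightarrow> lookup m u < k \<and> (\<forall>w. strict le u w \<longrightarrow> lookup m w = 0)"
proof -
  interpret strict_total_order "strict le" by (fact assms)
  have *: "lookup (single u k) w = 0" if "strict le u w" for w
    using that irrefl[of u] by (auto simp: lookup_single when_def)
  show ?thesis
  proof
    assume "lex_less le m (single u k)"
    then obtain v where v: "lookup m v < lookup (single u k) v"
      "\<And>w. strict le v w \<Longrightarrow> lookup m w = lookup (single u k) w"
      unfolding lex_less_def by blast
    from v(1) have "v = u" by (cases "v = u") (auto simp: lookup_single when_def)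
    then show "lookup m u < k \<and> (\<forall>w. strict le u w \<longrightarrow> lookup m w = 0)" using v * by auto
  next
    assume "lookup m u < k \<and> (\<forall>w. strict le u w \<longrightarrow> lookup m w = 0)"
    then show "lex_less le m (single u k)" unfolding lex_less_def using * by (intro exI[of _ u]) auto
  qed
qed

lemma mono_dvd_single_iff: "mono_dvd (single u k) m \<longleftrightarrow> k \<le> lookup m u"
  by (auto simp: mono_dvd_def lookup_single when_def)

lemma mono_dvd_singleD: "mono_dvd m (single u k) \<Longrightarrow> \<exists>j\<le>k. m = single u j"
proof (intro exI conjI)
  assume m: "mono_dvd m (single u k)"
  show "lookup m u \<le> k" using m by (auto simp: mono_dvd_def dest: spec[of _ u])
  show "m = single u (lookup m u)"
  proof (rule poly_mapping_eqI)
    fix v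
    show "lookup m v = lookup (single u (lookup m u)) v"
      using m by (auto simp: mono_dvd_def lookup_single when_def dest!: spec[of _ v] split: if_splits)
  qed
qed

text \<open>A monomial of the coefficient of the top power of the leader is a monomial of \<open>h\<close> with
  that power removed, so the leading monomials of \<open>h\<close> and of its initial correspond.\<close>

lemma lex_coeff_initial:
  fixes h :: "('v, 'a::comm_ring_1) mpoly"
  assumes ord: "strict_total_order (strict le)" and h: "h \<noteq> 0" "d = deg_in u h"
    and vars: "\<And>v. v \<in> vars h \<Longrightarrow> v = u \<or> strict le v u"
  shows "lex_coeff le (coeff_in u d h) = lex_coeff le h"
proof -
  interpret strict_total_order "strict le" by (fact ord)
  define c where "c = coeff_in u d h"
  have c0: "c \<noteq> 0" unfolding c_def h(2) using h(1) by (rule coeff_in_deg_in)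
  define l where "l = lead_mono le c"
  have l: "l \<in> keys c" "\<And>m. m \<in> keys c \<Longrightarrow> m \<noteq> l \<Longrightarrow> lex_less le m l"
    using lead_mono[OF ord c0] by (auto simp: l_def)
  have lu: "lookup l u = 0" and lh: "lookup c l = lookup h (l + single u d)"
    using l(1) by (auto simp: c_def lookup_coeff_in in_keys_iff split: if_splits)
  have "lead_mono le h = l + single u d"
  proof (rule lead_mono_eqI[OF ord])
    show "l + single u d \<in> keys h" using l(1) lh by (simp add: in_keys_iff)
    fix m assume m: "m \<in> keys h" "m \<noteq> l + single u d"
    show "lex_less le m (l + single u d)"
    proof (cases "lookup m u = d")
      case True
      let ?n = "m - single u d"
      have mn: "m = ?n + single u d" using mono_split[of m u] True by simp
      have nu: "lookup ?n u = 0" using True by (simp add: lookup_minus)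
      have "?n \<in> keys c" using m(1) mn nu by (simp add: c_def in_keys_iff lookup_coeff_in)
      moreover have "?n \<noteq> l" using m(2) mn by auto
      ultimately have "lex_less le ?n l" by (rule l(2))
      then have "lex_less le (?n + single u d) (l + single u d)"
        unfolding lex_less_def by (simp add: lookup_add)
      then show ?thesis using mn by simp
    next
      case False
      then have "lookup m u < d" using lookup_le_deg_in[OF m(1), of u] h(2) by simp
      moreover have zero: "lookup n w = 0" if "n \<in> keys h" "strict le u w" for n w
      proof -
        have "w \<notin> vars h" using vars[of w] that(2) irrefl trans by blast
        then show ?thesis using that(1) by (auto simp: in_vars_iff)
      qed
      ultimately show ?thesis
        using zero[OF m(1)] zero[OF \<open>l + single u d \<in> keys h\<close>] lu
        unfolding lex_less_def by (intro exI[of _ u]) (simp add: lookup_add)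
    qed
  qed
  then show ?thesis using lh by (simp add: lex_coeff_def c_def l_def)
qed

locale groebner = charset le I A
  for le :: "('d::finite, 'y::finite) dvar \<Rightarrow> ('d, 'y) dvar \<Rightarrow> bool"
    and I A :: "('d, 'y, 'k::field) dpoly set" +
  fixes GB :: "(('d, 'y) dvar, ('d, 'y, 'k) dpoly fract) mpoly set"
  assumes gb: "reduced_groebner_basis le GB
    (ideal_in (frac_polys (nonleaders (leaders le A)) (leaders le A)) hull
      (to_frac_polys (leaders le A) ` (I \<inter> polys_in (nonleaders (leaders le A) \<union> leaders le A))))"
begin

abbreviation P where "P \<equiv> polys_in (N \<union> L) :: ('d, 'y, 'k) dpoly set"
abbreviation tf where "tf \<equiv> to_frac_polys L :: ('d, 'y, 'k) dpoly \<Rightarrow> _"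
abbreviation J where "J \<equiv> ideal_in (frac_polys N L) hull (tf ` (I \<inter> P))"

lemma disj: "N \<inter> L = {}"
  by (rule nonleaders_disjoint)

lemma N_P: "p \<in> polys_in N \<Longrightarrow> p \<in> P"
  by (auto simp: polys_in_iff)

lemma tf_N: "b \<in> polys_in N \<Longrightarrow> tf b = Const (Fract b 1)"
  by (rule to_frac_polys_free[OF _ disj])

lemma frac_polysI: "b \<in> polys_in N \<Longrightarrow> b \<noteq> 0 \<Longrightarrow> h \<in> P \<Longrightarrow> tf b * x = tf h \<Longrightarrow> x \<in> frac_polys N L"
  unfolding frac_polys_iff[OF disj] using tf_N by metis

lemma frac_polysE: "x \<in> frac_polys N L \<Longrightarrow> \<exists>b\<in>polys_in N. b \<noteq> 0 \<and> (\<exists>h\<in>P. tf b * x = tf h)"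
  unfolding frac_polys_iff[OF disj] using tf_N by metis

lemma tf_one: "tf 1 = 1"
  by (simp add: tf_N Const_def flip: One_fract_def)

lemma tf_frac_polys: "h \<in> P \<Longrightarrow> tf h \<in> frac_polys N L"
  by (rule frac_polysI[of 1 h]) (simp_all add: tf_one)

lemma keys_tf_N_mult: "b \<in> polys_in N \<Longrightarrow> b \<noteq> 0 \<Longrightarrow> keys (tf b * x) = keys x"
  by (simp add: tf_N keys_Const_mult Fract_one_eq_0_iff)

lemma J_clear: 
  assumes "x \<in> J"
  shows "\<exists>b\<in>polys_in N. b \<noteq> 0 \<and> (\<exists>f\<in>I \<inter> P. tf b * x = tf f)"
    and "ideal_in (frac_polys N L) J"
proof -
  define J' where "J' = {x. \<exists>b\<in>polys_in N. b \<noteq> 0 \<and> (\<exists>f\<in>I \<inter> P. tf b * x = tf f)}"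
  have J'I: "x \<in> J'" if "b \<in> polys_in N" "b \<noteq> 0" "f \<in> I \<inter> P" "tf b * x = tf f" for b f x
    unfolding J'_def using that by blast
  have ideal': "ideal_in (frac_polys N L) J'"
    unfolding ideal_in_def
  proof (intro conjI ballI)
    show "J' \<subseteq> frac_polys N L" unfolding J'_def using frac_polysI by blast
    show "0 \<in> J'" using ideal_zero by (intro J'I[of 1 0]) auto
    fix x y assume "x \<in> J'" "y \<in> J'"
    then obtain b f b' f' where b: "b \<in> polys_in N" "b \<noteq> 0" "f \<in> I" "f \<in> P" "tf b * x = tf f"
      and b': "b' \<in> polys_in N" "b' \<noteq> 0" "f' \<in> I" "f' \<in> P" "tf b' * y = tf f'"
      unfolding J'_def by blast
    have "tf (b * b') * (x + y) = tf b' * (tf b * x) + tf b * (tf b' * y)"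
      by (simp only: to_frac_polys_mult algebra_simps)
    also have "\<dots> = tf (b' * f + b * f')" by (simp only: b b' to_frac_polys_mult to_frac_polys_add)
    finally have eq: "tf (b * b') * (x + y) = tf (b' * f + b * f')" .
    have "b' * f + b * f' \<in> I \<inter> P"
      using b b' N_P ideal_add ideal_mult by blast
    then show "x + y \<in> J'" using b(1,2) b'(1,2) by (intro J'I[OF _ _ _ eq]) auto
  next
    fix r x :: "(('d, 'y) dvar, ('d, 'y, 'k) dpoly fract) mpoly"
    assume "r \<in> frac_polys N L" "x \<in> J'"
    then obtain b h b' f where b: "b \<in> polys_in N" "b \<noteq> 0" "h \<in> P" "tf b * r = tf h"
      and b': "b' \<in> polys_in N" "b' \<noteq> 0" "f \<in> I" "f \<in> P" "tf b' * x = tf f"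
      using frac_polysE unfolding J'_def by blast
    have "tf (b * b') * (r * x) = (tf b * r) * (tf b' * x)"
      by (simp only: to_frac_polys_mult ac_simps)
    also have "\<dots> = tf (h * f)" by (simp only: b b' to_frac_polys_mult)
    finally have eq: "tf (b * b') * (r * x) = tf (h * f)" .
    have "h * f \<in> I \<inter> P" using b b' ideal_mult by blast
    then show "r * x \<in> J'" using b(1,2) b'(1,2) by (intro J'I[OF _ _ _ eq]) auto
  qed
  have gen: "tf ` (I \<inter> P) \<subseteq> J'"
    using J'I[of 1] by (auto simp: tf_one)
  have "J \<subseteq> J'" using gen ideal' by (rule hull_minimal)
  then show "\<exists>b\<in>polys_in N. b \<noteq> 0 \<and> (\<exists>f\<in>I \<inter> P. tf b * x = tf f)"
    using assms unfolding J'_def by blast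
  show "ideal_in (frac_polys N L) J" using ideal' gen by (rule ideal_in_hull)
qed

lemma tf_J: "f \<in> I \<Longrightarrow> f \<in> P \<Longrightarrow> tf f \<in> J"
  by (rule hull_inc) blast

lemma J_diff: "x \<in> J \<Longrightarrow> y \<in> J \<Longrightarrow> b \<in> P \<Longrightarrow> x - tf b * y \<in> J"
proof -
  assume xy: "x \<in> J" "y \<in> J" "b \<in> P"
  note J = J_clear(2)[OF xy(1)]
  have "tf (- b) * y \<in> J" using xy by (intro ideal_inD(4)[OF J] tf_frac_polys) auto
  then have "x + tf (- b) * y \<in> J" using xy(1) by (intro ideal_inD(3)[OF J])
  moreover have "tf (- b) = - tf b"
    using additive_diff[of tf 0 b, OF to_frac_polys_add] by simp
  ultimately show ?thesis by simp
qed

lemma J_reduced_zero: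
  assumes x: "x \<in> J" and red: "\<And>m u. m \<in> keys x \<Longrightarrow> u \<in> L \<Longrightarrow> lookup m u < d u"
  shows "x = 0"
proof -
  obtain b f where b: "b \<in> polys_in N" "b \<noteq> 0" and f: "f \<in> I" "f \<in> P" "tf b * x = tf f"
    using J_clear(1)[OF x] by blast
  have keys: "keys x = restrict_mono L ` keys f"
    using keys_tf_N_mult[OF b, of x] by (simp add: f(3) keys_to_frac_polys)
  have "f = 0"
  proof (rule reduced_zero[OF f(1,2)])
    fix u assume u: "u \<in> L"
    have "lookup m u \<le> d u - 1" if "m \<in> keys f" for m
      using red[of "restrict_mono L m", OF _ u] that u by (simp add: keys lookup_restrict_mono)
    then have "deg_in u f \<le> d u - 1" unfolding deg_in_le_iff by blast
    then show "deg_in u f < d u" using d_pos[OF u] by simp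
  qed
  then show ?thesis using keys by simp
qed

lemma GB_J: "g \<in> GB \<Longrightarrow> g \<in> J" and GB_nonzero: "g \<in> GB \<Longrightarrow> g \<noteq> 0"
  and GB_divides: "f \<in> J \<Longrightarrow> f \<noteq> 0 \<Longrightarrow> \<exists>g\<in>GB. mono_dvd (lead_mono le g) (lead_mono le f)"
  and GB_monic: "g \<in> GB \<Longrightarrow> lex_coeff le g = 1"
  and GB_reduced: "g \<in> GB \<Longrightarrow> h \<in> GB \<Longrightarrow> h \<noteq> g \<Longrightarrow> m \<in> keys g \<Longrightarrow> \<not> mono_dvd (lead_mono le h) m"
  using gb unfolding reduced_groebner_basis_def by blast+

lemmas lead_mono' = lead_mono[OF ord.strict_total_order_axioms]
lemmas lex_less_single' = lex_less_single_iff[OF ord.strict_total_order_axioms]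

text \<open>The polynomial whose primitive part will be the element with leader \<open>u\<close> of the canonical
  characteristic set.\<close>

definition reduced_monic :: "('d, 'y) dvar \<Rightarrow> ('d, 'y, 'k) dpoly \<Rightarrow> ('d, 'y, 'k) dpoly \<Rightarrow> bool"
  where "reduced_monic u \<beta> E \<longleftrightarrow> \<beta> \<in> polys_in {v \<in> N. lt v u} \<and> \<beta> \<noteq> 0 \<and> E \<in> I \<and>
    E - \<beta> * Var u ^ d u \<in> polys_in {v \<in> N \<union> L. v = u \<or> lt v u} \<and>
    (\<forall>w\<in>L. deg_in w (E - \<beta> * Var u ^ d u) < d w)"

lemma reduced_monic_exists': "u \<in> L \<Longrightarrow> \<exists>\<beta> E. reduced_monic u \<beta> E"
proof -
  assume "u \<in> L"
  from reduced_monic_exists[OF this] obtain \<beta> r where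
    "\<beta> \<in> polys_in {v \<in> N. lt v u}" "\<beta> \<noteq> 0" "r \<in> polys_in {v \<in> N \<union> L. v = u \<or> lt v u}"
    "\<forall>w\<in>L. deg_in w r < d w" "\<beta> * Var u ^ d u + r \<in> I" by blast
  then have "reduced_monic u \<beta> (\<beta> * Var u ^ d u + r)" by (simp add: reduced_monic_def)
  then show ?thesis by blast
qed

lemma reduced_monic:
  assumes u: "u \<in> L" and E: "reduced_monic u \<beta> E"
  shows "\<beta> \<in> polys_in N" "\<beta> \<noteq> 0" "E \<in> I" "E \<in> polys_in {v \<in> N \<union> L. v = u \<or> lt v u}" "E \<in> P"
    "coeff_in u (d u) E = \<beta>" "deg_in u E = d u" "\<And>w. w \<in> L \<Longrightarrow> w \<noteq> u \<Longrightarrow> deg_in w E < d w"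
    "lookup (tf E) (single u (d u)) = Fract \<beta> 1"
    "\<And>m. m \<in> keys (tf E) \<Longrightarrow> m \<noteq> single u (d u) \<Longrightarrow>
       lex_less le m (single u (d u)) \<and> (\<forall>w\<in>L. lookup m w < d w)"
proof -
  define r where "r = E - \<beta> * Var u ^ d u"
  have Er: "E = \<beta> * Var u ^ d u + r" by (simp add: r_def)
  let ?U = "{v \<in> N \<union> L. v = u \<or> lt v u}"
  have \<beta>: "\<beta> \<in> polys_in {v \<in> N. lt v u}" "\<beta> \<noteq> 0" and r: "r \<in> polys_in ?U" "\<And>w. w \<in> L \<Longrightarrow> deg_in w r < d w"
    using E by (auto simp: reduced_monic_def r_def)
  show "E \<in> I" "\<beta> \<noteq> 0" using E by (auto simp: reduced_monic_def)
  show \<beta>N: "\<beta> \<in> polys_in N" using \<beta>(1) by (rule polys_in_mono[rotated]) auto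
  have "\<beta> \<in> polys_in ?U" using \<beta>(1) by (rule polys_in_mono[rotated]) auto
  then show EU: "E \<in> polys_in ?U" unfolding Er using r(1) u by blast
  then show "E \<in> P" by (rule polys_in_mono[rotated]) auto
  have u\<beta>: "u \<notin> vars \<beta>" using \<beta>(1) ord.irrefl by (auto simp: polys_in_iff)
  have coeff: "coeff_in u j E = (if j = d u then \<beta> else 0) + coeff_in u j r" for j
    unfolding Er coeff_in_add coeff_in_mult_Var_power[OF u\<beta>] ..
  show cE: "coeff_in u (d u) E = \<beta>" using r(2)[OF u] by (simp add: coeff coeff_in_gt)
  show "deg_in u E = d u"
  proof (rule deg_in_eqI)
    show "coeff_in u (d u) E \<noteq> 0" using cE \<beta>(2) by simp
    show "coeff_in u j E = 0" if "d u < j" for j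
      using that r(2)[OF u] coeff_in_gt[of u r j] by (simp add: coeff)
  qed
  show "deg_in w E < d w" if w: "w \<in> L" "w \<noteq> u" for w
  proof -
    have "w \<notin> vars \<beta>" using \<beta>N w(1) disj by (auto simp: polys_in_iff)
    moreover have "w \<notin> vars ((Var u :: ('d, 'y, 'k) dpoly) ^ d u)"
      using vars_Var_power[of u "d u"] w(2) by auto
    ultimately have "w \<notin> vars (\<beta> * Var u ^ d u)" using vars_mult_subset[of \<beta> "Var u ^ d u"] by blast
    then show ?thesis
      using deg_in_add_le[of w "\<beta> * Var u ^ d u" r] r(2)[OF w(1)] by (simp add: Er deg_in_free)
  qed
  have "tf (Var u ^ d u) = single (single u (d u)) 1"
    unfolding Var_power using u by (intro to_frac_polys_monomial) simp
  then have tfE: "tf E = single (single u (d u)) (Fract \<beta> 1) + tf r"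
    by (simp add: Er to_frac_polys_add to_frac_polys_mult tf_N[OF \<beta>N] Const_def mult_single)
  have keys_r: "(\<forall>w\<in>L. lookup m w < d w) \<and> (\<forall>w. lt u w \<longrightarrow> lookup m w = 0)" if m: "m \<in> keys (tf r)" for m
  proof -
    obtain n where n: "n \<in> keys r" "m = restrict_mono L n" using m by (auto simp: keys_to_frac_polys)
    have "lookup m w < d w" if "w \<in> L" for w
      using lookup_le_deg_in[OF n(1), of w] r(2)[OF that] that by (simp add: n(2) lookup_restrict_mono)
    moreover have "lookup m w = 0" if "lt u w" for w
    proof -
      have "w \<notin> ?U" using that ord.trans ord.irrefl by blast
      then have "w \<notin> vars r" using r(1) by (auto simp: polys_in_iff)
      then have "lookup n w = 0" using n(1) by (auto simp: in_vars_iff)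
      then show ?thesis by (simp add: n(2) lookup_restrict_mono)
    qed
    ultimately show ?thesis by blast
  qed
  have "single u (d u) \<notin> keys (tf r)" using keys_r u by fastforce
  then show "lookup (tf E) (single u (d u)) = Fract \<beta> 1" by (simp add: tfE lookup_add in_keys_iff)
  show "lex_less le m (single u (d u)) \<and> (\<forall>w\<in>L. lookup m w < d w)"
    if m: "m \<in> keys (tf E)" "m \<noteq> single u (d u)" for m
  proof -
    have "m \<in> keys (tf r)" using m by (auto simp: tfE lookup_add in_keys_iff lookup_single when_def)
    then show ?thesis using keys_r u by (auto simp: lex_less_single')
  qed
qed

end

lemma Const_eq_0_iff: "Const c = 0 \<longleftrightarrow> c = 0"
  unfolding Const_def by (metis lookup_single_eq lookup_zero single_zero)

context groebner
begin

lemma GB_leader: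
  assumes u: "u \<in> L"
  shows "\<exists>g\<in>GB. lead_mono le g = single u (d u)"
proof -
  obtain \<beta> E where E: "reduced_monic u \<beta> E" using reduced_monic_exists'[OF u] by blast
  note rm = reduced_monic[OF u E]
  have key: "single u (d u) \<in> keys (tf E)"
    using rm(2,9) by (simp add: in_keys_iff Fract_one_eq_0_iff)
  have lm: "lead_mono le (tf E) = single u (d u)"
    using rm(10) by (intro lead_mono_eqI[OF ord.strict_total_order_axioms key]) blast
  have "tf E \<noteq> 0" using key by auto
  then obtain g where g: "g \<in> GB" "mono_dvd (lead_mono le g) (single u (d u))"
    using GB_divides[OF tf_J[OF rm(3,5)]] lm by auto
  then obtain k where k: "k \<le> d u" "lead_mono le g = single u k" using mono_dvd_singleD[OF g(2)] by blast
  have "k = d u"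
  proof (rule ccontr)
    assume "k \<noteq> d u"
    then have kd: "k < d u" using k(1) by simp
    have g0: "g \<noteq> 0" using GB_nonzero[OF g(1)] .
    have lex: "m = single u k \<or> lex_less le m (single u k)" if "m \<in> keys g" for m
      using lead_mono'(2)[OF g0 that] k(2) by auto
    obtain b f where b: "b \<in> polys_in N" "b \<noteq> 0" and f: "f \<in> I" "f \<in> P" "tf b * g = tf f"
      using J_clear(1)[OF GB_J[OF g(1)]] by blast
    have keys: "keys g = restrict_mono L ` keys f"
      using keys_tf_N_mult[OF b, of g] by (simp add: f(3) keys_to_frac_polys)
    have res: "lookup m u \<le> k \<and> (\<forall>w\<in>L. lt u w \<longrightarrow> lookup m w = 0) \<and>
        (lookup m u = k \<longrightarrow> (\<forall>w\<in>L. w \<noteq> u \<longrightarrow> lookup m w = 0))" if m: "m \<in> keys f" for m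
    proof -
      have lk: "lookup (restrict_mono L m) w = lookup m w" if "w \<in> L" for w
        using that by (simp add: lookup_restrict_mono)
      from lex[of "restrict_mono L m"] m consider "restrict_mono L m = single u k"
        | "lookup (restrict_mono L m) u < k" "\<forall>w. lt u w \<longrightarrow> lookup (restrict_mono L m) w = 0"
        unfolding keys lex_less_single' by blast
      then show ?thesis
      proof cases
        case 1
        then have "lookup m w = lookup (single u k) w" if "w \<in> L" for w using lk[OF that] by simp
        then show ?thesis using u ord.irrefl by (auto simp: lookup_single when_def)
      next
        case 2
        then show ?thesis using lk u by auto
      qed
    qed
    have "vars f \<subseteq> N \<union> {w \<in> L. w = u \<or> lt w u}"
    proof
      fix w assume w: "w \<in> vars f"
      then obtain m where m: "m \<in> keys f" "lookup m w \<noteq> 0" by (auto simp: in_vars_iff)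
      have "\<not> lt u w" if "w \<in> L"
      proof
        assume "lt u w"
        then have "lookup m w = 0" using res[OF m(1)] that by simp
        then show False using m(2) by simp
      qed
      then show "w \<in> N \<union> {w \<in> L. w = u \<or> lt w u}"
        using w f(2) ord.total[of w u] by (auto simp: polys_in_iff)
    qed
    moreover have "deg_in u f \<le> k" using res unfolding deg_in_le_iff by blast
    ultimately have cI: "coeff_in u k f \<in> I"
      using kd u by (intro coeff_in_ideal[OF f(1)]) (auto simp: polys_in_iff)
    have "coeff_in u k f \<in> polys_in N"
      unfolding polys_in_iff
    proof
      fix w assume w: "w \<in> vars (coeff_in u k f)"
      then have wf: "w \<in> vars f" "w \<noteq> u" using vars_coeff_in[of u k f] by auto
      obtain m where m: "m \<in> keys (coeff_in u k f)" "lookup m w \<noteq> 0" using w by (auto simp: in_vars_iff)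
      then have m': "m + single u k \<in> keys f" "lookup m u = 0"
        by (auto simp: in_keys_iff lookup_coeff_in split: if_splits)
      have "w \<notin> L"
        using res[OF m'(1)] m'(2) m(2) wf(2) by (auto simp: lookup_add)
      then show "w \<in> N" using wf(1) f(2) by (auto simp: polys_in_iff)
    qed
    then have "coeff_in u k f = 0" using cI nonleaders_zero by blast
    moreover have "single u k \<in> restrict_mono L ` keys f"
      using lead_mono'(1)[OF g0] k(2) keys by simp
    then obtain m where m: "m \<in> keys f" "restrict_mono L m = single u k" by force
    have "lookup m u = k" using m(2) u by (metis lookup_restrict_mono lookup_single_eq)
    then have "lookup (coeff_in u k f) (m - single u k) = lookup f m"
      using mono_split[of m u] by (simp add: lookup_coeff_in lookup_minus)
    ultimately show False using m(1) by (simp add: in_keys_iff)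
  qed
  then show ?thesis using g(1) k(2) by blast
qed

lemma GB_cases: "g \<in> GB \<Longrightarrow> \<exists>u\<in>L. lead_mono le g = single u (d u)"
proof (rule ccontr)
  assume g: "g \<in> GB" and no: "\<not> (\<exists>u\<in>L. lead_mono le g = single u (d u))"
  have "g = 0"
  proof (rule J_reduced_zero[OF GB_J[OF g]])
    fix m u assume m: "m \<in> keys g" "u \<in> L"
    obtain h where h: "h \<in> GB" "lead_mono le h = single u (d u)" using GB_leader[OF m(2)] by blast
    then have "h \<noteq> g" using no m(2) by blast
    then have "\<not> mono_dvd (single u (d u)) m" using GB_reduced[OF g h(1) _ m(1)] h(2) by simp
    then show "lookup m u < d u" by (simp add: mono_dvd_single_iff)
  qed
  then show False using GB_nonzero[OF g] by blast
qed

lemma GB_reduced_monic: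
  assumes g: "g \<in> GB" "lead_mono le g = single u (d u)" and u: "u \<in> L" and E: "reduced_monic u \<beta> E"
  shows "tf E = tf \<beta> * g"
proof -
  note rm = reduced_monic[OF u E]
  let ?x = "tf E - tf \<beta> * g"
  have g0: "g \<noteq> 0" using GB_nonzero[OF g(1)] .
  have "?x = 0"
  proof (rule J_reduced_zero)
    show "?x \<in> J" using tf_J[OF rm(3,5)] GB_J[OF g(1)] N_P[OF rm(1)] by (rule J_diff)
    fix m w assume m: "m \<in> keys ?x" and w: "w \<in> L"
    have look: "lookup ?x m = lookup (tf E) m - Fract \<beta> 1 * lookup g m" for m
      by (simp add: lookup_minus tf_N[OF rm(1)] lookup_Const_mult)
    have "lookup g (single u (d u)) = 1"
      using GB_monic[OF g(1)] g(2) by (simp add: lex_coeff_def)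
    then have "lookup ?x (single u (d u)) = 0" by (simp add: look rm(9))
    then have mu: "m \<noteq> single u (d u)" using m by (auto simp: in_keys_iff)
    have "m \<in> keys (tf E) \<or> m \<in> keys g" using m by (auto simp: in_keys_iff look)
    then show "lookup m w < d w"
    proof
      assume "m \<in> keys (tf E)"
      then show ?thesis using rm(10) mu w by blast
    next
      assume mg: "m \<in> keys g"
      show ?thesis
      proof (cases "w = u")
        case True
        then show ?thesis using lead_mono'(2)[OF g0 mg] mu by (simp add: g(2) lex_less_single')
      next
        case False
        obtain h where h: "h \<in> GB" "lead_mono le h = single w (d w)" using GB_leader[OF w] by blast
        have "lookup (single w (d w)) w \<noteq> lookup (single u (d u)) w"
          using False d_pos[OF w] by (auto simp: lookup_single when_def)
        then have "h \<noteq> g" using h(2) g(2) by auto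
        then have "\<not> mono_dvd (single w (d w)) m" using GB_reduced[OF g(1) h(1) _ mg] h(2) by simp
        then show ?thesis by (simp add: mono_dvd_single_iff)
      qed
    qed
  qed
  then show ?thesis by simp
qed

definition reduced_pair :: "('d, 'y) dvar \<Rightarrow> ('d, 'y, 'k) dpoly \<times> ('d, 'y, 'k) dpoly"
  where "reduced_pair u = (SOME p. reduced_monic u (fst p) (snd p))"

definition \<beta> where "\<beta> u = fst (reduced_pair u)"
definition E where "E u = snd (reduced_pair u)"

lemma reduced_pair: "u \<in> L \<Longrightarrow> reduced_monic u (\<beta> u) (E u)"
  unfolding \<beta>_def E_def reduced_pair_def using reduced_monic_exists'[of u]
  by (intro someI_ex[of "\<lambda>p. reduced_monic u (fst p) (snd p)"]) auto

lemma E: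
  assumes u: "u \<in> L"
  shows "\<beta> u \<in> polys_in N" "\<beta> u \<noteq> 0" "E u \<in> I" "E u \<in> polys_in {v \<in> N \<union> L. v = u \<or> lt v u}" "E u \<in> P"
    "coeff_in u (d u) (E u) = \<beta> u" "deg_in u (E u) = d u"
    "\<And>w. w \<in> L \<Longrightarrow> w \<noteq> u \<Longrightarrow> deg_in w (E u) < d w"
    "lookup (tf (E u)) (single u (d u)) = Fract (\<beta> u) 1"
  using reduced_monic[OF u reduced_pair[OF u]] by simp_all

definition is_lcm :: "('d, 'y) dvar \<Rightarrow> ('d, 'y, 'k) dpoly \<Rightarrow> bool"
  where "is_lcm u c \<longleftrightarrow> lcm_in (polys_in N)
    {b. \<exists>m\<in>keys (tf (E u)). denominator_in N (Fract (lcoeff L m (E u)) (\<beta> u)) b} c"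

lemma is_lcm_iff: "u \<in> L \<Longrightarrow> is_lcm u c \<longleftrightarrow>
  c \<in> polys_in N \<and> (\<forall>m\<in>keys (tf (E u)). \<beta> u dvd c * lcoeff L m (E u)) \<and>
    (\<forall>c'\<in>polys_in N. (\<forall>m\<in>keys (tf (E u)). \<beta> u dvd c' * lcoeff L m (E u)) \<longrightarrow> c dvd c')"
  unfolding is_lcm_def by (rule lcm_in_denominators_iff) (simp_all add: E(1,2,5) lcoeff_polys_in)

lemma is_lcm_exists: "u \<in> L \<Longrightarrow> \<exists>c. is_lcm u c"
  unfolding is_lcm_def by (rule lcm_in_denominators_exists) (simp_all add: E(1,2,5) lcoeff_polys_in)

lemma GB_coeffs:
  assumes g: "g \<in> GB" "lead_mono le g = single u (d u)" and u: "u \<in> L"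
  shows "keys g = keys (tf (E u))" "lookup g m = Fract (lcoeff L m (E u)) (\<beta> u)"
proof -
  have eq: "tf (E u) = tf (\<beta> u) * g" using GB_reduced_monic[OF g u reduced_pair[OF u]] .
  show "keys g = keys (tf (E u))" unfolding eq by (simp add: keys_tf_N_mult E(1,2) u)
  have "Fract (lcoeff L m (E u)) 1 = Fract (\<beta> u) 1 * lookup g m"
    using arg_cong[OF eq, of "\<lambda>p. lookup p m"]
    by (simp add: lookup_to_frac_polys tf_N[OF E(1)[OF u]] lookup_Const_mult)
  then have "Fract 1 (\<beta> u) * Fract (lcoeff L m (E u)) 1 = Fract 1 (\<beta> u) * Fract (\<beta> u) 1 * lookup g m"
    by (simp only: mult.assoc)
  also have "Fract 1 (\<beta> u) * Fract (\<beta> u) 1 = 1" using E(2)[OF u] by (simp add: One_fract_def eq_fract)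
  finally show "lookup g m = Fract (lcoeff L m (E u)) (\<beta> u)" by simp
qed

lemma GB_is_lcm:
  assumes g: "g \<in> GB" "lead_mono le g = single u (d u)" and u: "u \<in> L"
  shows "lcm_in (polys_in N) {b. \<exists>m\<in>keys g. denominator_in N (lookup g m) b} c \<longleftrightarrow> is_lcm u c"
  unfolding is_lcm_def GB_coeffs[OF assms] ..

abbreviation D where "D \<equiv> clear_denominators le N L GB"

abbreviation normalize_lex :: "('d, 'y, 'k) dpoly \<Rightarrow> ('d, 'y, 'k) dpoly"
  where "normalize_lex h \<equiv> Const (inverse (lex_coeff le h)) * h"

lemma D_cases:
  assumes "f \<in> D"
  shows "\<exists>u\<in>L. \<exists>h c. f = normalize_lex h \<and> is_lcm u c \<and> h \<in> P \<and> \<beta> u * h = c * E u"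
proof -
  obtain h g c where h: "f = normalize_lex h" "h \<in> P" and g: "g \<in> GB"
    and c: "lcm_in (polys_in N) {b. \<exists>m\<in>keys g. denominator_in N (lookup g m) b} c"
    and eq: "tf h = Const (Fract c 1) * g"
    using assms unfolding clear_denominators_def by blast
  obtain u where u: "u \<in> L" "lead_mono le g = single u (d u)" using GB_cases[OF g] by blast
  have lcm: "is_lcm u c" using c GB_is_lcm[OF g u(2,1)] by blast
  have cN: "c \<in> polys_in N" using c by (simp add: lcm_in_def)
  have "tf (\<beta> u * h) = tf (\<beta> u) * (tf c * g)" by (simp only: to_frac_polys_mult eq tf_N[OF cN])
  also have "\<dots> = tf c * (tf (\<beta> u) * g)" by (simp only: ac_simps)
  also have "\<dots> = tf (c * E u)"
    by (simp only: to_frac_polys_mult GB_reduced_monic[OF g u(2,1) reduced_pair[OF u(1)]])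
  finally have "\<beta> u * h = c * E u" by (simp only: to_frac_polys_inject)
  then show ?thesis using u(1) h lcm by blast
qed

lemma D_exists:
  assumes u: "u \<in> L"
  shows "\<exists>h c. normalize_lex h \<in> D \<and> is_lcm u c \<and> h \<in> P \<and> \<beta> u * h = c * E u"
proof -
  obtain g where g: "g \<in> GB" "lead_mono le g = single u (d u)" using GB_leader[OF u] by blast
  obtain c where c: "is_lcm u c" using is_lcm_exists[OF u] by blast
  have cN: "c \<in> polys_in N" using c is_lcm_iff[OF u] by blast
  have "g \<in> polys_in L"
    using GB_J[OF g(1)] ideal_inD(2)[OF J_clear(2)[OF GB_J[OF g(1)]]] by (auto simp: frac_polys_def)
  moreover have "\<exists>a\<in>polys_in N. Fract c 1 * lookup g m = Fract a 1" if m: "m \<in> keys g" for m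
  proof -
    have "\<beta> u dvd c * lcoeff L m (E u)"
      using c m unfolding is_lcm_iff[OF u] GB_coeffs(1)[OF g u] by blast
    then obtain a where a: "c * lcoeff L m (E u) = \<beta> u * a" by blast
    have b0: "\<beta> u \<noteq> 0" using E(2)[OF u] .
    have "\<beta> u * a \<in> polys_in N" unfolding a[symmetric] using cN lcoeff_polys_in[OF E(5)[OF u]] by blast
    then have "a \<in> polys_in N" using polys_in_factor(2)[of "\<beta> u" a N] b0 by (cases "a = 0") auto
    moreover have "Fract c 1 * lookup g m = Fract a 1"
      using b0 a unfolding GB_coeffs(2)[OF g u] by (simp add: eq_fract mult.commute)
    ultimately show ?thesis by blast
  qed
  ultimately obtain h where h: "h \<in> P" "tf h = Const (Fract c 1) * g"
    using frac_polys_assemble[OF disj, of g "Fract c 1"] by blast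
  have D: "normalize_lex h \<in> D"
    unfolding clear_denominators_def using h g c GB_is_lcm[OF g u] by blast
  have "tf (\<beta> u * h) = tf (\<beta> u) * (tf c * g)" by (simp only: to_frac_polys_mult h(2) tf_N[OF cN])
  also have "\<dots> = tf c * (tf (\<beta> u) * g)" by (simp only: ac_simps)
  also have "\<dots> = tf (c * E u)"
    by (simp only: to_frac_polys_mult GB_reduced_monic[OF g u reduced_pair[OF u]])
  finally have "\<beta> u * h = c * E u" by (simp only: to_frac_polys_inject)
  then show ?thesis using D c h(1) by blast
qed

lemma cleared:
  assumes u: "u \<in> L" and c: "is_lcm u c" and h: "h \<in> P" "\<beta> u * h = c * E u"
  shows "c \<in> polys_in N" "c \<noteq> 0" "h \<noteq> 0" "h \<in> I" "coeff_in u (d u) h = c" "deg_in u h = d u"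
    "\<And>v. v \<in> vars h \<Longrightarrow> v = u \<or> lt v u" "\<And>w. w \<in> L \<Longrightarrow> w \<noteq> u \<Longrightarrow> deg_in w h < d w"
    "\<And>p. p \<in> polys_in N \<Longrightarrow> p dvd h \<Longrightarrow> p \<in> polys_in {}"
proof -
  note lcm = is_lcm_iff[OF u, THEN iffD1, OF c]
  show cN: "c \<in> polys_in N" using lcm by blast
  have b: "\<beta> u \<in> polys_in N" "\<beta> u \<noteq> 0" using E(1,2)[OF u] by auto
  have "c dvd \<beta> u" using lcm b(1) by simp
  then obtain c' where c': "\<beta> u = c * c'" by blast
  then show c0: "c \<noteq> 0" using b by auto
  have c'0: "c' \<noteq> 0" and c'N: "c' \<in> polys_in N" using b c' polys_in_factor(2)[of c c' N] by auto
  have c'h: "c' * h = E u" using h(2) c0 by (simp add: c' mult.assoc)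
  have E0: "E u \<noteq> 0" using E(6)[OF u] b(2) by auto
  then show h0: "h \<noteq> 0" using c'h by auto
  show "h \<in> I" using torsion_free[OF c'N c'0 h(1)] c'h E(3)[OF u] by simp
  have free: "w \<notin> vars c'" if "w \<in> L" for w using c'N that disj by (auto simp: polys_in_iff)
  have "c' * coeff_in u (d u) h = c' * c"
    using E(6)[OF u] coeff_in_mult_free[OF free[OF u], of "d u" h] by (auto simp: c'h c' mult.commute)
  then show "coeff_in u (d u) h = c" using c'0 by simp
  have deg: "deg_in w h = deg_in w (E u)" if "w \<in> L" for w
    using deg_in_mult[OF c'0 h0, of w] free[OF that] by (simp add: c'h deg_in_free)
  show "deg_in u h = d u" using deg[OF u] E(7)[OF u] by simp
  show "deg_in w h < d w" if "w \<in> L" "w \<noteq> u" for w using deg[OF that(1)] E(8)[OF u that] by simp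
  show "v = u \<or> lt v u" if "v \<in> vars h" for v
  proof -
    have "v \<in> vars (E u)" using vars_mult[OF c'0 h0] that by (simp add: c'h)
    then show ?thesis using E(4)[OF u] by (auto simp: polys_in_iff)
  qed
  show "p \<in> polys_in {}" if p: "p \<in> polys_in N" "p dvd h" for p
  proof -
    obtain w where w: "h = p * w" using p(2) by blast
    have nz: "p \<noteq> 0" "w \<noteq> 0" using h0 w by auto
    have wP: "w \<in> P" using polys_in_factor(2)[of p w "N \<union> L"] h(1) h0 by (simp add: w)
    have co: "\<beta> u * (p * lcoeff L m w) = c * lcoeff L m (E u)" for m
      using arg_cong[OF h(2), of "lcoeff L m"] by (simp only: w lcoeff_mult_free[OF _ disj] b(1) p(1) cN)
    define w0 where "w0 = lcoeff L (single u (d u)) w"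
    have w0N: "w0 \<in> polys_in N" unfolding w0_def using wP by (rule lcoeff_polys_in)
    have "lcoeff L (single u (d u)) (E u) = \<beta> u"
      using E(9)[OF u] by (simp only: lookup_to_frac_polys Fract_one_inject)
    then have "\<beta> u * (p * w0) = \<beta> u * c" using co[of "single u (d u)"] by (simp add: w0_def mult.commute)
    then have c_eq: "c = p * w0" using b(2) by simp
    have "\<beta> u dvd w0 * lcoeff L m (E u)" for m
    proof -
      have "p * (\<beta> u * lcoeff L m w) = p * (w0 * lcoeff L m (E u))"
        using co[of m] by (simp only: c_eq ac_simps)
      then have "\<beta> u * lcoeff L m w = w0 * lcoeff L m (E u)" using nz by simp
      then show ?thesis by (metis dvd_triv_left)
    qed
    then have "c dvd w0" using lcm w0N by blast
    then obtain k where k: "w0 = p * w0 * k" unfolding c_eq by blast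
    have "w0 \<noteq> 0" using c0 c_eq by auto
    have "w0 * (p * k) = p * w0 * k" by (simp only: ac_simps)
    also have "\<dots> = w0 * 1" by (simp only: k[symmetric] mult_1_right)
    finally have "1 = p * k" using \<open>w0 \<noteq> 0\<close> by (simp only: mult_cancel_left) simp
    then have "p dvd 1" by (rule dvdI)
    then show ?thesis by (simp add: dvd_one_iff)
  qed
qed

lemma cleared_unique:
  assumes u: "u \<in> L" and "is_lcm u c" "h \<in> P" "\<beta> u * h = c * E u"
    and "is_lcm u c'" "h' \<in> P" "\<beta> u * h' = c' * E u"
  shows "normalize_lex h = normalize_lex h'"
proof -
  note c = cleared[OF u assms(2-4)] and c' = cleared[OF u assms(5-7)]
  have "c dvd c'" "c' dvd c" using assms(2,5) unfolding is_lcm_iff[OF u] by blast+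
  then obtain e where e: "c' = c * e" by blast
  have "c * e dvd c * 1" using \<open>c' dvd c\<close> e by simp
  then have "e dvd 1" using c(2) dvd_mult_cancel_left[of c e 1] by blast
  then obtain t where t: "e = Const t" using dvd_one_iff polys_in_empty_iff by blast
  have t0: "t \<noteq> 0" using e c'(2) by (auto simp: t Const_def)
  have "\<beta> u * h' = \<beta> u * (Const t * h)" using assms(4,7) by (simp add: e t ac_simps)
  then have h': "h' = Const t * h" using E(2)[OF u] by simp
  have l0: "lex_coeff le h \<noteq> 0" using lex_coeff_nonzero[OF ord.strict_total_order_axioms c(3)] .
  have "inverse (t * lex_coeff le h) * t = inverse (lex_coeff le h)" using t0 l0 by (simp add: field_simps)
  then have "Const (inverse (t * lex_coeff le h)) * Const t = (Const (inverse (lex_coeff le h)) :: ('d, 'y, 'k) dpoly)"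
    by (simp only: Const_def mult_single add_0)
  then show ?thesis unfolding h' lex_coeff_Const_mult[OF t0] mult.assoc[symmetric] by simp
qed

lemma normalize_lex:
  assumes u: "u \<in> L" and c: "is_lcm u c" and h: "h \<in> P" "\<beta> u * h = c * E u" and f: "f = normalize_lex h"
  shows "f \<in> I" "f \<in> P" "f \<notin> polys_in {}" "leader le f = u" "deg_in u f = d u"
    "\<And>w. w \<in> L \<Longrightarrow> w \<noteq> u \<Longrightarrow> deg_in w f < d w" "initial le f \<in> polys_in N"
    "\<And>p. p \<in> polys_in N \<Longrightarrow> p dvd f \<Longrightarrow> p \<in> polys_in {}" "lex_coeff le (initial le f) = 1"
proof -
  note cl = cleared[OF u c h]
  define k where "k = inverse (lex_coeff le h)"
  have l0: "lex_coeff le h \<noteq> 0" using lex_coeff_nonzero[OF ord.strict_total_order_axioms cl(3)] .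
  then have k0: "k \<noteq> 0" by (simp add: k_def)
  have fk: "f = Const k * h" by (simp add: f k_def)
  have kc: "Const k \<in> polys_in V" for V :: "('d, 'y) dvar set" by (simp add: Const_def polys_in_single)
  show "f \<in> I" "f \<in> P" unfolding fk using cl(4) h(1) kc by (auto intro: ideal_mult)
  have keys: "keys f = keys h" unfolding fk using k0 by (rule keys_Const_mult)
  then have vars: "vars f = vars h" and deg: "\<And>w. deg_in w f = deg_in w h"
    by (simp_all add: vars_def deg_in_def)
  show "deg_in u f = d u" "\<And>w. w \<in> L \<Longrightarrow> w \<noteq> u \<Longrightarrow> deg_in w f < d w" using cl(6,8) deg by auto
  have uv: "u \<in> vars f" using \<open>deg_in u f = d u\<close> d_pos[OF u] by (simp add: in_vars_iff_deg)
  then show nc: "f \<notin> polys_in {}" by (auto simp: polys_in_iff)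
  show lf: "leader le f = u"
    using leader[OF ranking nc] cl(7) uv vars ord.trans ord.irrefl by metis
  have "u \<notin> vars (Const k :: ('d, 'y, 'k) dpoly)" using kc[of "{}"] by (auto simp: polys_in_iff)
  then have ini: "initial le f = Const k * c"
    unfolding initial_def lf \<open>deg_in u f = d u\<close> by (simp add: fk coeff_in_mult_free cl(5))
  show "initial le f \<in> polys_in N" unfolding ini using kc cl(1) by blast
  have "lex_coeff le c = lex_coeff le h"
    using lex_coeff_initial[OF ord.strict_total_order_axioms cl(3) refl cl(7)] by (simp add: cl(5,6))
  then show "lex_coeff le (initial le f) = 1"
    unfolding ini lex_coeff_Const_mult[OF k0] using l0 by (simp add: k_def)
  show "p \<in> polys_in {}" if p: "p \<in> polys_in N" "p dvd f" for p
  proof -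
    have "Const k dvd (1 :: ('d, 'y, 'k) dpoly)"
      using kc k0 by (intro constant_dvd_one) (auto simp: Const_eq_0_iff)
    then have "p dvd h" using p(2) unfolding fk by (rule dvd_mult_unitD)
    then show ?thesis using cl(9) p(1) by blast
  qed
qed

definition D_el :: "('d, 'y) dvar \<Rightarrow> ('d, 'y, 'k) dpoly"
  where "D_el u = (SOME f. \<exists>h c. f \<in> D \<and> f = normalize_lex h \<and> is_lcm u c \<and> h \<in> P \<and> \<beta> u * h = c * E u)"

lemma D_el: "u \<in> L \<Longrightarrow> \<exists>h c. D_el u \<in> D \<and> D_el u = normalize_lex h \<and> is_lcm u c \<and> h \<in> P \<and> \<beta> u * h = c * E u"
  unfolding D_el_def by (rule someI_ex) (use D_exists[of u] in blast)

lemma D_eq: "D = D_el ` L"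
proof (intro equalityI subsetI)
  fix f assume "f \<in> D"
  from D_cases[OF this] obtain u h c where u: "u \<in> L"
    and f: "f = normalize_lex h" "is_lcm u c" "h \<in> P" "\<beta> u * h = c * E u" by blast
  have "f = D_el u" using D_el[OF u] cleared_unique[OF u f(2-4)] f(1) by metis
  then show "f \<in> D_el ` L" using u by blast
qed (use D_el in blast)

lemma D_el_facts:
  assumes "u \<in> L"
  shows "D_el u \<in> I" "D_el u \<in> P" "D_el u \<notin> polys_in {}" "leader le (D_el u) = u" "deg_in u (D_el u) = d u"
    "\<And>w. w \<in> L \<Longrightarrow> w \<noteq> u \<Longrightarrow> deg_in w (D_el u) < d w" "initial le (D_el u) \<in> polys_in N"
    "\<And>p. p \<in> polys_in N \<Longrightarrow> p dvd D_el u \<Longrightarrow> p \<in> polys_in {}" "lex_coeff le (initial le (D_el u)) = 1"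
  using D_el[OF assms] normalize_lex[OF assms] by metis+

lemma leaders_D: "leaders le D = L"
  unfolding D_eq leaders_def[of le "D_el ` L"] image_image using D_el_facts(4) by simp

lemma char_set_D: "char_set le D I"
proof -
  have rank: "rank le ` D = rank le ` A"
  proof -
    have "rank le (D_el u) = rank le (el u)" if "u \<in> L" for u
      using D_el_facts(4,5)[OF that] el(2)[OF that] by (simp add: rank_def d_def)
    then have "rank le ` D = (\<lambda>u. rank le (el u)) ` L" unfolding D_eq image_image by simp
    also have "\<dots> = rank le ` A" unfolding leaders_def image_image using el_leader by simp
    finally show ?thesis .
  qed
  have "reduced le f g" if fg: "f \<in> D" "g \<in> D" "f \<noteq> g" for f g
  proof -
    obtain u v where uv: "u \<in> L" "f = D_el u" "v \<in> L" "g = D_el v" using fg(1,2) unfolding D_eq by blast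
    then have "v \<noteq> u" using fg(3) by blast
    then have "deg_in v f < deg_in v g" using D_el_facts uv by metis
    moreover have "act \<theta> v \<notin> vars f" if "\<theta> \<noteq> (\<lambda>_. 0)" for \<theta>
      using proper_derivative[OF uv(3) that] D_el_facts(2)[OF uv(1)] uv(2) by (auto simp: polys_in_iff)
    ultimately show ?thesis using D_el_facts(4)[OF uv(3)] uv(4) by (simp add: reduced_def)
  qed
  then have "autoreduced le D"
    unfolding autoreduced_def D_eq using L_finite D_el_facts(3) by auto
  moreover have "D \<subseteq> I" unfolding D_eq using D_el_facts(1) by auto
  moreover have "lower_rank le B D \<longleftrightarrow> lower_rank le B A" for B :: "('d, 'y, 'k) dpoly set"
    by (simp add: lower_rank_def rank)
  ultimately show ?thesis using char_set by (simp add: char_set_def)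
qed

lemma canonical_D:
  assumes "characterizable \<delta> le I"
  shows "canonical_char_set \<delta> le D I"
proof -
  have "initial le f \<in> polys_in N \<and> (\<forall>p\<in>polys_in N. p dvd f \<longrightarrow> p \<in> polys_in {}) \<and>
      lex_coeff le (initial le f) = 1" if f: "f \<in> D" for f
  proof -
    obtain u where u: "u \<in> L" "f = D_el u" using f unfolding D_eq by blast
    show ?thesis unfolding u(2) using D_el_facts(7-9)[OF u(1)] by blast
  qed
  then show ?thesis
    unfolding canonical_char_set_def Let_def leaders_D using assms char_set_D by blast
qed

end

theorem proposition6:
  fixes \<delta> :: "'d::finite \<Rightarrow> 'k::field_char_0 \<Rightarrow> 'k"
    and le :: "('d, 'y::finite) dvar \<Rightarrow> ('d, 'y) dvar \<Rightarrow> bool"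
    and F :: "('d, 'y, 'k) dpoly set"
    and n :: nat
    and C :: "nat \<Rightarrow> ('d, 'y, 'k) dpoly set"
    and T :: "nat set"
    and i1 :: nat
    and L N :: "('d, 'y) dvar set"
    and R I' :: "('d, 'y, 'k) dpoly set"
    and GB :: "(('d, 'y) dvar, ('d, 'y, 'k) dpoly fract) mpoly set"
    and D :: "('d, 'y, 'k) dpoly set"
  assumes "commuting_derivations \<delta>"
    and "ranking le"
    and "finite F"
    and "characterizable \<delta> le (radical_diff_ideal \<delta> hull F)"
    and "radical_diff_ideal \<delta> hull F = (\<Inter>i\<in>{1..n}. diff_sat \<delta> le (C i))"
    and "\<And>i. i \<in> {1..n} \<Longrightarrow> characterizable \<delta> le (diff_sat \<delta> le (C i))"
    and "\<And>i. i \<in> {1..n} \<Longrightarrow> char_set le (C i) (diff_sat \<delta> le (C i))"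
    and "T = {i \<in> {1..n}. \<forall>j\<in>{1..n}. \<not> lower_leaders le (leaders le (C i)) (leaders le (C j))}"
    and "i1 \<in> T"
    and "L = leaders le (C i1)"
    and "N = nonleaders L"
    and "R = polys_in (N \<union> L)"
    and "I' = (\<Inter>i\<in>T. alg_sat R le (C i))"
    and "reduced_groebner_basis le GB (ideal_in (frac_polys N L) hull (to_frac_polys L ` I'))"
    and "D = clear_denominators le N L GB"
  shows "canonical_char_set \<delta> le D (radical_diff_ideal \<delta> hull F)"
proof -
  let ?I = "radical_diff_ideal \<delta> hull F"
  let ?I' = "\<lambda>i. diff_sat \<delta> le (C i)"
  note \<delta> = assms(1) and rk = assms(2) and inter = assms(5)
  interpret ord: strict_total_order "strict le" using rk by (rule strict_total_order_ranking)
  obtain A where A: "diff_ideal \<delta> ?I" "char_set le A ?I" "?I = diff_sat \<delta> le A"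
    using assms(4) unfolding characterizable_def by blast
  interpret X: charset le ?I A using \<delta> rk A by (rule charset_of_diff_sat)
  have Y: "charset le (?I' i) (C i)" if "i \<in> {1..n}" for i
    using charset_of_diff_sat[OF \<delta> rk _ assms(7)[OF that] refl] assms(6)[OF that]
    unfolding characterizable_def by blast
  have sub: "?I \<subseteq> ?I' i" if "i \<in> {1..n}" for i using that unfolding inter by blast
  have fin: "finite (leaders le (C i))" if "i \<in> {1..n}" for i
    using charset.L_finite[OF Y[OF that]] .
  define low where "low U V \<longleftrightarrow> (\<exists>v\<in>U - V. \<forall>w. strict le w v \<longrightarrow> (w \<in> U \<longleftrightarrow> w \<in> V))"
    for U V :: "('d, 'y) dvar set"
  have low_iff: "lower_leaders le U V \<longleftrightarrow> low U V" if "finite U" "finite V" for U V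
    unfolding lower_leaders_def low_def using that by (rule ord.seq_lower_increasing_list_iff)
  have not_low: "\<not> low X.L (leaders le (C i))" if i: "i \<in> {1..n}" for i
  proof
    assume "low X.L (leaders le (C i))"
    then obtain v where v: "v \<in> X.L" "v \<notin> leaders le (C i)"
      "\<And>w. strict le w v \<Longrightarrow> w \<in> X.L \<longleftrightarrow> w \<in> leaders le (C i)"
      unfolding low_def by blast
    show False
      by (rule charset_leader_not_lost[OF X.charset_axioms Y[OF i] sub[OF i] v])
  qed
  have low: "low (leaders le (C i)) X.L" if i: "i \<in> {1..n}" "leaders le (C i) \<noteq> X.L" for i
    using ord.finite_sets_differ[OF fin[OF i(1)] X.L_finite i(2)] not_low[OF i(1)]
    unfolding low_def by blast
  have "\<exists>g\<in>?I' i \<inter> polys_in X.N. g \<noteq> 0" if i: "i \<in> {1..n}" "leaders le (C i) \<noteq> X.L" for i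
  proof -
    obtain v where v: "v \<in> leaders le (C i)" "v \<notin> X.L"
      "\<And>w. strict le w v \<Longrightarrow> w \<in> X.L \<longleftrightarrow> w \<in> leaders le (C i)"
      using low[OF i] unfolding low_def by blast
    show ?thesis
      by (rule charset_new_leader_relation[OF X.charset_axioms Y[OF i(1)] sub[OF i(1)] v])
  qed
  then obtain g where g: "\<And>i. i \<in> {1..n} \<Longrightarrow> leaders le (C i) \<noteq> X.L \<Longrightarrow>
      g i \<in> ?I' i \<and> g i \<in> polys_in X.N \<and> g i \<noteq> 0"
    by (metis IntE)
  define G where "G = (\<Prod>i\<in>{i \<in> {1..n}. leaders le (C i) \<noteq> X.L}. g i)"
  have G: "G \<in> polys_in X.N" "G \<noteq> 0" unfolding G_def using g by (auto intro!: polys_in_prod)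
  have G_mem: "G * f \<in> ?I' i" if i: "i \<in> {1..n}" "leaders le (C i) \<noteq> X.L" for f i
  proof -
    interpret Yi: charset le "?I' i" "C i" by (rule Y[OF i(1)])
    have "g i dvd G" unfolding G_def using i by (intro dvd_prodI) auto
    then obtain q where "G = g i * q" by blast
    then have eq: "G * f = q * f * g i" by (simp only: ac_simps)
    show ?thesis unfolding eq using g[OF i] by (intro Yi.ideal_mult) blast
  qed
  have ex: "\<exists>j\<in>{1..n}. leaders le (C j) = X.L"
  proof (rule ccontr)
    assume "\<not> ?thesis"
    then have "G * 1 \<in> ?I' i" if "i \<in> {1..n}" for i using G_mem[OF that, of 1] that by blast
    then have "G \<in> ?I" unfolding inter by simp
    then show False using X.nonleaders_zero G by blast
  qed
  have irr: "\<not> low U U" for U unfolding low_def by blast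
  have T: "T = {i \<in> {1..n}. leaders le (C i) = X.L}"
  proof (intro equalityI subsetI)
    fix i assume i: "i \<in> T"
    then have in1: "i \<in> {1..n}" and max: "\<And>j. j \<in> {1..n} \<Longrightarrow> \<not> low (leaders le (C i)) (leaders le (C j))"
      using low_iff[OF fin fin] unfolding assms(8) by blast+
    then show "i \<in> {i \<in> {1..n}. leaders le (C i) = X.L}" using ex low[OF in1] by force
  next
    fix i assume "i \<in> {i \<in> {1..n}. leaders le (C i) = X.L}"
    then have i: "i \<in> {1..n}" "leaders le (C i) = X.L" by auto
    have "\<not> lower_leaders le (leaders le (C i)) (leaders le (C j))" if j: "j \<in> {1..n}" for j
      using not_low[OF j] low_iff[OF X.L_finite fin[OF j]] unfolding i(2) by blast
    then show "i \<in> T" unfolding assms(8) using i(1) by blast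
  qed
  have L: "L = X.L" using assms(9,10) T by simp
  have N: "N = X.N" using assms(11) L by simp
  have R: "R = polys_in (X.N \<union> X.L)" using assms(12) L N by simp
  have sat: "alg_sat R le (C i) = ?I' i \<inter> R" if "i \<in> T" for i
    using that charset.alg_sat_eq[OF Y, of i] unfolding T R by simp
  have I': "I' = ?I \<inter> R"
  proof (intro equalityI subsetI)
    fix f assume f: "f \<in> I'"
    have fT: "f \<in> ?I' i" "f \<in> R" if "i \<in> T" for i using f sat[OF that] that unfolding assms(13) by blast+
    have fR: "f \<in> R" using fT(2)[OF assms(9)] .
    have "G * f \<in> ?I' i" if i: "i \<in> {1..n}" for i
    proof (cases "leaders le (C i) = X.L")
      case True
      interpret Yi: charset le "?I' i" "C i" by (rule Y[OF i])
      show ?thesis using True i fT(1)[of i] by (intro Yi.ideal_mult) (simp add: T)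
    qed (use G_mem i in blast)
    then have "G * f \<in> ?I" unfolding inter by blast
    then have "f \<in> ?I" using X.torsion_free[OF G] fR R by simp
    then show "f \<in> ?I \<inter> R" using fR by blast
  next
    fix f assume f: "f \<in> ?I \<inter> R"
    show "f \<in> I'"
      unfolding assms(13)
    proof
      fix i assume i: "i \<in> T"
      then show "f \<in> alg_sat R le (C i)" using f sub[of i] unfolding sat[OF i] by (auto simp: T)
    qed
  qed
  interpret groebner le ?I A GB
    by unfold_locales (use assms(14) in \<open>simp only: I' R L N\<close>)
  show ?thesis using canonical_D[OF assms(4)] by (simp only: assms(15) L N)
qed

end
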